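(* Let $F$ be a non-Archimedean local field. Then $\mathbb{P}\mathfrak{gl}_2(F)$ is weakly multiplicity-free as a $PGL_2(F)\times PGL_2(F)$-variety; that is, writing $H=PGL_2(F)\times PGL_2(F)$, for every irreducible admissible representation $\pi$ of $H$ with contragredient $\widetilde{\pi}$, $$\dim \operatorname{Hom}_{H}\bigl(\mathcal{S}(\mathbb{P}\mathfrak{gl}_2(F)),\pi\bigr)\cdot \dim \operatorname{Hom}_{H}\bigl(\mathcal{S}(\mathbb{P}\mathfrak{gl}_2(F)),\widetilde{\pi}\bigr)\le 1 .$$
   Context: $\mathbb{P}\mathfrak{gl}_2(F)$ is the projective space of nonzero $2\times 2$ matrices over $F$ modulo nonzero scalars, with the topology coming from $F$. The group $PGL_2(F)\times PGL_2(F)$ acts on it by $([g],[h]).[x]=[gxh^{-1}]$. For a Hausdorff, locally compact, totally disconnected space $Y$, $\mathcal{S}(Y)$ denotes the space of locally constant compactly supported functions $Y\to\mathbb{C}$. Representations are complex, and admissible has its usual meaning (smooth, with finite-dimensional spaces of invariants under compact open subgroups). The contragredient $\widetilde{\pi}$ is the subrepresentation of smooth vectors in the dual representation $\pi^*$. *)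

theory Defs
  imports
    "HOL-Analysis.Analysis"
    "HOL-Algebra.Coset"
    "HOL-Library.Function_Algebras"
    "HOL-Library.Extended_Nat"
begin

section \<open>Non-Archimedean local fields\<close>

text \<open>
  A field with a nontrivial multiplicative ultrametric absolute value whose
  metric topology is locally compact.  No restriction on the characteristic.
\<close>

class nonarch_local_field = field + metric_space +
  fixes absval :: "'a \<Rightarrow> real"
  assumes dist_absval: "dist x y = absval (x - y)"
    and absval_mult: "absval (x * y) = absval x * absval y"
    and absval_ultrametric: "absval (x + y) \<le> max (absval x) (absval y)"
    and absval_nontrivial: "\<exists>x. x \<noteq> 0 \<and> absval x \<noteq> 1"
    and absval_locally_compact: "\<exists>r>0. compact {x. absval x \<le> r}"


section \<open>Quotient topologies\<close>

definition quotient_topology :: "'x topology \<Rightarrow> ('x \<Rightarrow> 'y) \<Rightarrow> 'y topology" where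
  "quotient_topology X f =
     topology (\<lambda>U. U \<subseteq> f ` topspace X \<and> openin X {x \<in> topspace X. f x \<in> U})"

lemma openin_quotient_topology:
  "openin (quotient_topology X f) U \<longleftrightarrow>
     U \<subseteq> f ` topspace X \<and> openin X {x \<in> topspace X. f x \<in> U}"
proof -
  have "istopology (\<lambda>U. U \<subseteq> f ` topspace X \<and> openin X {x \<in> topspace X. f x \<in> U})"
    unfolding istopology_def
  proof (intro conjI allI impI; (elim conjE)?)
    fix S T
    assume "openin X {x \<in> topspace X. f x \<in> S}" "openin X {x \<in> topspace X. f x \<in> T}"
    moreover have "{x \<in> topspace X. f x \<in> S \<inter> T} =
        {x \<in> topspace X. f x \<in> S} \<inter> {x \<in> topspace X. f x \<in> T}"
      by blast
    ultimately show "openin X {x \<in> topspace X. f x \<in> S \<inter> T}"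
      by (simp add: openin_Int)
  next
    fix \<K>
    assume *: "\<forall>K\<in>\<K>. K \<subseteq> f ` topspace X \<and> openin X {x \<in> topspace X. f x \<in> K}"
    have "{x \<in> topspace X. f x \<in> \<Union>\<K>} = (\<Union>K\<in>\<K>. {x \<in> topspace X. f x \<in> K})"
      by blast
    with * show "openin X {x \<in> topspace X. f x \<in> \<Union>\<K>}"
      by auto
  qed auto
  then show ?thesis
    by (simp add: quotient_topology_def topology_inverse')
qed

lemma topspace_quotient_topology: "topspace (quotient_topology X f) = f ` topspace X"
proof
  have "openin (quotient_topology X f) (f ` topspace X)"
  proof -
    have "{x \<in> topspace X. f x \<in> f ` topspace X} = topspace X" by blast
    then show ?thesis by (simp add: openin_quotient_topology)
  qed
  then show "f ` topspace X \<subseteq> topspace (quotient_topology X f)"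
    by (rule openin_subset)
  show "topspace (quotient_topology X f) \<subseteq> f ` topspace X"
    using openin_topspace[of "quotient_topology X f"] unfolding openin_quotient_topology by simp
qed

lemma quotient_map_quotient_topology: "quotient_map X (quotient_topology X f) f"
  by (simp add: quotient_map_def topspace_quotient_topology openin_quotient_topology)


section \<open>The groups and the projective space of matrices\<close>

definition GL2 :: "('a::nonarch_local_field^2^2) monoid" where
  "GL2 = \<lparr>carrier = {g. invertible g}, mult = (**), one = mat 1\<rparr>"

definition scalars :: "('a::nonarch_local_field^2^2) set" where
  "scalars = {mat c | c. c \<noteq> 0}"

definition PGL2 :: "('a::nonarch_local_field^2^2) set monoid" where
  "PGL2 = GL2 Mod scalars"

definition PGL2_top :: "('a::nonarch_local_field^2^2) set topology" where
  "PGL2_top = quotient_topology (top_of_set (carrier GL2)) (\<lambda>g. scalars #>\<^bsub>GL2\<^esub> g)"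

definition H_group :: "(('a::nonarch_local_field^2^2) set \<times> ('a^2^2) set) monoid" where
  "H_group = PGL2 \<times>\<times> PGL2"

definition H_top :: "(('a::nonarch_local_field^2^2) set \<times> ('a^2^2) set) topology" where
  "H_top = prod_topology PGL2_top PGL2_top"

definition proj_class :: "'a::nonarch_local_field^2^2 \<Rightarrow> ('a^2^2) set" where
  "proj_class x = {mat c ** x | c. c \<noteq> 0}"

text \<open>The space \<open>P(gl\<^sub>2(F))\<close>; its underlying set is \<^term>\<open>topspace Pgl2\<close>.\<close>

definition Pgl2 :: "('a::nonarch_local_field^2^2) set topology" where
  "Pgl2 = quotient_topology (top_of_set (- {0})) proj_class"

text \<open>
  The action \<open>([g],[h]).[x] = [g x h\<^sup>-\<^sup>1]\<close>.  As classes are sets of matrices, the set of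
  all products of representatives is exactly the class on the right-hand side, so that no
  representatives have to be chosen.
\<close>

definition H_act ::
  "('a::nonarch_local_field^2^2) set \<times> ('a^2^2) set \<Rightarrow> ('a^2^2) set \<Rightarrow> ('a^2^2) set" where
  "H_act = (\<lambda>(A, B) X. {g ** x ** matrix_inv h | g x h. g \<in> A \<and> x \<in> X \<and> h \<in> B})"

lemma mat_mult_left: "(mat c ** x) $ i $ j = c * x $ i $ j"
  for x :: "'a::comm_semiring_1^'n^'n"
proof -
  have "(mat c ** x) $ i $ j = (\<Sum>k\<in>UNIV. if k = i then c * x $ k $ j else 0)"
    unfolding matrix_matrix_mult_def mat_def vec_lambda_beta by (rule sum.cong) auto
  then show ?thesis by simp
qed

lemma mat_mult_right: "(x ** mat c) $ i $ j = c * x $ i $ j"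
  for x :: "'a::comm_semiring_1^'n^'n"
proof -
  have "(x ** mat c) $ i $ j = (\<Sum>k\<in>UNIV. if k = j then c * x $ i $ k else 0)"
    unfolding matrix_matrix_mult_def mat_def vec_lambda_beta by (rule sum.cong) (auto simp: mult.commute)
  then show ?thesis by simp
qed

lemma mat_mult_commute: "mat c ** x = x ** mat c" for x :: "'a::comm_semiring_1^'n^'n"
  by (simp add: vec_eq_iff mat_mult_left mat_mult_right)

lemma mat_mult_mat: "mat c ** mat d = (mat (c * d) :: 'a::comm_semiring_1^'n^'n)"
  by (simp add: vec_eq_iff mat_mult_left) (simp add: mat_def)

lemma mat_mult_assoc: "mat a ** (mat b ** x) = mat (a * b) ** x"
  for x :: "'a::comm_semiring_1^'n^'n"
  by (simp add: matrix_mul_assoc mat_mult_mat)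

lemma mat_mult_pull1: "(mat c ** x) ** y = mat c ** (x ** y)"
  for x :: "'a::comm_semiring_1^'n^'n"
  by (rule matrix_mul_assoc[symmetric])

lemma mat_mult_pull2: "x ** (mat c ** y) = mat c ** (x ** y)"
  for x :: "'a::comm_semiring_1^'n^'n"
  by (metis mat_mult_commute matrix_mul_assoc)

lemma invertible_mat: "c \<noteq> 0 \<Longrightarrow> invertible (mat c :: 'a::field^'n^'n)"
  unfolding invertible_def by (rule exI[of _ "mat (inverse c)"]) (simp add: mat_mult_mat)

lemma invertible_matrix_inv:
  "invertible g \<Longrightarrow> g ** matrix_inv g = mat 1 \<and> matrix_inv g ** g = mat 1"
  unfolding invertible_def matrix_inv_def by (rule someI_ex)

lemma group_GL2: "group (GL2 :: ('a::nonarch_local_field^2^2) monoid)"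
proof (rule groupI)
  fix x :: "'a^2^2" assume "x \<in> carrier GL2"
  then show "\<exists>y\<in>carrier GL2. y \<otimes>\<^bsub>GL2\<^esub> x = \<one>\<^bsub>GL2\<^esub>"
    by (auto simp: GL2_def invertible_def)
qed (auto simp: GL2_def invertible_mult matrix_mul_assoc invertible_mat)

lemma inv_GL2: "g \<in> carrier GL2 \<Longrightarrow> inv\<^bsub>GL2\<^esub> g = matrix_inv g"
  using invertible_matrix_inv[of g] group.inv_equality[OF group_GL2, of "matrix_inv g" g]
  by (auto simp: GL2_def invertible_def)

lemma normal_scalars: "(scalars :: ('a::nonarch_local_field^2^2) set) \<lhd> GL2"
proof -
  interpret group "GL2 :: ('a^2^2) monoid" by (rule group_GL2)
  have "subgroup (scalars :: ('a^2^2) set) GL2"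
  proof (rule subgroupI)
    show "scalars \<subseteq> carrier GL2"
      by (auto simp: scalars_def GL2_def invertible_mat)
    show "scalars \<noteq> {}"
      using one_neq_zero unfolding scalars_def by blast
    show "inv\<^bsub>GL2\<^esub> a \<in> scalars" if "a \<in> scalars" for a :: "'a^2^2"
    proof -
      from that obtain c where c: "a = mat c" "c \<noteq> 0" by (auto simp: scalars_def)
      then have "inv\<^bsub>GL2\<^esub> a = mat (inverse c)"
        by (intro inv_equality) (auto simp: GL2_def mat_mult_mat invertible_mat)
      then show ?thesis using c by (auto simp: scalars_def)
    qed
    show "a \<otimes>\<^bsub>GL2\<^esub> b \<in> scalars" if "a \<in> scalars" "b \<in> scalars" for a b :: "'a^2^2"
      using that by (auto simp: scalars_def GL2_def mat_mult_mat)
  qed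
  then show ?thesis
    by (rule normalI) (auto simp: r_coset_def l_coset_def scalars_def GL2_def mat_mult_commute)
qed

lemma group_H: "group H_group"
  unfolding H_group_def PGL2_def
  by (intro DirProd_group normal.factorgroup_is_group normal_scalars)

lemma r_coset_scalars: "scalars #>\<^bsub>GL2\<^esub> g = proj_class g"
  by (auto simp: r_coset_def scalars_def GL2_def proj_class_def)

lemma topspace_PGL2_top: "topspace PGL2_top = carrier PGL2"
  by (simp add: PGL2_top_def PGL2_def topspace_quotient_topology carrier_FactGroup)

lemma H_act_proj_class:
  fixes g h x :: "'a::nonarch_local_field^2^2"
  assumes g: "invertible g" and h: "invertible h"
  shows "H_act (proj_class g, proj_class h) (proj_class x) = proj_class (g ** x ** matrix_inv h)"
proof -
  have inv: "matrix_inv (mat c ** h) = mat (inverse c) ** matrix_inv h" if "c \<noteq> 0" for c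
  proof -
    have "mat c ** h \<in> carrier GL2" using h that by (simp add: GL2_def invertible_mult invertible_mat)
    moreover have "mat (inverse c) ** matrix_inv h \<in> carrier GL2"
      using invertible_matrix_inv[OF h] that
      by (auto simp: GL2_def invertible_def[of "matrix_inv h"] intro!: invertible_mult invertible_mat)
    moreover have "(mat (inverse c) ** matrix_inv h) ** (mat c ** h) = mat 1"
      using that invertible_matrix_inv[OF h]
      by (simp add: mat_mult_pull1 mat_mult_pull2[of "matrix_inv h"] mat_mult_mat)
    ultimately show ?thesis
      using group.inv_equality[OF group_GL2, of "mat (inverse c) ** matrix_inv h" "mat c ** h"]
        inv_GL2[of "mat c ** h"] by (simp add: GL2_def)
  qed
  have move: "(mat a ** g) ** (mat b ** x) ** (mat c ** k) = mat (a * b * c) ** (g ** x ** k)"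
    for a b c and k :: "'a^2^2"
    by (simp add: mat_mult_pull1 mat_mult_pull2[of g] mat_mult_pull2[of "g ** x"]
        mat_mult_assoc mult_ac)
  show ?thesis
  proof (intro equalityI subsetI)
    fix y assume "y \<in> H_act (proj_class g, proj_class h) (proj_class x)"
    then obtain a b c where "a \<noteq> 0" "b \<noteq> 0" "c \<noteq> 0"
      "y = (mat a ** g) ** (mat b ** x) ** matrix_inv (mat c ** h)"
      by (auto simp: H_act_def proj_class_def)
    then have "y = mat (a * b * inverse c) ** (g ** x ** matrix_inv h)" "a * b * inverse c \<noteq> 0"
      by (simp_all add: inv move)
    then show "y \<in> proj_class (g ** x ** matrix_inv h)"
      unfolding proj_class_def by blast
  next
    fix y assume "y \<in> proj_class (g ** x ** matrix_inv h)"
    then obtain a where a: "a \<noteq> 0" "y = mat a ** (g ** x ** matrix_inv h)"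
      by (auto simp: proj_class_def)
    then have "y = (mat a ** g) ** x ** matrix_inv h"
      by (simp add: mat_mult_pull1)
    moreover have "mat a ** g \<in> proj_class g"
      using a(1) unfolding proj_class_def by blast
    moreover have "z \<in> proj_class z" for z :: "'a^2^2"
      unfolding proj_class_def by (rule CollectI, rule exI[of _ 1]) simp
    ultimately show "y \<in> H_act (proj_class g, proj_class h) (proj_class x)"
      unfolding H_act_def case_prod_conv by blast
  qed
qed


section \<open>Complex representations\<close>

text \<open>
  A complex vector space is a subspace \<open>rspace\<close> of an ambient abelian group that is a
  vector space under \<open>rscale\<close>.  Spaces of functions on a set \<open>V\<close> are represented by
  functions on the ambient type that vanish outside \<open>V\<close>.
\<close>

record ('g, 'v) crep =
  rscale :: "complex \<Rightarrow> 'v \<Rightarrow> 'v"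
  rspace :: "'v set"
  ract :: "'g \<Rightarrow> 'v \<Rightarrow> 'v"

definition representation :: "'g monoid \<Rightarrow> ('g, 'v::ab_group_add) crep \<Rightarrow> bool" where
  "representation G \<pi> \<longleftrightarrow>
     vector_space (rscale \<pi>) \<and> module.subspace (rscale \<pi>) (rspace \<pi>) \<and>
     (\<forall>g\<in>carrier G. \<forall>v\<in>rspace \<pi>. ract \<pi> g v \<in> rspace \<pi>) \<and>
     (\<forall>g\<in>carrier G. \<forall>v\<in>rspace \<pi>. \<forall>w\<in>rspace \<pi>.
        ract \<pi> g (v + w) = ract \<pi> g v + ract \<pi> g w) \<and>
     (\<forall>g\<in>carrier G. \<forall>c. \<forall>v\<in>rspace \<pi>. ract \<pi> g (rscale \<pi> c v) = rscale \<pi> c (ract \<pi> g v)) \<and>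
     (\<forall>v\<in>rspace \<pi>. ract \<pi> \<one>\<^bsub>G\<^esub> v = v) \<and>
     (\<forall>g\<in>carrier G. \<forall>h\<in>carrier G. \<forall>v\<in>rspace \<pi>.
        ract \<pi> (g \<otimes>\<^bsub>G\<^esub> h) v = ract \<pi> g (ract \<pi> h v))"

definition irreducible_rep :: "'g monoid \<Rightarrow> ('g, 'v::ab_group_add) crep \<Rightarrow> bool" where
  "irreducible_rep G \<pi> \<longleftrightarrow>
     rspace \<pi> \<noteq> {0} \<and>
     (\<forall>W. module.subspace (rscale \<pi>) W \<and> W \<subseteq> rspace \<pi> \<and>
          (\<forall>g\<in>carrier G. \<forall>w\<in>W. ract \<pi> g w \<in> W) \<longrightarrow> W = {0} \<or> W = rspace \<pi>)"

definition stabilizer_in :: "'g monoid \<Rightarrow> ('g, 'v) crep \<Rightarrow> 'v \<Rightarrow> 'g set" where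
  "stabilizer_in G \<pi> v = {g \<in> carrier G. ract \<pi> g v = v}"

definition smooth_vectors :: "'g monoid \<Rightarrow> 'g topology \<Rightarrow> ('g, 'v) crep \<Rightarrow> 'v set" where
  "smooth_vectors G T \<pi> = {v \<in> rspace \<pi>. openin T (stabilizer_in G \<pi> v)}"

definition invariants :: "('g, 'v) crep \<Rightarrow> 'g set \<Rightarrow> 'v set" where
  "invariants \<pi> K = {v \<in> rspace \<pi>. \<forall>k\<in>K. ract \<pi> k v = v}"

definition finite_dimensional :: "(complex \<Rightarrow> 'v::ab_group_add \<Rightarrow> 'v) \<Rightarrow> 'v set \<Rightarrow> bool" where
  "finite_dimensional s S \<longleftrightarrow> (\<exists>B. finite B \<and> S \<subseteq> module.span s B)"

text \<open>
  The library's \<^const>\<open>vector_space.dim\<close> is \<open>0\<close> on infinite-dimensional spaces; this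
  version is \<open>\<infinity>\<close> there.
\<close>

definition edim :: "(complex \<Rightarrow> 'v::ab_group_add \<Rightarrow> 'v) \<Rightarrow> 'v set \<Rightarrow> enat" where
  "edim s S = (if finite_dimensional s S then enat (vector_space.dim s S) else \<infinity>)"

definition admissible_rep ::
  "'g monoid \<Rightarrow> 'g topology \<Rightarrow> ('g, 'v::ab_group_add) crep \<Rightarrow> bool" where
  "admissible_rep G T \<pi> \<longleftrightarrow>
     smooth_vectors G T \<pi> = rspace \<pi> \<and>
     (\<forall>K. subgroup K G \<and> openin T K \<and> compactin T K \<longrightarrow>
          finite_dimensional (rscale \<pi>) (invariants \<pi> K))"

definition dual_rep ::
  "'g monoid \<Rightarrow> ('g, 'v::ab_group_add) crep \<Rightarrow> ('g, 'v \<Rightarrow> complex) crep" where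
  "dual_rep G \<pi> =
     \<lparr>rscale = (\<lambda>c l v. c * l v),
      rspace = {l. (\<forall>v. v \<notin> rspace \<pi> \<longrightarrow> l v = 0) \<and>
                   (\<forall>v\<in>rspace \<pi>. \<forall>w\<in>rspace \<pi>. l (v + w) = l v + l w) \<and>
                   (\<forall>c. \<forall>v\<in>rspace \<pi>. l (rscale \<pi> c v) = c * l v)},
      ract = (\<lambda>g l v. if v \<in> rspace \<pi> then l (ract \<pi> (inv\<^bsub>G\<^esub> g) v) else 0)\<rparr>"

definition contragredient ::
  "'g monoid \<Rightarrow> 'g topology \<Rightarrow> ('g, 'v::ab_group_add) crep \<Rightarrow> ('g, 'v \<Rightarrow> complex) crep" where
  "contragredient G T \<pi> =
     (dual_rep G \<pi>)\<lparr>rspace := smooth_vectors G T (dual_rep G \<pi>)\<rparr>"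

definition Hom_rep ::
  "'g monoid \<Rightarrow> ('g, 'v::ab_group_add) crep \<Rightarrow> ('g, 'w::ab_group_add) crep \<Rightarrow> ('v \<Rightarrow> 'w) set" where
  "Hom_rep G \<pi> \<sigma> =
     {f. (\<forall>v. v \<notin> rspace \<pi> \<longrightarrow> f v = 0) \<and>
         (\<forall>v\<in>rspace \<pi>. f v \<in> rspace \<sigma>) \<and>
         (\<forall>v\<in>rspace \<pi>. \<forall>w\<in>rspace \<pi>. f (v + w) = f v + f w) \<and>
         (\<forall>c. \<forall>v\<in>rspace \<pi>. f (rscale \<pi> c v) = rscale \<sigma> c (f v)) \<and>
         (\<forall>g\<in>carrier G. \<forall>v\<in>rspace \<pi>. f (ract \<pi> g v) = ract \<sigma> g (f v))}"

definition dim_Hom ::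
  "'g monoid \<Rightarrow> ('g, 'v::ab_group_add) crep \<Rightarrow> ('g, 'w::ab_group_add) crep \<Rightarrow> enat" where
  "dim_Hom G \<pi> \<sigma> = edim (\<lambda>c f v. rscale \<sigma> c (f v)) (Hom_rep G \<pi> \<sigma>)"


section \<open>Locally constant compactly supported functions\<close>

definition schwartz :: "'y topology \<Rightarrow> ('y \<Rightarrow> complex) set" where
  "schwartz Y =
     {f. (\<forall>y. y \<notin> topspace Y \<longrightarrow> f y = 0) \<and>
         (\<forall>y\<in>topspace Y. \<exists>U. openin Y U \<and> y \<in> U \<and> (\<forall>z\<in>U. f z = f y)) \<and>
         compactin Y (Y closure_of {y \<in> topspace Y. f y \<noteq> 0})}"

definition schwartz_rep ::
  "'g monoid \<Rightarrow> ('g \<Rightarrow> 'y \<Rightarrow> 'y) \<Rightarrow> 'y topology \<Rightarrow> ('g, 'y \<Rightarrow> complex) crep" where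
  "schwartz_rep G act Y =
     \<lparr>rscale = (\<lambda>c f y. c * f y),
      rspace = schwartz Y,
      ract = (\<lambda>g f y. if y \<in> topspace Y then f (act (inv\<^bsub>G\<^esub> g) y) else 0)\<rparr>"

end

theory Submission
  imports Defs "HOL-Computational_Algebra.Fundamental_Theorem_Algebra"
begin

text \<open>
  For every irreducible admissible \<open>V\<close> already \<open>Hom(S(P(gl\<^sub>2)), V)\<close> has dimension at most one, and
  the contragredient of \<open>V\<close> is again irreducible and admissible (or zero).

  On the open orbit \<open>PGL\<^sub>2\<close>, two homomorphisms \<open>\<phi>, \<psi>\<close> with \<open>\<phi> \<noteq> 0\<close> satisfy \<open>ker \<phi> \<subseteq> ker \<psi>\<close>, because
  \<open>\<psi>\<close> of the indicator of a small subgroup is a combination of right translates of the same value of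
  \<open>\<phi>\<close>, and right translations commute with left ones; Schur's lemma then gives proportionality.

  A homomorphism \<open>\<phi> \<noteq> 0\<close> vanishing on the open orbit lives on \<open>P\<^sup>1 \<times> P\<^sup>1\<close>.  It is generated by its value \<open>m\<close>
  on one product of discs, it kills functions of one variable only, and hence the Iwahori-fixed
  vectors of \<open>V\<close> are the multiples of \<open>m\<close> (\<open>V\<close> is the tensor square of the Steinberg representation).  The Hecke
  operator \<open>U\<close> that cuts a disc into subdiscs fixes \<open>m\<close>.  For an arbitrary homomorphism \<open>\<psi>\<close>, the
  neighbourhoods \<open>cell'\<close> and \<open>cell\<close> of the product of discs satisfy \<open>\<psi>(cell) = U \<psi>(cell') = \<psi>(cell')\<close>,
  so \<open>\<psi>\<close> kills the difference of their indicators, which is the indicator of the Iwahori subgroup.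
  Therefore \<open>\<psi>\<close> vanishes on the open orbit too: matrix coefficients of the Steinberg representation do
  not extend to the boundary.
\<close>

section \<open>Non-Archimedean local fields\<close>

text \<open>Homomorphisms that agree on the open orbit may differ by one supported on the boundary,
  so two multiplicities could add up; the difficulty is to exclude that both kinds occur for one V.
  The Iwahori subgroup achieves this because, modulo scalars, it is exactly the difference of two
  open extensions of one product of discs, and the subdivision identity \<open>cell\<close> = U
  \<open>cell'\<close> holds on all matrices, not merely on the boundary. The eigenvalue 1 of U, set
  against the number q >= 2 of subdiscs, is also the reason why functions of one variable are
  killed: if one group factor acted trivially on V, then m would equal q m. Schwartz functions are
  pulled back to homogeneous functions of matrices, which reduces the geometry to ultrametric
  estimates of entries, and means over finite orbits of smooth vectors take the place of Haar
  measure. Admissibility enters through finite-dimensional spaces of fixed vectors: an eigenvector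
  there gives Schur's lemma, and duality there carries irreducibility over to the
  contragredient.\<close>

lemma absval_nonneg [simp]: "0 \<le> absval (x::'a::nonarch_local_field)"
  using dist_absval[of x 0] zero_le_dist[of x 0] by simp

lemma absval_eq_0 [simp]: "absval (x::'a::nonarch_local_field) = 0 \<longleftrightarrow> x = 0"
  using dist_absval[of x 0] dist_eq_0_iff[of x 0] by simp

lemma absval_0 [simp]: "absval (0::'a::nonarch_local_field) = 0"
  by (subst absval_eq_0) (rule refl)

lemma absval_pos [simp]: "0 < absval (x::'a::nonarch_local_field) \<longleftrightarrow> x \<noteq> 0"
  using absval_nonneg[of x] absval_eq_0[of x] by linarith

lemma absval_le_0 [simp]: "absval (x::'a::nonarch_local_field) \<le> 0 \<longleftrightarrow> x = 0"
  using absval_nonneg[of x] absval_eq_0[of x] by linarith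

lemma absval_1 [simp]: "absval (1::'a::nonarch_local_field) = 1"
  using absval_mult[of "1::'a" 1] absval_eq_0[of "1::'a"] by simp

lemma absval_minus [simp]: "absval (- x) = absval (x::'a::nonarch_local_field)"
proof -
  have "absval (- x) = dist 0 x" by (simp add: dist_absval)
  also have "\<dots> = dist x 0" by (rule dist_commute)
  also have "\<dots> = absval x" by (simp add: dist_absval)
  finally show ?thesis .
qed

lemma absval_inverse: "absval (inverse x) = inverse (absval (x::'a::nonarch_local_field))"
proof (cases "x = 0")
  case False
  then have "absval x * absval (inverse x) = 1"
    using absval_mult[of x "inverse x"] by simp
  then show ?thesis by (metis inverse_unique)
qed simp

lemma absval_divide: "absval (x / y) = absval x / absval (y::'a::nonarch_local_field)"
  by (simp add: divide_inverse absval_mult absval_inverse)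

lemma absval_power: "absval (x ^ n) = absval (x::'a::nonarch_local_field) ^ n"
  by (induction n) (simp_all add: absval_mult)

lemma absval_minus_commute: "absval (x - y) = absval (y - x :: 'a::nonarch_local_field)"
  using absval_minus[of "x - y"] by simp

lemma absval_add_le:
  "absval x \<le> r \<Longrightarrow> absval y \<le> r \<Longrightarrow> absval (x + y) \<le> r" for x :: "'a::nonarch_local_field"
  using absval_ultrametric[of x y] by simp

lemma absval_add_less:
  "absval x < r \<Longrightarrow> absval y < r \<Longrightarrow> absval (x + y) < r" for x :: "'a::nonarch_local_field"
  using absval_ultrametric[of x y] by simp

lemma absval_diff_le:
  "absval x \<le> r \<Longrightarrow> absval y \<le> r \<Longrightarrow> absval (x - y) \<le> r" for x :: "'a::nonarch_local_field"
  using absval_add_le[of x r "- y"] by simp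

lemma absval_diff_less:
  "absval x < r \<Longrightarrow> absval y < r \<Longrightarrow> absval (x - y) < r" for x :: "'a::nonarch_local_field"
  using absval_add_less[of x r "- y"] by simp

text \<open>The isosceles principle: the ultrametric inequality bounds each of the two values by the
  other. Hence spheres are open, and the conditions defining cells survive small
  perturbations.\<close>

lemma absval_eq_near:
  assumes "absval (y - x) < absval (x::'a::nonarch_local_field)"
  shows "absval y = absval x"
proof (rule antisym)
  have "absval (x + (y - x)) \<le> absval x"
    by (rule absval_add_le) (use assms in simp_all)
  then show "absval y \<le> absval x" by simp
  show "absval x \<le> absval y"
  proof (rule ccontr)
    assume "\<not> ?thesis"
    then have "absval (y - (y - x)) < absval x"
      using assms by (intro absval_diff_less[of y _ "y - x"]) simp_all
    then show False by simp
  qed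
qed

text \<open>The class provides a single compact disc. Some element has absolute value above 1, and a
  power of it stretches that disc until it contains the given one, which is closed.\<close>

lemma compact_absval_le: "compact {x::'a::nonarch_local_field. absval x \<le> R}"
proof -
  obtain r where r: "r > 0" "compact {x::'a. absval x \<le> r}"
    using absval_locally_compact by blast
  obtain u :: 'a where u: "absval u > 1"
  proof -
    obtain x :: 'a where x: "x \<noteq> 0" "absval x \<noteq> 1"
      using absval_nontrivial by blast
    show ?thesis
    proof (cases "absval x > 1")
      case False
      then have "absval (inverse x) > 1"
        using x by (simp add: absval_inverse one_less_inverse)
      then show ?thesis using that by blast
    qed (use that in blast)
  qed
  obtain n where n: "R / r < absval u ^ n"
    using real_arch_pow[OF u] by blast
  define v where "v = u ^ n"
  have v: "v \<noteq> 0" "R \<le> absval v * r"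
    using n u r by (auto simp: v_def absval_power field_simps simp flip: absval_pos)
  have "compact ((\<lambda>x. v * x) ` {x::'a. absval x \<le> r})"
  proof (rule compact_continuous_image[OF _ r(2)])
    show "continuous_on {x. absval x \<le> r} (\<lambda>x. v * x)"
      unfolding continuous_on_iff
    proof (intro ballI allI impI)
      fix x :: 'a and e :: real assume "e > 0"
      then show "\<exists>d>0. \<forall>x'\<in>{x. absval x \<le> r}. dist x' x < d \<longrightarrow> dist (v * x') (v * x) < e"
        using v(1) by (intro exI[of _ "e / absval v"])
          (auto simp: dist_absval right_diff_distrib[symmetric] absval_mult pos_less_divide_eq mult.commute[of _ "absval v"])
    qed
  qed
  moreover have "{x. absval x \<le> R} \<subseteq> (\<lambda>x. v * x) ` {x::'a. absval x \<le> r}"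
  proof
    fix x :: 'a assume "x \<in> {x. absval x \<le> R}"
    then have "absval (x / v) \<le> r"
      using v by (auto simp: absval_divide field_simps)
    then show "x \<in> (\<lambda>x. v * x) ` {x::'a. absval x \<le> r}"
      using v(1) by (intro image_eqI[of _ _ "x / v"]) auto
  qed
  moreover have "closed {x::'a. absval x \<le> R}"
  proof -
    have "{x::'a. absval x \<le> R} = cball 0 R"
      by (auto simp: dist_absval)
    then show ?thesis by simp
  qed
  ultimately show ?thesis
    by (metis compact_Int_closed inf.absorb2)
qed

text \<open>The library carries \<open>heine_borel\<close> over to vectors, so closed bounded sets
  of matrices become compact; see \<open>compact_mnorm\<close>.\<close>

instance nonarch_local_field \<subseteq> heine_borel
proof
  fix f :: "nat \<Rightarrow> 'a" assume "bounded (range f)"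
  then obtain R where R: "\<And>n. dist 0 (f n) \<le> R"
    unfolding bounded_any_center[of _ 0] by blast
  then have "\<forall>n. f n \<in> {x. absval x \<le> R}"
    by (simp add: dist_absval)
  then show "\<exists>l r. strict_mono r \<and> (f \<circ> r) \<longlonglongrightarrow> l"
    using compact_absval_le[of R] unfolding compact_def by blast
qed

text \<open>Discreteness of the valuation comes from compactness: the open unit disc is also closed,
  hence compact, so the absolute value attains a maximum on it, and this maximum is below 1.\<close>

lemma ex_uniformizer:
  "\<exists>p::'a::nonarch_local_field. p \<noteq> 0 \<and> absval p < 1 \<and> (\<forall>x::'a. absval x < 1 \<longrightarrow> absval x \<le> absval p)"
proof -
  let ?P = "{x::'a. absval x \<le> 1} \<inter> ball 0 1"
  have "open (- ball (0::'a) 1)"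
    unfolding open_dist
  proof (intro ballI exI conjI allI impI)
    fix x y :: 'a assume "x \<in> - ball 0 1" "dist y x < 1"
    then have "absval (y - x) < absval x" by (auto simp: dist_absval)
    from absval_eq_near[OF this] show "y \<in> - ball 0 1"
      using \<open>x \<in> _\<close> by (simp add: dist_absval)
  qed simp
  then have "closed (ball (0::'a) 1)" by (simp add: closed_def)
  then have c: "compact ?P"
    using compact_absval_le compact_Int_closed by blast
  obtain x0 :: 'a where x0: "x0 \<noteq> 0" "absval x0 < 1"
  proof -
    obtain x :: 'a where x: "x \<noteq> 0" "absval x \<noteq> 1"
      using absval_nontrivial by blast
    show ?thesis
    proof (cases "absval x < 1")
      case False
      then have "absval (inverse x) < 1" "inverse x \<noteq> 0"
        using x by (simp_all add: absval_inverse inverse_less_1_iff)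
      then show ?thesis using that by blast
    qed (use that x in blast)
  qed
  have "continuous_on ?P (\<lambda>x. dist 0 x)" by (intro continuous_intros)
  moreover have "?P \<noteq> {}" using x0 by (auto simp: dist_absval disjoint_iff intro!: exI[of _ x0])
  ultimately obtain p where p: "p \<in> ?P" "\<forall>y\<in>?P. dist 0 y \<le> dist 0 p"
    using continuous_attains_sup[OF c] by blast
  have le: "absval x \<le> absval p" if "absval x < 1" for x :: 'a
    using bspec[OF p(2), of x] that by (simp add: dist_absval)
  moreover have "absval p < 1" using p(1) by (auto simp: dist_absval)
  moreover have "p \<noteq> 0"
    using le[OF x0(2)] x0(1) by auto
  ultimately show ?thesis by blast
qed

definition uniformizer :: "'a::nonarch_local_field" where
  "uniformizer = (SOME p. p \<noteq> 0 \<and> absval p < 1 \<and> (\<forall>x::'a. absval x < 1 \<longrightarrow> absval x \<le> absval p))"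

lemma
  shows uniformizer_nz [simp]: "uniformizer \<noteq> (0::'a::nonarch_local_field)"
    and absval_uniformizer_less_1 [simp]: "absval (uniformizer::'a) < 1"
    and absval_less_1_le: "absval (x::'a) < 1 \<Longrightarrow> absval x \<le> absval (uniformizer::'a)"
  using someI_ex[OF ex_uniformizer[where 'a='a]] by (auto simp: uniformizer_def)

lemma absval_uniformizer_le_1 [simp]: "absval (uniformizer::'a::nonarch_local_field) \<le> 1"
  using absval_uniformizer_less_1[where 'a='a] by linarith

text \<open>No absolute value lies strictly between that of the uniformizer and 1. All later
  passages between the strict and the weak inequalities that define the cells rest on this
  conversion.\<close>

lemma absval_less_iff:
  "absval x < absval y \<longleftrightarrow> y \<noteq> 0 \<and> absval x \<le> absval (uniformizer * y)"
  for x y :: "'a::nonarch_local_field"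
proof (cases "y = 0")
  case False
  have "absval x < absval y \<longleftrightarrow> absval (x / y) < 1"
    using False by (simp add: absval_divide)
  also have "\<dots> \<longleftrightarrow> absval (x / y) \<le> absval (uniformizer::'a)"
    using absval_less_1_le[of "x / y"] absval_uniformizer_less_1[where 'a='a] by linarith
  also have "\<dots> \<longleftrightarrow> absval x \<le> absval (uniformizer * y)"
    using False by (simp add: absval_divide absval_mult field_simps)
  finally show ?thesis using False by simp
qed (simp add: not_less)

lemma ex_small:
  assumes "e > 0"
  obtains d :: "'a::nonarch_local_field" where "d \<noteq> 0" "absval d \<le> e" "absval d < 1"
proof -
  obtain n where n: "absval (uniformizer::'a) ^ n < e"
    using real_arch_pow_inv[OF assms absval_uniformizer_less_1] by blast
  have "absval (uniformizer ^ Suc n :: 'a) \<le> absval (uniformizer::'a) ^ n"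
    by (simp add: absval_mult absval_power mult_left_le_one_le)
  moreover have "absval (uniformizer ^ Suc n :: 'a) < 1"
    unfolding absval_power by (rule power_Suc_less_one) simp_all
  ultimately show ?thesis using n by (intro that[of "uniformizer ^ Suc n"]) auto
qed

text \<open>Discs of radius |d| are equal or disjoint, and by compactness finitely many of them
  cover the unit disc. The set R represents the integers modulo d.\<close>

lemma ex_residues:
  fixes d :: "'a::nonarch_local_field"
  assumes "d \<noteq> 0"
  shows "\<exists>R. finite R \<and> (\<forall>r\<in>R. absval r \<le> 1) \<and> (\<forall>x::'a. absval x \<le> 1 \<longrightarrow> (\<exists>!r. r \<in> R \<and> absval (x - r) \<le> absval d))"
proof -
  let ?O = "{x::'a. absval x \<le> 1}"
  \<comment> \<open>The predicate under \<open>SOME\<close> depends only on the disc of radius |d|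
    around x, so points of the same disc get the same representative.\<close>
  define \<rho> where "\<rho> x = (SOME y::'a. absval y \<le> 1 \<and> absval (x - y) \<le> absval d)" for x
  have \<rho>: "absval (\<rho> x) \<le> 1 \<and> absval (x - \<rho> x) \<le> absval d" if "absval x \<le> 1" for x
    unfolding \<rho>_def by (rule someI[of _ x]) (use that in simp)
  have \<rho>_eq: "\<rho> x = \<rho> y" if "absval (x - y) \<le> absval d" for x y
  proof -
    have "absval (x - z) \<le> absval d \<longleftrightarrow> absval (y - z) \<le> absval d" for z
      using absval_add_le[of "y - z" "absval d" "x - y"] absval_diff_le[of "x - z" "absval d" "x - y"] that
      by auto
    then show ?thesis by (simp add: \<rho>_def)
  qed
  have "finite (\<rho> ` ?O)"
  proof -
    have "compact ?O" by (rule compact_absval_le)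
    moreover have "\<forall>t\<in>?O. open (ball t (absval d))" by simp
    moreover have "?O \<subseteq> (\<Union>t\<in>?O. ball t (absval d))" using assms by auto
    ultimately obtain T where T: "T \<subseteq> ?O" "finite T" "?O \<subseteq> (\<Union>t\<in>T. ball t (absval d))"
      using compactE_image[of ?O ?O "\<lambda>t. ball t (absval d)"] by metis
    have "\<rho> ` ?O \<subseteq> \<rho> ` T"
    proof
      fix z assume "z \<in> \<rho> ` ?O"
      then obtain x t where "z = \<rho> x" "t \<in> T" "dist t x < absval d" using T by auto
      then show "z \<in> \<rho> ` T" using \<rho>_eq[of t x] by (metis dist_absval imageI less_imp_le)
    qed
    then show ?thesis using T(2) finite_surj by blast
  qed
  moreover have "\<exists>!r. r \<in> \<rho> ` ?O \<and> absval (x - r) \<le> absval d" if x: "absval x \<le> 1" for x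
  proof (rule ex1I[of _ "\<rho> x"])
    show "\<rho> x \<in> \<rho> ` ?O \<and> absval (x - \<rho> x) \<le> absval d" using \<rho>[OF x] x by auto
    fix r assume r: "r \<in> \<rho> ` ?O \<and> absval (x - r) \<le> absval d"
    then obtain y where y: "absval y \<le> 1" "r = \<rho> y" by auto
    have "absval ((x - r) - (y - r)) \<le> absval d"
      using r \<rho>[OF y(1)] unfolding y(2) by (intro absval_diff_le[of "x - \<rho> y"]) simp_all
    then show "r = \<rho> x" using \<rho>_eq[of x y] y by simp
  qed
  moreover have "\<forall>r\<in>\<rho> ` ?O. absval r \<le> 1" using \<rho> by auto
  ultimately have "finite (\<rho> ` ?O) \<and> (\<forall>r\<in>\<rho> ` ?O. absval r \<le> 1) \<and>
      (\<forall>x::'a. absval x \<le> 1 \<longrightarrow> (\<exists>!r. r \<in> \<rho> ` ?O \<and> absval (x - r) \<le> absval d))"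
    by (intro conjI allI impI)
  then show ?thesis by (rule exI)
qed

definition residues :: "'a::nonarch_local_field \<Rightarrow> 'a set" where
  "residues d = (SOME R. finite R \<and> (\<forall>r\<in>R. absval r \<le> 1) \<and> (\<forall>x::'a. absval x \<le> 1 \<longrightarrow> (\<exists>!r. r \<in> R \<and> absval (x - r) \<le> absval d)))"

lemma
  fixes d :: "'a::nonarch_local_field"
  assumes "d \<noteq> 0"
  shows finite_residues: "finite (residues d)"
    and absval_residues: "(r::'a) \<in> residues d \<Longrightarrow> absval r \<le> 1"
    and ex1_residues: "absval (x::'a) \<le> 1 \<Longrightarrow> \<exists>!r. r \<in> residues d \<and> absval (x - r) \<le> absval d"
proof -
  note * = someI_ex[OF ex_residues[OF assms], folded residues_def]
  show "finite (residues d)" by (rule *[THEN conjunct1])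
  show "r \<in> residues d \<Longrightarrow> absval r \<le> 1"
    by (rule *[THEN conjunct2, THEN conjunct1, rule_format])
  show "absval x \<le> 1 \<Longrightarrow> \<exists>!r. r \<in> residues d \<and> absval (x - r) \<le> absval d"
    by (rule *[THEN conjunct2, THEN conjunct2, rule_format])
qed

text \<open>The representatives of 0 and 1 differ. This bound q >= 2 is what later contradicts m = q
  m.\<close>

lemma card_residues_uniformizer: "card (residues (uniformizer::'a::nonarch_local_field)) \<ge> 2"
proof -
  let ?p = "uniformizer::'a"
  obtain r where r: "r \<in> residues ?p" "absval (0 - r) \<le> absval ?p"
    using ex1_implies_ex[OF ex1_residues[of ?p 0]] by auto
  obtain s where s: "s \<in> residues ?p" "absval (1 - s) \<le> absval ?p"
    using ex1_implies_ex[OF ex1_residues[of ?p 1]] by auto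
  have "r \<noteq> s"
  proof
    assume "r = s"
    have "absval ((1 - s) - (0 - r)) \<le> absval ?p"
      using r(2) s(2) by (rule absval_diff_le[rotated])
    then show False using \<open>r = s\<close> absval_uniformizer_less_1[where 'a='a] by simp
  qed
  then have "card {r, s} = 2" by simp
  moreover have "card {r, s} \<le> card (residues ?p)"
    using r s by (intro card_mono finite_residues) auto
  ultimately show ?thesis by simp
qed

section \<open>Two-by-two matrices and their compact open subgroups\<close>

definition mat2 :: "'a::zero \<Rightarrow> 'a \<Rightarrow> 'a \<Rightarrow> 'a \<Rightarrow> 'a^2^2" where
  "mat2 a b c d = vector [vector [a, b], vector [c, d]]"

lemma mat2_nth [simp]:
  "mat2 a b c d $ 1 $ 1 = a" "mat2 a b c d $ 1 $ 2 = b"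
  "mat2 a b c d $ 2 $ 1 = c" "mat2 a b c d $ 2 $ 2 = d"
  by (simp_all add: mat2_def)

lemma mat_2_nth [simp]:
  "(mat c :: 'a::zero^2^2) $ 1 $ 1 = c" "(mat c :: 'a^2^2) $ 1 $ 2 = 0"
  "(mat c :: 'a^2^2) $ 2 $ 1 = 0" "(mat c :: 'a^2^2) $ 2 $ 2 = c"
  by (simp_all add: mat_def)

lemma matrix_2_eq_iff:
  "x = y \<longleftrightarrow> x$1$1 = y$1$1 \<and> x$1$2 = y$1$2 \<and> x$2$1 = y$2$1 \<and> x$2$2 = y$2$2" for x y :: "'a^2^2"
  by (auto simp: vec_eq_iff forall_2)

lemma matrix_2_mult_nth: "(x ** y) $ i $ j = x$i$1 * y$1$j + x$i$2 * y$2$j"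
  for x y :: "'a::comm_semiring_1^2^2"
  by (simp add: matrix_matrix_mult_def sum_2)

lemmas mat_mult_nth [simp] = mat_mult_left[where 'n=2]

lemma matrix_mult_distribs:
  fixes x y z :: "'a::comm_ring_1^2^2"
  shows "(x + y) ** z = x ** z + y ** z" "z ** (x + y) = z ** x + z ** y"
    "(x - y) ** z = x ** z - y ** z" "z ** (x - y) = z ** x - z ** y"
  by (simp_all add: matrix_2_eq_iff matrix_2_mult_nth algebra_simps)

lemma mat_mult_eq_0_iff [simp]: "mat c ** x = 0 \<longleftrightarrow> c = 0 \<or> x = 0" for x :: "'a::field^2^2"
  by (auto simp: matrix_2_eq_iff)

lemma invertible_det: "invertible x \<longleftrightarrow> det x \<noteq> 0" for x :: "'a::field^'n^'n"
  by (rule invertible_det_nz)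

definition adj2 :: "'a::comm_ring_1^2^2 \<Rightarrow> 'a^2^2" where
  "adj2 x = mat2 (x$2$2) (- x$1$2) (- x$2$1) (x$1$1)"

lemma adj2_mult: "x ** adj2 x = mat (det x)" "adj2 x ** x = mat (det x)"
  by (simp_all add: matrix_2_eq_iff matrix_2_mult_nth adj2_def det_2 algebra_simps)

lemma
  fixes x :: "'a::field^'n^'n"
  assumes "invertible x"
  shows matrix_inv_mult_right [simp]: "x ** matrix_inv x = mat 1"
    and matrix_inv_mult_left [simp]: "matrix_inv x ** x = mat 1"
  using invertible_matrix_inv[OF assms] by auto

lemma matrix_inv_unique:
  fixes x y :: "'a::field^'n^'n"
  assumes "x ** y = mat 1"
  shows "matrix_inv x = y"
proof -
  have "invertible x"
    unfolding invertible_right_inverse using assms by blast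
  then have "matrix_inv x ** (x ** y) = y"
    by (simp add: matrix_mul_assoc)
  then show ?thesis by (simp add: assms)
qed

lemma invertible_inv [simp]: "invertible x \<Longrightarrow> invertible (matrix_inv x)" for x :: "'a::field^'n^'n"
  unfolding invertible_def[of "matrix_inv x"] by (rule exI[of _ x]) simp

lemma matrix_inv_inv [simp]: "invertible x \<Longrightarrow> matrix_inv (matrix_inv x) = x" for x :: "'a::field^'n^'n"
  by (rule matrix_inv_unique) simp

lemma matrix_inv_mult:
  fixes x y :: "'a::field^'n^'n"
  assumes "invertible x" "invertible y"
  shows "matrix_inv (x ** y) = matrix_inv y ** matrix_inv x"
proof (rule matrix_inv_unique)
  have "x ** y ** (matrix_inv y ** matrix_inv x) = x ** (y ** matrix_inv y) ** matrix_inv x"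
    by (simp only: matrix_mul_assoc)
  then show "x ** y ** (matrix_inv y ** matrix_inv x) = mat 1" using assms by simp
qed

lemma matrix_inv_1 [simp]: "matrix_inv (mat 1) = (mat 1 :: 'a::field^'n^'n)"
  by (rule matrix_inv_unique) simp

lemma invertible_1 [simp]: "invertible (mat 1 :: 'a::field^'n^'n)"
  by (rule invertible_mat) simp

lemma
  fixes x y :: "'a::field^'n^'n"
  assumes "invertible x"
  shows matrix_inv_cancel1 [simp]: "matrix_inv x ** (x ** y) = y"
    and matrix_inv_cancel2 [simp]: "x ** (matrix_inv x ** y) = y"
    and matrix_inv_cancel3 [simp]: "y ** x ** matrix_inv x = y"
    and matrix_inv_cancel4 [simp]: "y ** matrix_inv x ** x = y"
  using assms by (simp_all add: matrix_mul_assoc) (simp_all add: assms flip: matrix_mul_assoc)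

lemma matrix_inv_2: "invertible x \<Longrightarrow> matrix_inv x = mat (inverse (det x)) ** adj2 x" for x :: "'a::field^2^2"
  by (rule matrix_inv_unique) (simp add: mat_mult_pull2 adj2_mult mat_mult_mat invertible_det)

lemma mult_eq_0_invertible [simp]:
  fixes x y :: "'a::field^'n^'n"
  assumes "invertible x"
  shows "x ** y = 0 \<longleftrightarrow> y = 0" "y ** x = 0 \<longleftrightarrow> y = 0"
proof -
  have z: "z ** 0 = 0" "0 ** z = 0" for z :: "'a^'n^'n"
    by (simp_all add: matrix_matrix_mult_def vec_eq_iff)
  show "x ** y = 0 \<longleftrightarrow> y = 0"
    using matrix_inv_cancel1[OF assms, of y] z by metis
  show "y ** x = 0 \<longleftrightarrow> y = 0"
    using matrix_inv_cancel3[OF assms, of y] z by metis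
qed


section \<open>The maximum norm on matrices and its topology\<close>

definition mnorm :: "'a::nonarch_local_field^2^2 \<Rightarrow> real" where
  "mnorm x = max (max (absval (x$1$1)) (absval (x$1$2))) (max (absval (x$2$1)) (absval (x$2$2)))"

lemma mnorm_le_iff:
  "mnorm x \<le> r \<longleftrightarrow> absval (x$1$1) \<le> r \<and> absval (x$1$2) \<le> r \<and> absval (x$2$1) \<le> r \<and> absval (x$2$2) \<le> r"
  by (auto simp: mnorm_def)

lemma absval_nth_le_mnorm: "absval (x$i$j) \<le> mnorm x"
  using exhaust_2[of i] exhaust_2[of j] by (auto simp: mnorm_def)

lemma mnorm_nonneg [simp]: "0 \<le> mnorm x"
  by (rule order_trans[OF absval_nonneg absval_nth_le_mnorm])

lemma mnorm_eq_0 [simp]: "mnorm x = 0 \<longleftrightarrow> x = 0"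
proof -
  have "mnorm x = 0 \<longleftrightarrow> mnorm x \<le> 0" using mnorm_nonneg[of x] by linarith
  also have "\<dots> \<longleftrightarrow> x = 0" by (auto simp: mnorm_le_iff matrix_2_eq_iff)
  finally show ?thesis .
qed

lemma mnorm_pos [simp]: "0 < mnorm x \<longleftrightarrow> x \<noteq> 0"
  using mnorm_nonneg[of x] mnorm_eq_0[of x] by linarith

lemma mnorm_minus_commute: "mnorm (x - y) = mnorm (y - x)"
  by (simp add: mnorm_def absval_minus_commute)

lemma mnorm_add_le: "mnorm x \<le> r \<Longrightarrow> mnorm y \<le> r \<Longrightarrow> mnorm (x + y) \<le> r"
  by (simp add: mnorm_le_iff absval_add_le)

lemma mnorm_scale [simp]: "mnorm (mat c ** x) = absval c * mnorm x"
  by (simp add: mnorm_def absval_mult max_mult_distrib_left)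

lemma mnorm_mat: "mnorm (mat c) = absval c"
  by (simp add: mnorm_def)

lemma mnorm_mult_le: "mnorm (x ** y) \<le> mnorm x * mnorm y"
proof -
  have "absval ((x ** y)$i$j) \<le> mnorm x * mnorm y" for i j
    unfolding matrix_2_mult_nth
    by (intro absval_add_le; unfold absval_mult; intro mult_mono absval_nth_le_mnorm) simp_all
  then show ?thesis by (simp add: mnorm_le_iff)
qed

lemma mnorm_mult_mono: "mnorm x \<le> r \<Longrightarrow> mnorm y \<le> s \<Longrightarrow> mnorm (x ** y) \<le> r * s"
  by (rule order_trans[OF mnorm_mult_le]) (meson mnorm_nonneg mult_mono order_trans)

lemma mnorm_eq_near:
  assumes "mnorm (y - x) < mnorm x"
  shows "mnorm y = mnorm x"
proof (rule antisym)
  have "mnorm (x + (y - x)) \<le> mnorm x"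
    by (rule mnorm_add_le) (use assms in simp_all)
  then show "mnorm y \<le> mnorm x" by simp
  show "mnorm x \<le> mnorm y"
  proof (rule ccontr)
    assume "\<not> ?thesis"
    then have "mnorm y \<le> max (mnorm y) (mnorm (x - y))" "mnorm (x - y) \<le> max (mnorm y) (mnorm (x - y))"
      and *: "max (mnorm y) (mnorm (x - y)) < mnorm x"
      using assms by (simp_all add: mnorm_minus_commute)
    then have "mnorm (y + (x - y)) \<le> max (mnorm y) (mnorm (x - y))" by (intro mnorm_add_le)
    moreover have "y + (x - y) = x" by simp
    ultimately show False using * by simp
  qed
qed

lemma ex_absval_eq_mnorm: "\<exists>c::'a. absval c = mnorm (x :: 'a::nonarch_local_field^2^2)"
  by (auto simp: mnorm_def max_def)

text \<open>The norm is the absolute value of one of the entries, so it can be divided out by a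
  scalar. Hence the compact unit sphere maps onto the projective space.\<close>

lemma ex_normalized:
  fixes x :: "'a::nonarch_local_field^2^2"
  assumes "x \<noteq> 0"
  shows "\<exists>c. c \<noteq> 0 \<and> mnorm (mat c ** x) = 1"
proof -
  obtain c :: 'a where c: "absval c = mnorm x" using ex_absval_eq_mnorm[of x] by auto
  then have "absval c > 0" using assms by simp
  then show ?thesis
    using c assms by (intro exI[of _ "inverse c"]) (auto simp: absval_inverse simp flip: absval_eq_0)
qed

lemma mnorm_le_dist: "mnorm (x - y) \<le> dist x y"
proof -
  have "absval ((x - y)$i$j) \<le> dist x y" for i j
  proof -
    have "absval ((x - y)$i$j) = dist (x$i$j) (y$i$j)" by (simp add: dist_absval)
    also have "\<dots> \<le> dist (x$i) (y$i)" by (rule dist_vec_nth_le)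
    also have "\<dots> \<le> dist x y" by (rule dist_vec_nth_le)
    finally show ?thesis .
  qed
  then show ?thesis by (simp add: mnorm_le_iff)
qed

text \<open>The metric on vectors is Euclidean and thus bounded by the sum over the coordinates; two
  rows of two entries account for the factor 4.\<close>

lemma dist_le_mnorm: "dist x y \<le> 4 * mnorm (x - y)"
proof -
  have 1: "dist (x$i) (y$i) \<le> 2 * mnorm (x - y)" for i
  proof -
    have "dist (x$i) (y$i) \<le> (\<Sum>j\<in>UNIV. dist (x$i$j) (y$i$j))"
      unfolding dist_vec_def by (rule L2_set_le_sum) simp
    also have "\<dots> \<le> 2 * mnorm (x - y)"
      using absval_nth_le_mnorm[of "x - y" i 1] absval_nth_le_mnorm[of "x - y" i 2]
      by (simp add: sum_2 dist_absval)
    finally show ?thesis .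
  qed
  have "dist x y \<le> (\<Sum>i\<in>UNIV. dist (x$i) (y$i))"
    unfolding dist_vec_def by (rule L2_set_le_sum) simp
  also have "\<dots> \<le> 4 * mnorm (x - y)"
    using 1[of 1] 1[of 2] by (simp add: sum_2)
  finally show ?thesis .
qed

lemma open_mnorm: "open S \<longleftrightarrow> (\<forall>x\<in>S. \<exists>e>0. \<forall>y. mnorm (y - x) < e \<longrightarrow> y \<in> S)"
  (is "_ \<longleftrightarrow> ?R")
proof
  assume "open S"
  show ?R
  proof
    fix x assume "x \<in> S"
    then obtain e where e: "e > 0" "\<forall>y. dist y x < e \<longrightarrow> y \<in> S"
      using \<open>open S\<close> open_dist by blast
    have "y \<in> S" if "mnorm (y - x) < e / 4" for y
      using e(2) that dist_le_mnorm[of y x] by auto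
    then show "\<exists>e>0. \<forall>y. mnorm (y - x) < e \<longrightarrow> y \<in> S"
      using e(1) by (intro exI[of _ "e / 4"]) auto
  qed
next
  assume R: ?R
  show "open S"
    unfolding open_dist
  proof
    fix x assume "x \<in> S"
    then obtain e where "e > 0" "\<forall>y. mnorm (y - x) < e \<longrightarrow> y \<in> S" using R by blast
    then show "\<exists>e>0. \<forall>y. dist y x < e \<longrightarrow> y \<in> S"
      by (meson le_less_trans mnorm_le_dist)
  qed
qed

lemma compact_mnorm:
  fixes S :: "('a::nonarch_local_field^2^2) set"
  assumes bdd: "\<And>x. x \<in> S \<Longrightarrow> mnorm x \<le> R"
    and cl: "\<And>x. x \<notin> S \<Longrightarrow> \<exists>e>0. \<forall>y. mnorm (y - x) < e \<longrightarrow> y \<notin> S"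
  shows "compact S"
proof -
  have "open (- S)"
    unfolding open_mnorm using cl by simp
  moreover have "bounded S"
    unfolding bounded_def
  proof (intro exI ballI)
    fix x assume "x \<in> S"
    then have "dist 0 x \<le> 4 * mnorm x"
      using dist_le_mnorm[of x 0] by (simp add: dist_commute)
    then show "dist 0 x \<le> 4 * R" using bdd[OF \<open>x \<in> S\<close>] by linarith
  qed
  ultimately show ?thesis
    by (simp add: compact_eq_bounded_closed closed_def)
qed

section \<open>Principal congruence subgroups and the Iwahori subgroup\<close>

definition congr :: "real \<Rightarrow> ('a::nonarch_local_field^2^2) set" where
  "congr \<delta> = {x. mnorm (x - mat 1) \<le> \<delta>}"

text \<open>A predicate on plain sets of matrices, so that computations stay with \<open>**\<close>
  and \<open>matrix_inv\<close> instead of the operations of the monoid \<open>GL2\<close>.\<close>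

definition matrix_group :: "('a::nonarch_local_field^2^2) set \<Rightarrow> bool" where
  "matrix_group M \<longleftrightarrow> mat 1 \<in> M \<and> (\<forall>x\<in>M. invertible x \<and> matrix_inv x \<in> M) \<and> (\<forall>x\<in>M. \<forall>y\<in>M. x ** y \<in> M)"

lemma matrix_groupD:
  assumes "matrix_group M"
  shows "mat 1 \<in> M" "x \<in> M \<Longrightarrow> invertible x" "x \<in> M \<Longrightarrow> matrix_inv x \<in> M"
    "x \<in> M \<Longrightarrow> y \<in> M \<Longrightarrow> x ** y \<in> M"
  using assms by (auto simp: matrix_group_def)

lemma matrix_group_1: "matrix_group {mat 1}"
  by (simp add: matrix_group_def)

lemma congr_mnorm:
  assumes "\<delta> < 1" "x \<in> congr \<delta>"
  shows "mnorm x = 1"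
  using mnorm_eq_near[of x "mat 1"] assms by (simp add: congr_def mnorm_mat)

lemma congr_det:
  assumes "\<delta> < 1" "x \<in> congr \<delta>"
  shows "absval (det x) = 1"
proof -
  have x: "absval (x$1$1 - 1) \<le> \<delta>" "absval (x$1$2) \<le> \<delta>" "absval (x$2$1) \<le> \<delta>" "absval (x$2$2 - 1) \<le> \<delta>"
    using assms(2) by (auto simp: congr_def mnorm_le_iff)
  have l1: "absval u = 1" if "absval (u - 1) \<le> \<delta>" for u :: 'a
    using absval_eq_near[of u 1] that assms(1) by simp
  have 0: "0 \<le> \<delta>" using x(2) absval_nonneg order_trans by blast
  \<comment> \<open>This is \<open>det x - 1\<close>, arranged so that each of the three terms is at
    most \<delta>.\<close>
  have "absval ((x$1$1 - 1) * x$2$2 + (x$2$2 - 1) - x$1$2 * x$2$1) \<le> \<delta>"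
  proof (rule absval_diff_le, rule absval_add_le)
    show "absval ((x$1$1 - 1) * x$2$2) \<le> \<delta>"
      using x by (simp add: absval_mult l1)
    have "absval (x$1$2 * x$2$1) \<le> \<delta> * \<delta>"
      unfolding absval_mult using x 0 by (intro mult_mono) simp_all
    also have "\<dots> \<le> \<delta>" using assms(1) 0 by (simp add: mult_left_le)
    finally show "absval (x$1$2 * x$2$1) \<le> \<delta>" .
  qed (rule x)
  then show ?thesis
    by (intro l1) (simp add: det_2 algebra_simps)
qed

lemma matrix_group_congr:
  assumes "0 \<le> \<delta>" "\<delta> < 1"
  shows "matrix_group (congr \<delta>)"
  unfolding matrix_group_def
proof (intro conjI ballI)
  show "mat 1 \<in> congr \<delta>"
    using assms by (simp add: congr_def mnorm_def)
next
  fix x :: "'a^2^2" assume x: "x \<in> congr \<delta>"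
  have d: "absval (det x) = 1" by (rule congr_det[OF assms(2) x])
  then show inv: "invertible x" by (auto simp: invertible_det)
  \<comment> \<open>The determinant is a unit, and the adjugate has the same entries up to order and
    sign.\<close>
  have "mnorm (matrix_inv x) = mnorm x"
    using d by (simp add: matrix_inv_2[OF inv] absval_inverse) (simp add: mnorm_def adj2_def max_def)
  also have "\<dots> = 1" by (rule congr_mnorm[OF assms(2) x])
  finally have 1: "mnorm (matrix_inv x) = 1" .
  have "matrix_inv x - mat 1 = matrix_inv x ** (mat 1 - x)"
    using inv by (simp add: matrix_mult_distribs)
  also have "mnorm \<dots> \<le> 1 * \<delta>"
    using 1 x by (intro mnorm_mult_mono) (simp_all add: congr_def mnorm_minus_commute)
  finally show "matrix_inv x \<in> congr \<delta>" by (simp add: congr_def)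
next
  fix x y :: "'a^2^2" assume x: "x \<in> congr \<delta>" and y: "y \<in> congr \<delta>"
  have "x ** y - mat 1 = (x - mat 1) ** y + (y - mat 1)"
    by (simp add: matrix_mult_distribs)
  also have "mnorm \<dots> \<le> \<delta>"
  proof (rule mnorm_add_le)
    have "mnorm ((x - mat 1) ** y) \<le> \<delta> * 1"
      using x congr_mnorm[OF assms(2) y] by (intro mnorm_mult_mono) (simp_all add: congr_def)
    then show "mnorm ((x - mat 1) ** y) \<le> \<delta>" by simp
  qed (use y in \<open>simp add: congr_def\<close>)
  finally show "x ** y \<in> congr \<delta>" by (simp add: congr_def)
qed

lemma congr_near:
  assumes "mnorm (y - x) < \<delta>" "x \<in> congr \<delta>"
  shows "y \<in> congr \<delta>"
  using mnorm_add_le[of "y - x" \<delta> "x - mat 1"] assms by (simp add: congr_def)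

lemma compact_congr:
  assumes "0 < \<delta>" "\<delta> < 1"
  shows "compact (congr \<delta>)"
proof (rule compact_mnorm[where R = 1])
  show "mnorm x \<le> 1" if "x \<in> congr \<delta>" for x :: "'a^2^2"
    using congr_mnorm[OF assms(2) that] by simp
  fix x :: "'a^2^2" assume x: "x \<notin> congr \<delta>"
  have "y \<notin> congr \<delta>" if "mnorm (y - x) < \<delta>" for y
    using congr_near[of x y \<delta>] that x mnorm_minus_commute[of x y] by metis
  then show "\<exists>e>0. \<forall>y. mnorm (y - x) < e \<longrightarrow> y \<notin> congr \<delta>"
    using assms(1) by metis
qed

text \<open>The integral invertible matrices that are upper triangular modulo the maximal
  ideal.\<close>

definition iwahori :: "('a::nonarch_local_field^2^2) set" where
  "iwahori = {x. absval (x$1$1) = 1 \<and> absval (x$2$2) = 1 \<and> absval (x$1$2) \<le> 1 \<and> absval (x$2$1) < 1}"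

lemma absval_mult_le_1: "absval x \<le> 1 \<Longrightarrow> absval y \<le> 1 \<Longrightarrow> absval (x * y) \<le> 1"
  for x y :: "'a::nonarch_local_field"
  by (simp add: absval_mult mult_le_one)

lemma absval_mult_less_1:
  fixes x y :: "'a::nonarch_local_field"
  shows "absval x < 1 \<Longrightarrow> absval y \<le> 1 \<Longrightarrow> absval (x * y) < 1"
    "absval x \<le> 1 \<Longrightarrow> absval y < 1 \<Longrightarrow> absval (x * y) < 1"
proof -
  have "absval (x * y) \<le> absval x" if "absval y \<le> 1"
    unfolding absval_mult using that by (intro mult_left_le) simp_all
  moreover have "absval (x * y) \<le> absval y" if "absval x \<le> 1"
    unfolding absval_mult using that by (intro mult_left_le_one_le) simp_all
  ultimately show "absval x < 1 \<Longrightarrow> absval y \<le> 1 \<Longrightarrow> absval (x * y) < 1"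
    "absval x \<le> 1 \<Longrightarrow> absval y < 1 \<Longrightarrow> absval (x * y) < 1"
    by linarith+
qed

lemma absval_unit_add:
  "absval u = 1 \<Longrightarrow> absval v < 1 \<Longrightarrow> absval (u + v) = 1" for u v :: "'a::nonarch_local_field"
  using absval_eq_near[of "u + v" u] by simp

lemma iwahori_det:
  assumes "x \<in> iwahori"
  shows "absval (det x) = 1"
proof -
  have "absval (x$1$2 * x$2$1) < 1"
    using assms by (intro absval_mult_less_1) (simp_all add: iwahori_def)
  then have "absval (det x - x$1$1 * x$2$2) < absval (x$1$1 * x$2$2)"
    using assms by (simp add: det_2 iwahori_def absval_mult)
  from absval_eq_near[OF this] show ?thesis
    using assms by (simp add: iwahori_def absval_mult)
qed

lemma matrix_group_iwahori: "matrix_group (iwahori :: ('a::nonarch_local_field^2^2) set)"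
  unfolding matrix_group_def
proof (intro conjI ballI)
  show "mat 1 \<in> (iwahori :: ('a^2^2) set)" by (simp add: iwahori_def)
next
  fix x :: "'a^2^2" assume x: "x \<in> iwahori"
  note d = iwahori_det[OF x]
  then show inv: "invertible x" by (auto simp: invertible_det)
  show "matrix_inv x \<in> iwahori"
    using x d by (simp add: matrix_inv_2[OF inv] adj2_def iwahori_def absval_mult absval_inverse)
next
  fix x y :: "'a^2^2" assume x: "x \<in> iwahori" and y: "y \<in> iwahori"
  then have xy: "absval (x$1$1) = 1" "absval (x$2$2) = 1" "absval (x$1$2) \<le> 1" "absval (x$2$1) < 1"
    "absval (y$1$1) = 1" "absval (y$2$2) = 1" "absval (y$1$2) \<le> 1" "absval (y$2$1) < 1"
    by (auto simp: iwahori_def)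
  have "absval (x$1$1 * y$1$1 + x$1$2 * y$2$1) = 1" "absval (x$2$2 * y$2$2 + x$2$1 * y$1$2) = 1"
    using xy by (auto intro!: absval_unit_add absval_mult_less_1(1) absval_mult_less_1(2)[of _ "y$2$1"] simp: absval_mult[of "x$1$1"] absval_mult[of "x$2$2"])
  moreover have "absval (x$1$1 * y$1$2 + x$1$2 * y$2$2) \<le> 1"
    using xy by (intro absval_add_le absval_mult_le_1) simp_all
  moreover have "absval (x$2$1 * y$1$1) < 1" "absval (x$2$2 * y$2$1) < 1"
    using xy by (intro absval_mult_less_1(1); simp) (intro absval_mult_less_1(2); use xy in simp)
  ultimately show "x ** y \<in> iwahori"
    by (simp add: iwahori_def matrix_2_mult_nth add.commute[of "x$2$1 * y$1$2"] absval_add_less)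
qed

lemma iwahori_near:
  assumes "mnorm (y - x) < 1" "x \<in> iwahori"
  shows "y \<in> iwahori"
proof -
  have *: "absval (y$i$j - x$i$j) < 1" for i j
    using absval_nth_le_mnorm[of "y - x" i j] assms(1) by simp
  have u: "absval (y$i$j) = 1" if "absval (x$i$j) = 1" for i j
    using absval_eq_near[of "y$i$j" "x$i$j"] * that by simp
  have "absval (x$1$2 + (y$1$2 - x$1$2)) \<le> 1"
    using *[of 1 2] assms(2) by (intro absval_add_le) (simp_all add: iwahori_def)
  moreover have "absval (x$2$1 + (y$2$1 - x$2$1)) < 1"
    using *[of 2 1] assms(2) by (intro absval_add_less) (simp_all add: iwahori_def)
  ultimately show ?thesis using assms(2) u by (simp add: iwahori_def)
qed

lemma compact_iwahori: "compact (iwahori :: ('a::nonarch_local_field^2^2) set)"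
proof (rule compact_mnorm[where R = 1])
  show "mnorm x \<le> 1" if "x \<in> iwahori" for x :: "'a^2^2"
    using that by (simp add: iwahori_def mnorm_le_iff)
  fix x :: "'a^2^2" assume x: "x \<notin> iwahori"
  have "y \<notin> iwahori" if "mnorm (y - x) < 1" for y
    using iwahori_near[of x y] that x mnorm_minus_commute[of x y] by metis
  then show "\<exists>e>0. \<forall>y. mnorm (y - x) < e \<longrightarrow> y \<notin> iwahori"
    using zero_less_one by metis
qed

lemma open_coset:
  assumes g: "invertible (g :: 'a::nonarch_local_field^2^2)" and S: "open S"
  shows "open {x. g ** x \<in> S}" "open {x. x ** g \<in> S}"
proof -
  have g0: "mnorm g > 0" using g by (auto simp: invertible_det det_2)
  show "open {x. g ** x \<in> S}"
    unfolding open_mnorm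
  proof
    fix x assume "x \<in> {x. g ** x \<in> S}"
    then obtain e where e: "e > 0" "\<And>y. mnorm (y - g ** x) < e \<Longrightarrow> y \<in> S"
      using S unfolding open_mnorm by blast
    have "g ** y \<in> S" if "mnorm (y - x) < e / mnorm g" for y
    proof (rule e(2))
      have "mnorm (g ** y - g ** x) \<le> mnorm g * mnorm (y - x)"
        using mnorm_mult_le[of g "y - x"] by (simp add: matrix_mult_distribs)
      also have "\<dots> < e" using that g0 by (simp add: field_simps)
      finally show "mnorm (g ** y - g ** x) < e" .
    qed
    then show "\<exists>e>0. \<forall>y. mnorm (y - x) < e \<longrightarrow> y \<in> {x. g ** x \<in> S}"
      using e(1) g0 by (intro exI[of _ "e / mnorm g"]) auto
  qed
  show "open {x. x ** g \<in> S}"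
    unfolding open_mnorm
  proof
    fix x assume "x \<in> {x. x ** g \<in> S}"
    then obtain e where e: "e > 0" "\<And>y. mnorm (y - x ** g) < e \<Longrightarrow> y \<in> S"
      using S unfolding open_mnorm by blast
    have "y ** g \<in> S" if "mnorm (y - x) < e / mnorm g" for y
    proof (rule e(2))
      have "mnorm (y ** g - x ** g) \<le> mnorm (y - x) * mnorm g"
        using mnorm_mult_le[of "y - x" g] by (simp add: matrix_mult_distribs)
      also have "\<dots> < e" using that g0 by (simp add: field_simps)
      finally show "mnorm (y ** g - x ** g) < e" .
    qed
    then show "\<exists>e>0. \<forall>y. mnorm (y - x) < e \<longrightarrow> y \<in> {x. x ** g \<in> S}"
      using e(1) g0 by (intro exI[of _ "e / mnorm g"]) auto
  qed
qed

lemma open_congr: "0 < \<delta> \<Longrightarrow> open (congr \<delta>)"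
  unfolding open_mnorm by (intro ballI exI[of _ \<delta>] conjI allI impI) (simp, rule congr_near)

lemma open_iwahori: "open iwahori"
  unfolding open_mnorm by (intro ballI exI[of _ 1] conjI allI impI) (simp, rule iwahori_near)

text \<open>The cosets of \<open>congr \<delta>\<close> are open, so finitely many cover a compact
  set. This finiteness is what makes Haar measure avoidable.\<close>

lemma compact_finite_cosets:
  fixes M :: "('a::nonarch_local_field^2^2) set"
  assumes "compact M" "\<And>x. x \<in> M \<Longrightarrow> invertible x" "0 < \<delta>" "\<delta> < 1"
  shows "\<exists>T. finite T \<and> T \<subseteq> M \<and> (\<forall>x\<in>M. \<exists>t\<in>T. \<exists>k\<in>congr \<delta>. x = t ** k)"
proof -
  let ?B = "\<lambda>t. {x. matrix_inv t ** x \<in> congr \<delta>}"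
  have op: "\<And>t. t \<in> M \<Longrightarrow> open (?B t)"
    using assms by (intro open_coset open_congr) auto
  have "mat 1 \<in> (congr \<delta> :: ('a^2^2) set)"
    using matrix_groupD(1)[OF matrix_group_congr[of \<delta>]] assms by simp
  then have "M \<subseteq> (\<Union>t\<in>M. ?B t)" using assms(2) by auto
  then obtain T where T: "T \<subseteq> M" "finite T" "M \<subseteq> (\<Union>t\<in>T. ?B t)"
    using compactE_image[of M M ?B] assms(1) op by metis
  show ?thesis
  proof (intro exI[of _ T] conjI ballI T(1,2))
    fix x assume "x \<in> M"
    then obtain t where t: "t \<in> T" "matrix_inv t ** x \<in> congr \<delta>" using T(3) by auto
    moreover have "x = t ** (matrix_inv t ** x)" using t T(1) assms(2) by auto
    ultimately show "\<exists>t\<in>T. \<exists>k\<in>congr \<delta>. x = t ** k" by blast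
  qed
qed

section \<open>Smooth representations of pairs of matrices\<close>

text \<open>Representations are pulled back from classes to pairs of invertible matrices. Smoothness
  is phrased with congruence subgroups, whose classes form a basis of neighbourhoods of the identity
  of the projective group.\<close>

locale smooth_rep =
  fixes s :: "complex \<Rightarrow> 'v::ab_group_add \<Rightarrow> 'v"
    and V :: "'v set"
    and \<rho> :: "'a::nonarch_local_field^2^2 \<Rightarrow> 'a^2^2 \<Rightarrow> 'v \<Rightarrow> 'v"
  assumes vector_space: "vector_space s"
    and subspace: "module.subspace s V"
    and act_closed: "invertible g \<Longrightarrow> invertible h \<Longrightarrow> v \<in> V \<Longrightarrow> \<rho> g h v \<in> V"
    and act_add: "invertible g \<Longrightarrow> invertible h \<Longrightarrow> v \<in> V \<Longrightarrow> w \<in> V \<Longrightarrow> \<rho> g h (v + w) = \<rho> g h v + \<rho> g h w"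
    and act_scale: "invertible g \<Longrightarrow> invertible h \<Longrightarrow> v \<in> V \<Longrightarrow> \<rho> g h (s c v) = s c (\<rho> g h v)"
    and act_1: "v \<in> V \<Longrightarrow> \<rho> (mat 1) (mat 1) v = v"
    and act_mult: "invertible g \<Longrightarrow> invertible h \<Longrightarrow> invertible g' \<Longrightarrow> invertible h' \<Longrightarrow> v \<in> V \<Longrightarrow>
      \<rho> (g ** g') (h ** h') v = \<rho> g h (\<rho> g' h' v)"
    and smooth: "v \<in> V \<Longrightarrow> \<exists>\<delta>>0. \<delta> < 1 \<and> (\<forall>g\<in>congr \<delta>. \<forall>h\<in>congr \<delta>. \<rho> g h v = v)"
begin

sublocale vector_space s by (rule vector_space)

lemma V_0 [simp]: "0 \<in> V" and V_add: "v \<in> V \<Longrightarrow> w \<in> V \<Longrightarrow> v + w \<in> V"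
  and V_scale: "v \<in> V \<Longrightarrow> s c v \<in> V" and V_diff: "v \<in> V \<Longrightarrow> w \<in> V \<Longrightarrow> v - w \<in> V"
  and V_sum: "(\<And>i. i \<in> I \<Longrightarrow> f i \<in> V) \<Longrightarrow> sum f I \<in> V"
  by (rule subspace_0[OF subspace] subspace_add[OF subspace] subspace_scale[OF subspace]
      subspace_diff[OF subspace] subspace_sum[OF subspace]; assumption?)+

lemma act_0 [simp]: "invertible g \<Longrightarrow> invertible h \<Longrightarrow> \<rho> g h 0 = 0"
  using act_scale[of g h 0 0] by simp

lemma act_sum:
  assumes "invertible g" "invertible h" "\<And>i. i \<in> I \<Longrightarrow> f i \<in> V"
  shows "\<rho> g h (\<Sum>i\<in>I. f i) = (\<Sum>i\<in>I. \<rho> g h (f i))"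
  using assms(3)
  by (induction I rule: infinite_finite_induct) (simp_all add: assms(1,2) act_add V_sum)

lemma act_split:
  assumes "invertible g" "invertible h" "v \<in> V"
  shows "\<rho> g h v = \<rho> g (mat 1) (\<rho> (mat 1) h v)" "\<rho> g h v = \<rho> (mat 1) h (\<rho> g (mat 1) v)"
  using act_mult[of g "mat 1" "mat 1" h v] act_mult[of "mat 1" h g "mat 1" v] assms by simp_all

lemma act_commute:
  assumes "invertible g" "invertible h" "v \<in> V"
  shows "\<rho> g (mat 1) (\<rho> (mat 1) h v) = \<rho> (mat 1) h (\<rho> g (mat 1) v)"
  using act_split[OF assms] by simp

lemma act_inv:
  assumes "invertible g" "invertible h" "v \<in> V"
  shows "\<rho> (matrix_inv g) (matrix_inv h) (\<rho> g h v) = v" "\<rho> g h (\<rho> (matrix_inv g) (matrix_inv h) v) = v"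
  using act_mult[of "matrix_inv g" "matrix_inv h" g h v] act_mult[of g h "matrix_inv g" "matrix_inv h" v] assms
  by (simp_all add: act_1)

definition invariant :: "'v set \<Rightarrow> bool" where
  "invariant W \<longleftrightarrow> subspace W \<and> W \<subseteq> V \<and> (\<forall>g h. invertible g \<longrightarrow> invertible h \<longrightarrow> (\<forall>w\<in>W. \<rho> g h w \<in> W))"

definition irreducible :: bool where
  "irreducible \<longleftrightarrow> V \<noteq> {0} \<and> (\<forall>W. invariant W \<longrightarrow> W = {0} \<or> W = V)"

lemma irreducibleD: "irreducible \<Longrightarrow> invariant W \<Longrightarrow> w \<in> W \<Longrightarrow> w \<noteq> 0 \<Longrightarrow> W = V"
  unfolding irreducible_def by blast

lemma invariant_V: "invariant V"
  by (simp add: invariant_def subspace act_closed)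

lemma smooth_rep_invariant:
  assumes "invariant W"
  shows "smooth_rep s W \<rho>"
proof -
  have W: "subspace W" "\<And>w. w \<in> W \<Longrightarrow> w \<in> V"
    "\<And>g h w. invertible g \<Longrightarrow> invertible h \<Longrightarrow> w \<in> W \<Longrightarrow> \<rho> g h w \<in> W"
    using assms by (auto simp: invariant_def)
  show ?thesis
    by (rule smooth_rep.intro) (fact vector_space | rule W act_add act_scale act_1 act_mult smooth; (rule W)?; assumption)+
qed

definition fixed :: "('a^2^2) set \<Rightarrow> ('a^2^2) set \<Rightarrow> 'v set" where
  "fixed M N = {v \<in> V. \<forall>g\<in>M. \<forall>h\<in>N. \<rho> g h v = v}"

definition orbit :: "('a^2^2) set \<Rightarrow> ('a^2^2) set \<Rightarrow> 'v \<Rightarrow> 'v set" where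
  "orbit M N v = {\<rho> g h v | g h. g \<in> M \<and> h \<in> N}"

text \<open>The integral over M \<times> N with total mass one, written as the mean over the orbit,
  which is finite when M and N are compact groups.\<close>

definition avg :: "('a^2^2) set \<Rightarrow> ('a^2^2) set \<Rightarrow> 'v \<Rightarrow> 'v" where
  "avg M N v = s (1 / of_nat (card (orbit M N v))) (\<Sum>x\<in>orbit M N v. x)"

lemma subspace_fixed:
  assumes "matrix_group M" "matrix_group N"
  shows "subspace (fixed M N)"
  using assms[THEN matrix_groupD(2)]
  by (intro subspaceI) (auto simp: fixed_def V_add V_scale act_add act_scale)


end

section \<open>Averaging over compact groups\<close>

locale averaging = smooth_rep s V \<rho>
  for s :: "complex \<Rightarrow> 'v::ab_group_add \<Rightarrow> 'v" and V and \<rho> :: "'a::nonarch_local_field^2^2 \<Rightarrow> 'a^2^2 \<Rightarrow> 'v \<Rightarrow> 'v" +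
  fixes M N :: "('a^2^2) set"
  assumes M: "matrix_group M" "compact M" and N: "matrix_group N" "compact N"
begin

text \<open>A smooth vector is fixed by some \<open>congr \<delta>\<close> on both sides, so its
  orbit is already swept out by finitely many coset representatives.\<close>

lemma finite_orbit:
  assumes v: "v \<in> V"
  shows "finite (orbit M N v)"
proof -
  obtain \<delta> where \<delta>: "0 < \<delta>" "\<delta> < 1" "\<And>g h. g \<in> congr \<delta> \<Longrightarrow> h \<in> congr \<delta> \<Longrightarrow> \<rho> g h v = v"
    using smooth[OF v] by blast
  note inv = M(1)[THEN matrix_groupD(2)] N(1)[THEN matrix_groupD(2)]
  obtain S where S: "finite S" "S \<subseteq> M" "\<And>x. x \<in> M \<Longrightarrow> \<exists>t\<in>S. \<exists>k\<in>congr \<delta>. x = t ** k"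
    using compact_finite_cosets[OF M(2) inv(1) \<delta>(1,2)] by auto
  obtain T where T: "finite T" "T \<subseteq> N" "\<And>x. x \<in> N \<Longrightarrow> \<exists>t\<in>T. \<exists>k\<in>congr \<delta>. x = t ** k"
    using compact_finite_cosets[OF N(2) inv(2) \<delta>(1,2)] by auto
  have "orbit M N v \<subseteq> (\<lambda>(g, h). \<rho> g h v) ` (S \<times> T)"
  proof
    fix x assume "x \<in> orbit M N v"
    then obtain g h where x: "x = \<rho> g h v" "g \<in> M" "h \<in> N" by (auto simp: orbit_def)
    obtain g' k where g: "g' \<in> S" "k \<in> congr \<delta>" "g = g' ** k" using S(3)[OF x(2)] by blast
    obtain h' l where h: "h' \<in> T" "l \<in> congr \<delta>" "h = h' ** l" using T(3)[OF x(3)] by blast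
    have "invertible k" "invertible l"
      using matrix_groupD(2)[OF matrix_group_congr[of \<delta>]] \<delta>(1,2) g(2) h(2) by simp_all
    then have "x = \<rho> g' h' (\<rho> k l v)"
      unfolding x(1) g(3) h(3) using g(1) h(1) S(2) T(2) v inv(1)[of g'] inv(2)[of h'] by (intro act_mult) auto
    then have "x = \<rho> g' h' v" by (simp add: \<delta>(3) g(2) h(2))
    then show "x \<in> (\<lambda>(g, h). \<rho> g h v) ` (S \<times> T)" using g h by auto
  qed
  then show ?thesis by (rule finite_subset) (simp add: S(1) T(1))
qed

lemma orbit_subset: "v \<in> V \<Longrightarrow> orbit M N v \<subseteq> V"
  using M(1)[THEN matrix_groupD(2)] N(1)[THEN matrix_groupD(2)] by (auto simp: orbit_def act_closed)

lemma orbit_self: "v \<in> V \<Longrightarrow> v \<in> orbit M N v"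
  using M(1)[THEN matrix_groupD(1)] N(1)[THEN matrix_groupD(1)] act_1 unfolding orbit_def by force

lemma card_orbit: "v \<in> V \<Longrightarrow> card (orbit M N v) \<noteq> 0"
  using finite_orbit[of v] orbit_self[of v] by auto

lemma avg_closed: "v \<in> V \<Longrightarrow> avg M N v \<in> V"
  unfolding avg_def using orbit_subset by (intro V_scale V_sum) auto

text \<open>Each pair in M \<times> N maps the finite orbit injectively into itself, hence permutes
  it and preserves the sum.\<close>

lemma avg_fixed:
  assumes v: "v \<in> V"
  shows "avg M N v \<in> fixed M N"
proof -
  have "\<rho> g h (avg M N v) = avg M N v" if g: "g \<in> M" and h: "h \<in> N" for g h
  proof -
    have gh: "invertible g" "invertible h"
      using g h M(1) N(1) by (auto dest: matrix_groupD)
    have O: "orbit M N v \<subseteq> V" by (rule orbit_subset[OF v])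
    have sub: "\<rho> g h ` orbit M N v \<subseteq> orbit M N v"
    proof
      fix x assume "x \<in> \<rho> g h ` orbit M N v"
      then obtain g' h' where x: "x = \<rho> g h (\<rho> g' h' v)" "g' \<in> M" "h' \<in> N" by (auto simp: orbit_def)
      then have "invertible g'" "invertible h'" using M(1) N(1) by (auto dest: matrix_groupD)
      then have "x = \<rho> (g ** g') (h ** h') v" using x(1) gh v by (simp add: act_mult)
      moreover have "g ** g' \<in> M" "h ** h' \<in> N"
        using M(1)[THEN matrix_groupD(4)] N(1)[THEN matrix_groupD(4)] g h x by auto
      ultimately show "x \<in> orbit M N v" unfolding orbit_def by blast
    qed
    have inj: "inj_on (\<rho> g h) (orbit M N v)"
    proof (rule inj_on_inverseI)
      fix x assume "x \<in> orbit M N v"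
      then show "\<rho> (matrix_inv g) (matrix_inv h) (\<rho> g h x) = x" using O gh by (intro act_inv) auto
    qed
    have eq: "\<rho> g h ` orbit M N v = orbit M N v"
      using endo_inj_surj[OF finite_orbit[OF v] sub inj] .
    have "\<rho> g h (\<Sum>x\<in>orbit M N v. x) = (\<Sum>x\<in>orbit M N v. \<rho> g h x)"
      using O by (intro act_sum gh) auto
    also have "\<dots> = (\<Sum>x\<in>\<rho> g h ` orbit M N v. x)"
      by (simp add: sum.reindex[OF inj])
    finally show ?thesis
      unfolding avg_def using act_scale[OF gh, of "\<Sum>x\<in>orbit M N v. x"] O V_sum[of "orbit M N v" "\<lambda>x. x"]
      by (simp add: eq subset_iff)
  qed
  then show ?thesis using avg_closed[OF v] by (simp add: fixed_def)
qed

text \<open>All summands of the mean have the same image. The scalar multiplication \<open>t\<close>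
  of the target is a parameter because L will be an intertwiner, a functional, or the evaluation of
  functionals at a vector.\<close>

lemma avg_hom:
  assumes t: "vector_space t" and v: "v \<in> V"
    and add: "\<And>v w. v \<in> V \<Longrightarrow> w \<in> V \<Longrightarrow> L (v + w) = L v + L w"
    and scale: "\<And>c v. v \<in> V \<Longrightarrow> L (s c v) = t c (L v)"
    and const: "\<And>g h. g \<in> M \<Longrightarrow> h \<in> N \<Longrightarrow> L (\<rho> g h v) = L v"
  shows "L (avg M N v) = L v"
proof -
  interpret t: vector_space t by (rule t)
  have "L (\<Sum>x\<in>A. x) = (\<Sum>x\<in>A. L x)" if "A \<subseteq> V" "finite A" for A
    using that(2,1)
  proof (induction A rule: finite_induct)
    case empty
    show ?case using scale[of 0 0] by simp
  qed (simp add: add V_sum subset_iff)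
  then have "L (\<Sum>x\<in>orbit M N v. x) = (\<Sum>x\<in>orbit M N v. L x)"
    using orbit_subset[OF v] finite_orbit[OF v] by blast
  also have "\<dots> = (\<Sum>x\<in>orbit M N v. L v)"
    by (rule sum.cong) (auto simp: orbit_def const)
  also have "\<dots> = t (of_nat (card (orbit M N v))) (L v)"
    by (simp add: t.sum_constant_scale)
  finally have *: "L (\<Sum>x\<in>orbit M N v. x) = t (of_nat (card (orbit M N v))) (L v)" .
  have "(\<Sum>x\<in>orbit M N v. x) \<in> V" using orbit_subset[OF v] by (intro V_sum) auto
  then show ?thesis
    unfolding avg_def by (simp add: scale * card_orbit[OF v])
qed

end

text \<open>Constrains the map on V only, unlike \<open>Hom_rep\<close>, whose members also vanish
  outside; uniqueness is therefore first proved on \<open>Sch\<close> and extended by zero at the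
  end.\<close>

definition rep_hom ::
  "(complex \<Rightarrow> 'v::ab_group_add \<Rightarrow> 'v) \<Rightarrow> 'v set \<Rightarrow> ('a::nonarch_local_field^2^2 \<Rightarrow> 'a^2^2 \<Rightarrow> 'v \<Rightarrow> 'v) \<Rightarrow>
   (complex \<Rightarrow> 'w::ab_group_add \<Rightarrow> 'w) \<Rightarrow> 'w set \<Rightarrow> ('a^2^2 \<Rightarrow> 'a^2^2 \<Rightarrow> 'w \<Rightarrow> 'w) \<Rightarrow> ('v \<Rightarrow> 'w) \<Rightarrow> bool" where
  "rep_hom s V \<rho> s' V' \<rho>' \<phi> \<longleftrightarrow>
     (\<forall>v\<in>V. \<phi> v \<in> V') \<and> (\<forall>v\<in>V. \<forall>w\<in>V. \<phi> (v + w) = \<phi> v + \<phi> w) \<and> (\<forall>c. \<forall>v\<in>V. \<phi> (s c v) = s' c (\<phi> v)) \<and>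
     (\<forall>g h. invertible g \<longrightarrow> invertible h \<longrightarrow> (\<forall>v\<in>V. \<phi> (\<rho> g h v) = \<rho>' g h (\<phi> v)))"

locale intertwining = V: smooth_rep s V \<rho> + V': smooth_rep s' V' \<rho>'
  for s :: "complex \<Rightarrow> 'v::ab_group_add \<Rightarrow> 'v" and V and \<rho> :: "'a::nonarch_local_field^2^2 \<Rightarrow> 'a^2^2 \<Rightarrow> 'v \<Rightarrow> 'v"
    and s' :: "complex \<Rightarrow> 'w::ab_group_add \<Rightarrow> 'w" and V' and \<rho>' :: "'a^2^2 \<Rightarrow> 'a^2^2 \<Rightarrow> 'w \<Rightarrow> 'w" +
  fixes \<phi> assumes hom: "rep_hom s V \<rho> s' V' \<rho>' \<phi>"
begin

lemma closed: "v \<in> V \<Longrightarrow> \<phi> v \<in> V'"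
  and add: "v \<in> V \<Longrightarrow> w \<in> V \<Longrightarrow> \<phi> (v + w) = \<phi> v + \<phi> w"
  and scale: "v \<in> V \<Longrightarrow> \<phi> (s c v) = s' c (\<phi> v)"
  and act: "invertible g \<Longrightarrow> invertible h \<Longrightarrow> v \<in> V \<Longrightarrow> \<phi> (\<rho> g h v) = \<rho>' g h (\<phi> v)"
  using hom unfolding rep_hom_def by blast+

lemma zero [simp]: "\<phi> 0 = 0"
  using scale[of 0 0] by simp

lemma diff: "v \<in> V \<Longrightarrow> w \<in> V \<Longrightarrow> \<phi> (v - w) = \<phi> v - \<phi> w"
  using add[of "v - w" w, OF V.V_diff] by (simp only: diff_add_cancel) (simp add: algebra_simps)

lemma sum:
  assumes "\<And>i. i \<in> I \<Longrightarrow> f i \<in> V"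
  shows "\<phi> (\<Sum>i\<in>I. f i) = (\<Sum>i\<in>I. \<phi> (f i))"
  using assms by (induction I rule: infinite_finite_induct) (simp_all add: add V.V_sum)

lemma image_invariant:
  assumes "V.invariant W"
  shows "V'.invariant (\<phi> ` W)"
proof -
  have W: "V.subspace W" "W \<subseteq> V" using assms by (auto simp: V.invariant_def)
  have "V'.subspace (\<phi> ` W)"
  proof (rule V'.subspaceI)
    show "0 \<in> \<phi> ` W" using V.subspace_0[OF W(1)] zero by (metis imageI)
    show "x + y \<in> \<phi> ` W" if "x \<in> \<phi> ` W" "y \<in> \<phi> ` W" for x y
    proof -
      from that obtain a b where ab: "a \<in> W" "b \<in> W" "x = \<phi> a" "y = \<phi> b" by auto
      then have "x + y = \<phi> (a + b)" using W(2) by (simp add: add subset_iff)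
      then show ?thesis using ab V.subspace_add[OF W(1)] by blast
    qed
    show "s' c x \<in> \<phi> ` W" if "x \<in> \<phi> ` W" for c x
    proof -
      from that obtain a where ab: "a \<in> W" "x = \<phi> a" by auto
      then have "s' c x = \<phi> (s c a)" using W(2) by (simp add: scale subset_iff)
      then show ?thesis using ab V.subspace_scale[OF W(1)] by blast
    qed
  qed
  moreover have "\<rho>' g h (\<phi> w) \<in> \<phi> ` W" if "invertible g" "invertible h" "w \<in> W" for g h w
  proof -
    have "\<rho>' g h (\<phi> w) = \<phi> (\<rho> g h w)" using that W(2) by (simp add: act subset_iff)
    then show ?thesis using that assms by (simp add: V.invariant_def)
  qed
  ultimately show ?thesis
    using W(2) closed by (auto simp: V'.invariant_def)
qed

lemma irreducible_image:
  assumes "V'.irreducible" "V.invariant W" "w \<in> W" "\<phi> w \<noteq> 0"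
  shows "\<phi> ` W = V'"
  using V'.irreducibleD[OF assms(1) image_invariant[OF assms(2)]] assms(3,4) by blast

text \<open>Taking invariants under a compact group is exact: by irreducibility W maps onto V', and
  averaging a preimage of the fixed vector u does not change its image.\<close>

lemma lift_fixed:
  assumes irr: "V'.irreducible" and W: "V.invariant W" "w \<in> W" "\<phi> w \<noteq> 0"
    and M: "matrix_group M" "compact M" "matrix_group N" "compact N"
    and u: "u \<in> V'.fixed M N"
  shows "\<exists>v\<in>W. v \<in> V.fixed M N \<and> \<phi> v = u"
proof -
  interpret W: smooth_rep s W \<rho> by (rule V.smooth_rep_invariant[OF W(1)])
  interpret W: averaging s W \<rho> M N by unfold_locales (use M in auto)
  have WV: "W \<subseteq> V" using W(1) by (auto simp: V.invariant_def)
  have "u \<in> \<phi> ` W" using irreducible_image[OF irr W] u by (auto simp: V'.fixed_def)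
  then obtain v where v: "v \<in> W" "\<phi> v = u" by auto
  have "\<phi> (W.avg M N v) = \<phi> v"
  proof (rule W.avg_hom[OF V'.vector_space v(1)])
    show "\<phi> (\<rho> g h v) = \<phi> v" if "g \<in> M" "h \<in> N" for g h
    proof -
      have "invertible g" "invertible h" using that M by (auto dest: matrix_groupD)
      then show ?thesis using act that u v WV by (auto simp: V'.fixed_def)
    qed
  qed (rule add scale; use WV in blast)+
  moreover have "W.avg M N v \<in> W.fixed M N" by (rule W.avg_fixed[OF v(1)])
  ultimately show ?thesis
    using v WV by (intro bexI[of _ "W.avg M N v"]) (auto simp: V.fixed_def W.fixed_def)
qed

end

section \<open>Schwartz functions as homogeneous functions on matrices\<close>

definition fscale :: "complex \<Rightarrow> ('x \<Rightarrow> complex) \<Rightarrow> 'x \<Rightarrow> complex" where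
  "fscale c F = (\<lambda>x. c * F x)"

lemma fscale_apply [simp]: "fscale c F x = c * F x"
  by (simp add: fscale_def)

lemma vector_space_fscale: "vector_space fscale"
  by unfold_locales (simp_all add: fun_eq_iff algebra_simps)

lemma sum_fun_apply: "(\<Sum>i\<in>I. f i) x = (\<Sum>i\<in>I. f i x)" for f :: "'i \<Rightarrow> 'x \<Rightarrow> complex"
  by (induction I rule: infinite_finite_induct) simp_all

text \<open>The pullbacks along \<open>proj_class\<close> of the Schwartz functions on
  \<open>Pgl2\<close>. That space is compact, so local constancy suffices; the value at the zero
  matrix is set to 0 to make the pullback a bijection.\<close>

definition Sch :: "('a::nonarch_local_field^2^2 \<Rightarrow> complex) set" where
  "Sch = {F. F 0 = 0 \<and> (\<forall>c x. c \<noteq> 0 \<longrightarrow> F (mat c ** x) = F x) \<and>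
     (\<forall>x. x \<noteq> 0 \<longrightarrow> (\<exists>e>0. \<forall>y. mnorm (y - x) < e \<longrightarrow> F y = F x))}"

text \<open>The Schwartz functions of the open orbit, extended by zero: a locally constant function
  that vanishes on the closed set of singular classes vanishes near it.\<close>

definition Sch0 :: "('a::nonarch_local_field^2^2 \<Rightarrow> complex) set" where
  "Sch0 = {F \<in> Sch. \<forall>x. det x = 0 \<longrightarrow> F x = 0}"

text \<open>Translation of functions evaluates at the image under the inverse group element, and h
  already acts through its inverse; hence only g is inverted here.\<close>

definition mact :: "'a::nonarch_local_field^2^2 \<Rightarrow> 'a^2^2 \<Rightarrow> ('a^2^2 \<Rightarrow> complex) \<Rightarrow> 'a^2^2 \<Rightarrow> complex" where
  "mact g h F = (\<lambda>x. F (matrix_inv g ** x ** h))"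

lemma mact_apply: "mact g h F x = F (matrix_inv g ** x ** h)"
  by (simp add: mact_def)

lemma Sch_0 [simp]: "F \<in> Sch \<Longrightarrow> F 0 = 0"
  by (simp add: Sch_def)

lemma Sch_scale: "F \<in> Sch \<Longrightarrow> c \<noteq> 0 \<Longrightarrow> F (mat c ** x) = F x"
  unfolding Sch_def by blast

lemma Sch_near: "F \<in> Sch \<Longrightarrow> x \<noteq> 0 \<Longrightarrow> \<exists>e>0. \<forall>y. mnorm (y - x) < e \<longrightarrow> F y = F x"
  unfolding Sch_def by blast

lemma mnorm_zero: "mnorm 0 = 0"
  by (simp only: mnorm_eq_0)

lemma compact_sphere: "compact {x::'a::nonarch_local_field^2^2. mnorm x = 1}"
proof (rule compact_mnorm[where R = 1])
  fix x :: "'a^2^2" assume x: "x \<notin> {x. mnorm x = 1}"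
  have "mnorm y \<noteq> 1" if y: "mnorm (y - x) < 1" for y
  proof
    assume "mnorm y = 1"
    then have "mnorm x = mnorm y"
      using y by (intro mnorm_eq_near) (simp add: mnorm_minus_commute)
    then show False using x \<open>mnorm y = 1\<close> by simp
  qed
  then show "\<exists>e>0. \<forall>y. mnorm (y - x) < e \<longrightarrow> y \<notin> {x. mnorm x = 1}"
    using zero_less_one by blast
qed simp

text \<open>A Lebesgue number on the compact unit sphere gives a uniform radius there, and
  homogeneity spreads it to all matrices as a radius relative to the norm.\<close>

lemma Sch_uniform:
  fixes F :: "'a::nonarch_local_field^2^2 \<Rightarrow> complex"
  assumes F: "F \<in> Sch"
  shows "\<exists>\<delta>>0. \<delta> < 1 \<and> (\<forall>x y. mnorm (y - x) \<le> \<delta> * mnorm x \<longrightarrow> F y = F x)"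
proof -
  let ?S = "{x::'a^2^2. mnorm x = 1}"
  let ?G = "{G. open G \<and> (\<exists>c. \<forall>y\<in>G. F y = c)}"
  have cover: "?S \<subseteq> \<Union>?G"
  proof
    fix x :: "'a^2^2" assume "x \<in> ?S"
    then have "x \<noteq> 0" using mnorm_eq_0[of x] by auto
    then obtain e where e: "e > 0" "\<forall>y. mnorm (y - x) < e \<longrightarrow> F y = F x"
      using Sch_near[OF F] by blast
    have "F y = F x" if "y \<in> ball x e" for y
    proof -
      have "mnorm (y - x) < e"
        using mnorm_le_dist[of y x] that by (simp add: dist_commute)
      then show ?thesis using e by blast
    qed
    then have "ball x e \<in> ?G" by auto
    then show "x \<in> \<Union>?G" using e(1) by (meson UnionI centre_in_ball)
  qed
  have opn: "\<And>G. G \<in> ?G \<Longrightarrow> open G" by simp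
  obtain \<epsilon> where \<epsilon>: "0 < \<epsilon>" "\<And>x. x \<in> ?S \<Longrightarrow> \<exists>G\<in>?G. ball x \<epsilon> \<subseteq> G"
    by (rule Heine_Borel_lemma[OF compact_sphere cover], rule opn, assumption, rule that)
  \<comment> \<open>A distance is at most 4 times the norm, so dividing by 8 leaves 4 \<delta>
    strictly below \<epsilon>; the bound 1/2 secures \<delta> < 1.\<close>
  define \<delta> where "\<delta> = min (1/2) (\<epsilon> / 8)"
  have \<delta>: "0 < \<delta>" "\<delta> < 1" "4 * \<delta> < \<epsilon>" using \<epsilon>(1) by (auto simp: \<delta>_def min_def)
  have *: "F y = F x" if x: "mnorm x = 1" and y: "mnorm (y - x) \<le> \<delta>" for x y
  proof -
    have "dist x y \<le> 4 * mnorm (y - x)" using dist_le_mnorm[of x y] mnorm_minus_commute[of x y] by simp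
    then have "y \<in> ball x \<epsilon>" using y \<delta>(3) by simp
    moreover
    have "\<exists>G\<in>?G. ball x \<epsilon> \<subseteq> G" by (rule \<epsilon>(2)) (use x in simp)
    then obtain G where G: "G \<in> ?G" "ball x \<epsilon> \<subseteq> G" by (rule bexE)
    from G(1) obtain c where "\<And>y. y \<in> G \<Longrightarrow> F y = c" by blast
    moreover note G(2)
    moreover have "x \<in> ball x \<epsilon>" using \<epsilon>(1) by simp
    ultimately have "F y = c" "F x = c" by blast+
    then show ?thesis by simp
  qed
  have "F y = F x" if y: "mnorm (y - x) \<le> \<delta> * mnorm x" for x y
  proof (cases "x = 0")
    case True
    then have "mnorm y = 0" using y mnorm_nonneg[of y] by (simp add: mnorm_zero)
    then show ?thesis using True by simp
  next
    case False
    then obtain c where c: "c \<noteq> 0" "mnorm (mat c ** x) = 1" using ex_normalized by blast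
    have "mnorm (mat c ** y - mat c ** x) = absval c * mnorm (y - x)"
      using mnorm_scale[of c "y - x"] by (simp add: matrix_mult_distribs)
    also have "\<dots> \<le> absval c * (\<delta> * mnorm x)" using y by (intro mult_left_mono) simp_all
    also have "\<dots> = \<delta>" using c(2) by simp
    finally have "F (mat c ** y) = F (mat c ** x)" by (intro * c(2))
    then show ?thesis using Sch_scale[OF F c(1)] by simp
  qed
  then show ?thesis using \<delta> by blast
qed

text \<open>Expand into (g - 1) x h + x (h - 1). The bound is relative to \<open>mnorm x\<close> in
  order to match \<open>Sch_uniform\<close>; together they show that translation is smooth on
  \<open>Sch\<close>.\<close>

lemma congr_mult_near:
  assumes \<delta>: "0 < \<delta>" "\<delta> < 1" and g: "g \<in> congr \<delta>" and h: "h \<in> congr \<delta>"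
  shows "mnorm (g ** x ** h - x) \<le> \<delta> * mnorm x"
proof -
  have "g ** x ** h - x = (g - mat 1) ** x ** h + x ** (h - mat 1)"
    by (simp add: matrix_mult_distribs)
  also have "mnorm \<dots> \<le> \<delta> * mnorm x"
  proof (rule mnorm_add_le)
    have "mnorm ((g - mat 1) ** x ** h) \<le> \<delta> * mnorm x * 1"
      using g congr_mnorm[OF \<delta>(2) h] by (intro mnorm_mult_mono) (auto simp: congr_def)
    then show "mnorm ((g - mat 1) ** x ** h) \<le> \<delta> * mnorm x" by simp
    have "mnorm (x ** (h - mat 1)) \<le> mnorm x * \<delta>"
      using h by (intro mnorm_mult_mono) (auto simp: congr_def)
    then show "mnorm (x ** (h - mat 1)) \<le> \<delta> * mnorm x" by (simp add: mult.commute)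
  qed
  finally show ?thesis .
qed

lemma mact_Sch:
  assumes g: "invertible g" and h: "invertible h" and F: "F \<in> Sch"
  shows "mact g h F \<in> Sch"
  unfolding Sch_def mem_Collect_eq
proof (intro conjI allI impI)
  show "mact g h F 0 = 0"
  proof -
    have "matrix_inv g ** 0 ** h = 0" using g h by simp
    then show ?thesis using F by (simp add: mact_apply)
  qed
  show "mact g h F (mat c ** x) = mact g h F x" if "c \<noteq> 0" for c x
    using Sch_scale[OF F that, of "matrix_inv g ** x ** h"]
    by (simp add: mact_apply mat_mult_pull1 mat_mult_pull2)
  fix x :: "'a^2^2" assume x: "x \<noteq> 0"
  let ?g = "matrix_inv g"
  have "?g ** x ** h \<noteq> 0" using x g h by simp
  then obtain e where e: "e > 0" "\<And>y. mnorm (y - ?g ** x ** h) < e \<Longrightarrow> F y = F (?g ** x ** h)"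
    using Sch_near[OF F] by blast
  define K where "K = mnorm ?g * mnorm h"
  have K: "K > 0"
  proof -
    have "?g \<noteq> 0" "h \<noteq> 0" using invertible_inv[OF g] h by (auto simp: invertible_det det_2)
    then show ?thesis by (simp add: K_def)
  qed
  have "mact g h F y = mact g h F x" if y: "mnorm (y - x) < e / K" for y
    unfolding mact_apply
  proof (rule e(2))
    have "?g ** y ** h - ?g ** x ** h = ?g ** (y - x) ** h" by (simp add: matrix_mult_distribs)
    also have "mnorm \<dots> \<le> mnorm ?g * mnorm (y - x) * mnorm h"
      by (intro mnorm_mult_mono order_refl)
    also have "\<dots> = K * mnorm (y - x)" by (simp add: K_def)
    also have "\<dots> < e" using y K by (simp add: field_simps)
    finally show "mnorm (?g ** y ** h - ?g ** x ** h) < e" .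
  qed
  then show "\<exists>e>0. \<forall>y. mnorm (y - x) < e \<longrightarrow> mact g h F y = mact g h F x"
    using e(1) K by (intro exI[of _ "e / K"]) simp
qed

lemma Sch_combine:
  assumes F: "F \<in> Sch" and G: "G \<in> Sch" and op: "op 0 0 = (0::complex)"
  shows "(\<lambda>x. op (F x) (G x)) \<in> Sch"
  unfolding Sch_def mem_Collect_eq
proof (intro conjI allI impI)
  show "op (F 0) (G 0) = 0" using F G op by simp
  show "op (F (mat c ** x)) (G (mat c ** x)) = op (F x) (G x)" if "c \<noteq> 0" for c x
    by (simp only: Sch_scale[OF F that] Sch_scale[OF G that])
  fix x assume "x \<noteq> (0::'a^2^2)"
  then obtain e e' where e: "e > 0" "\<And>y. mnorm (y - x) < e \<Longrightarrow> F y = F x"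
    "e' > 0" "\<And>y. mnorm (y - x) < e' \<Longrightarrow> G y = G x"
    using Sch_near[OF F] Sch_near[OF G] by metis
  have "op (F y) (G y) = op (F x) (G x)" if "mnorm (y - x) < min e e'" for y
    using e(2,4)[of y] that by simp
  then show "\<exists>e>0. \<forall>y. mnorm (y - x) < e \<longrightarrow> op (F y) (G y) = op (F x) (G x)"
    using e(1,3) by (intro exI[of _ "min e e'"]) simp
qed

lemma Sch_add: "F \<in> Sch \<Longrightarrow> G \<in> Sch \<Longrightarrow> (\<lambda>x. F x + G x) \<in> Sch"
  by (rule Sch_combine[where op = "(+)"]) simp_all

lemma Sch_mult: "F \<in> Sch \<Longrightarrow> G \<in> Sch \<Longrightarrow> (\<lambda>x. F x * G x) \<in> Sch"
  by (rule Sch_combine[where op = "(*)"]) simp_all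

lemma Sch_zero [simp]: "(\<lambda>x. 0) \<in> Sch"
  unfolding Sch_def mem_Collect_eq using zero_less_one by blast

lemma subspace_Sch: "module.subspace fscale (Sch :: ('a::nonarch_local_field^2^2 \<Rightarrow> complex) set)"
proof -
  interpret vector_space fscale by (rule vector_space_fscale)
  have z: "(0 :: 'a^2^2 \<Rightarrow> complex) = (\<lambda>x. 0)" by (simp add: fun_eq_iff)
  show ?thesis
  proof (rule subspaceI)
    show "(0 :: 'a^2^2 \<Rightarrow> complex) \<in> Sch" unfolding z by simp
    show "F + G \<in> Sch" if "F \<in> Sch" "G \<in> Sch" for F G :: "'a^2^2 \<Rightarrow> complex"
      using Sch_add[OF that] by (simp add: plus_fun_def)
    show "fscale c F \<in> Sch" if "F \<in> Sch" for c and F :: "'a^2^2 \<Rightarrow> complex"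
      using Sch_combine[OF that that, of "\<lambda>a b. c * a"] by (simp add: fscale_def)
  qed
qed

lemma mact_1: "mact (mat 1) (mat 1) F = F"
  by (simp add: mact_def)

lemma mact_mult:
  "invertible g \<Longrightarrow> invertible g' \<Longrightarrow> mact (g ** g') (h ** h') F = mact g h (mact g' h' F)"
  by (simp add: mact_def matrix_inv_mult matrix_mul_assoc)

lemma mact_smooth:
  fixes F :: "'a::nonarch_local_field^2^2 \<Rightarrow> complex"
  assumes F: "F \<in> Sch"
  shows "\<exists>\<delta>>0. \<delta> < 1 \<and> (\<forall>g\<in>congr \<delta>. \<forall>h\<in>congr \<delta>. mact g h F = F)"
proof -
  obtain \<delta> where \<delta>: "\<delta> > 0" "\<delta> < 1" "\<And>x y. mnorm (y - x) \<le> \<delta> * mnorm x \<Longrightarrow> F y = F x"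
    using Sch_uniform[OF F] by blast
  have "mact g h F = F" if g: "g \<in> congr \<delta>" and h: "h \<in> congr \<delta>" for g h
  proof
    fix x
    have "matrix_inv g \<in> congr \<delta>" using matrix_groupD(3)[OF matrix_group_congr g] \<delta> by simp
    then show "mact g h F x = F x"
      unfolding mact_apply by (intro \<delta>(3) congr_mult_near \<delta>(1,2) h)
  qed
  then show ?thesis using \<delta>(1,2) by blast
qed

interpretation Sch: smooth_rep fscale "Sch :: ('a::nonarch_local_field^2^2 \<Rightarrow> complex) set" mact
  by (rule smooth_rep.intro)
    (simp_all add: vector_space_fscale subspace_Sch mact_Sch mact_1 mact_mult mact_smooth,
     simp_all add: mact_def fun_eq_iff)

lemma det_mact_0:
  fixes g h x :: "'a::field^2^2"
  shows "invertible g \<Longrightarrow> invertible h \<Longrightarrow> det (g ** x ** h) = 0 \<longleftrightarrow> det x = 0"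
  by (simp add: det_mul invertible_det)

lemma invariant_Sch0: "Sch.invariant (Sch0 :: ('a::nonarch_local_field^2^2 \<Rightarrow> complex) set)"
  unfolding Sch.invariant_def
proof (intro conjI allI impI ballI Sch.subspaceI)
  fix g h :: "'a^2^2" and F :: "'a^2^2 \<Rightarrow> complex" assume gh: "invertible g" "invertible h" and "F \<in> Sch0"
  then show "mact g h F \<in> Sch0"
    using invertible_inv[OF gh(1)] by (auto simp: Sch0_def mact_Sch mact_apply det_mact_0)
qed (auto simp: Sch0_def Sch.V_add Sch.V_scale Sch.V_0[unfolded zero_fun_def])

text \<open>Openness is asked of A alone. For t \<le> 1 a matrix closer to x than
  \<open>t * mnorm x\<close> has the same norm as x, so closeness is symmetric and the complement is
  open too.\<close>

lemma indicator_Sch: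
  assumes "0 \<notin> A" and sc: "\<And>c x. c \<noteq> 0 \<Longrightarrow> x \<in> A \<Longrightarrow> mat c ** x \<in> A"
    and t: "0 < t" "t \<le> 1" and near: "\<And>x y. x \<in> A \<Longrightarrow> mnorm (y - x) < t * mnorm x \<Longrightarrow> y \<in> A"
  shows "indicator A \<in> Sch"
  unfolding Sch_def mem_Collect_eq
proof (intro conjI allI impI)
  show "indicator A 0 = (0::complex)" using assms(1) by simp
  fix c :: 'a and x :: "'a^2^2" assume c: "c \<noteq> 0"
  have "x = mat (inverse c) ** (mat c ** x)" using c by (simp add: mat_mult_assoc)
  then have "mat c ** x \<in> A \<longleftrightarrow> x \<in> A" using sc[OF c, of x] sc[of "inverse c" "mat c ** x"] c by auto
  then show "indicator A (mat c ** x) = (indicator A x :: complex)" by (simp add: indicator_def)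
next
  fix x :: "'a^2^2" assume "x \<noteq> 0"
  have "y \<in> A \<longleftrightarrow> x \<in> A" if y: "mnorm (y - x) < t * mnorm x" for y
  proof
    assume "y \<in> A"
    have "t * mnorm x \<le> mnorm x" using t by (simp add: mult_left_le_one_le)
    then have "mnorm y = mnorm x" using y by (intro mnorm_eq_near) simp
    then show "x \<in> A" using near[OF \<open>y \<in> A\<close>, of x] y by (simp add: mnorm_minus_commute)
  qed (use near y in blast)
  then show "\<exists>e>0. \<forall>y. mnorm (y - x) < e \<longrightarrow> indicator A y = (indicator A x :: complex)"
    using t(1) \<open>x \<noteq> 0\<close> by (intro exI[of _ "t * mnorm x"]) (simp add: indicator_def)
qed

text \<open>A function that is constant on the blocks of an open partition of the invertible
  matrices and supported there is a finite combination of block indicators. As an induction rule it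
  also builds up objects attached to the function, such as operators.\<close>

lemma Sch0_partition_induct:
  fixes f :: "'a::nonarch_local_field^2^2 \<Rightarrow> complex"
  assumes f: "f \<in> Sch0"
    and B: "\<And>x. invertible x \<Longrightarrow> open (B x)" "\<And>x. invertible x \<Longrightarrow> x \<in> B x"
    and eq: "\<And>x y. invertible x \<Longrightarrow> y \<in> B x \<Longrightarrow> invertible y \<and> B y = B x"
    and scale: "\<And>c x y. c \<noteq> 0 \<Longrightarrow> invertible x \<Longrightarrow> y \<in> B x \<Longrightarrow> mat c ** y \<in> B x"
    and const: "\<And>x y. invertible x \<Longrightarrow> y \<in> B x \<Longrightarrow> f y = f x"
    and zero: "Q (\<lambda>x. 0)"
    and step: "\<And>F c x. Q F \<Longrightarrow> invertible x \<Longrightarrow> Q (\<lambda>y. F y + c * indicator (B x) y)"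
  shows "Q f"
proof -
  have fS: "f \<in> Sch" and fd: "\<And>x. f x \<noteq> 0 \<Longrightarrow> invertible x"
    using f by (auto simp: Sch0_def invertible_det)
  \<comment> \<open>The normalized part of the support. It is compact and consists of invertible
    matrices, so finitely many blocks cover it; homogeneity then covers the whole support.\<close>
  let ?C = "{x. mnorm x = 1 \<and> f x \<noteq> 0}"
  have C: "compact ?C"
  proof (rule compact_mnorm[where R = 1])
    fix x :: "'a^2^2" assume x: "x \<notin> ?C"
    obtain \<delta> where \<delta>: "\<delta> > 0" "\<delta> < 1" "\<And>x y. mnorm (y - x) \<le> \<delta> * mnorm x \<Longrightarrow> f y = f x"
      using Sch_uniform[OF fS] by blast
    have "y \<notin> ?C" if y: "mnorm (y - x) < \<delta>" for y
    proof
      assume "y \<in> ?C"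
      then have "mnorm y = 1" "f y \<noteq> 0" by auto
      moreover have "mnorm x = mnorm y"
        using y \<delta> \<open>mnorm y = 1\<close> by (intro mnorm_eq_near) (simp add: mnorm_minus_commute)
      moreover have "f x = f y"
        using y \<open>mnorm y = 1\<close> by (intro \<delta>(3)) (simp add: mnorm_minus_commute)
      ultimately show False using x by simp
    qed
    then show "\<exists>e>0. \<forall>y. mnorm (y - x) < e \<longrightarrow> y \<notin> ?C" by (intro exI[of _ \<delta>] conjI \<delta>(1)) blast
  qed simp
  have cover: "?C \<subseteq> (\<Union>x\<in>?C. B x)" using B(2) fd by blast
  have opn: "open (B x)" if "x \<in> ?C" for x using that B(1) fd by blast
  obtain T where T: "T \<subseteq> ?C" "finite T" "?C \<subseteq> (\<Union>x\<in>T. B x)"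
    by (rule compactE_image[of ?C ?C B, OF C _ cover], rule opn, assumption, rule that)
  have *: "Q F" if "finite T" "\<And>x. x \<in> T \<Longrightarrow> invertible x"
    "\<And>x y. invertible x \<Longrightarrow> y \<in> B x \<Longrightarrow> F y = F x" "\<And>x. F x \<noteq> 0 \<Longrightarrow> x \<in> (\<Union>x\<in>T. B x)" for F T
    using that
  proof (induction T arbitrary: F rule: finite_induct)
    case empty
    then have "F = (\<lambda>x. 0)" by auto
    then show ?case using zero by simp
  next
    case (insert a T)
    \<comment> \<open>Removing the block of a leaves a function that is still constant on blocks and
      lives on the blocks of T.\<close>
    let ?F = "\<lambda>y. F y - F a * indicator (B a) y"
    have a: "invertible a" using insert by auto
    have "Q ?F"
    proof (rule insert.IH)
      show "?F y = ?F x" if x: "invertible x" and y: "y \<in> B x" for x y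
      proof -
        have "y \<in> B a \<longleftrightarrow> x \<in> B a"
          using eq[OF a] eq[OF x y] B(2)[OF x] y by metis
        then show ?thesis using insert.prems(2)[OF x y] by (simp add: indicator_def)
      qed
      show "x \<in> (\<Union>x\<in>T. B x)" if "?F x \<noteq> 0" for x
      proof -
        have "x \<notin> B a"
        proof
          assume "x \<in> B a"
          then show False using that insert.prems(2)[OF a] by simp
        qed
        then show ?thesis using that insert.prems(3)[of x] by auto
      qed
    qed (use insert in auto)
    from step[OF this a, of "F a"] show ?case by simp
  qed
  show ?thesis
  proof (rule *[OF T(2)])
    show "x \<in> (\<Union>x\<in>T. B x)" if "f x \<noteq> 0" for x
    proof -
      have "x \<noteq> 0" using that fS by auto
      then obtain c where c: "c \<noteq> 0" "mnorm (mat c ** x) = 1" using ex_normalized by blast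
      then have "mat c ** x \<in> ?C" using Sch_scale[OF fS c(1)] that by simp
      then obtain t where t: "t \<in> T" "mat c ** x \<in> B t" using T(3) by blast
      have "mat (inverse c) ** (mat c ** x) \<in> B t"
        by (rule scale) (use t T(1) fd c(1) in auto)
      then have "x \<in> B t" using c(1) by (simp add: mat_mult_assoc)
      then show ?thesis using t(1) by blast
    qed
  qed (use T(1) fd const in auto)
qed

section \<open>The cells of the projective space\<close>

lemma absval_not_less_0 [simp]: "\<not> absval (x::'a::nonarch_local_field) < 0"
  by (simp add: not_less)

lemma max_absval_mult:
  fixes c :: "'a::nonarch_local_field"
  shows "max (absval c * u) (absval c * v) = absval c * max u v"
    "max (u * absval c) (v * absval c) = max u v * absval c"
  by (simp_all add: max_mult_distrib_left max_mult_distrib_right)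

text \<open>On a rank-one matrix u v^T this reads |u1| \<le> |u2|, a disc in the first projective
  line; comparing norms of rows extends it to all matrices.\<close>

definition rows_le :: "('a::nonarch_local_field^2^2) set" where
  "rows_le = {x. x \<noteq> 0 \<and> max (absval (x$1$1)) (absval (x$1$2)) \<le> max (absval (x$2$1)) (absval (x$2$2))}"

text \<open>On u v^T this reads |v1| < |v2|. The inequality is strict here and weak for rows because
  the Iwahori subgroup acts on columns from the left and on rows from the right.\<close>

definition cols_less :: "('a::nonarch_local_field^2^2) set" where
  "cols_less = {x. max (absval (x$1$1)) (absval (x$2$1)) < max (absval (x$1$2)) (absval (x$2$2))}"

text \<open>Together with \<open>cell'\<close> one of two open extensions of the same product of
  discs. Only matrices with |x11| = |x22| separate them, and these are the scalar multiples of the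
  Iwahori subgroup.\<close>

definition cell :: "('a::nonarch_local_field^2^2) set" where
  "cell = {x. absval (x$2$1) < absval (x$2$2) \<and> absval (x$1$2) \<le> absval (x$2$2) \<and> absval (x$1$1) < absval (x$2$2)}"

definition cell' :: "('a::nonarch_local_field^2^2) set" where
  "cell' = {x. absval (x$2$1) < absval (x$2$2) \<and> absval (x$1$2) \<le> absval (x$2$2) \<and> absval (x$1$1) \<le> absval (x$2$2)}"

lemma cell_eq: "cell = rows_le \<inter> cols_less"
  by (auto simp: cell_def rows_le_def cols_less_def max_def split: if_splits)

lemma absval_near:
  fixes x y :: "'a::nonarch_local_field"
  assumes "absval (y - x) < r"
  shows "absval x \<le> r \<Longrightarrow> absval y \<le> r" "absval x < r \<Longrightarrow> absval y < r" "absval x = r \<Longrightarrow> absval y = r"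
  using absval_add_le[of x r "y - x"] absval_add_less[of x r "y - x"] absval_eq_near[of y x] assms by simp_all

lemma mnorm_diff_lessD:
  "mnorm (y - x) < r \<Longrightarrow> absval (y$i$j - x$i$j) < r"
  using absval_nth_le_mnorm[of "y - x" i j] by simp

lemma indicator_cell' [simp]: "indicator cell' \<in> Sch"
proof (rule indicator_Sch[where t = 1])
  fix x y :: "'a^2^2" assume x: "x \<in> cell'" and y: "mnorm (y - x) < 1 * mnorm x"
  then have "mnorm x = absval (x$2$2)"
    by (auto simp: cell'_def mnorm_def)
  then have y: "absval (y$i$j - x$i$j) < absval (x$2$2)" for i j
    using y mnorm_diff_lessD by simp
  show "y \<in> cell'"
    using x absval_near[OF y] by (auto simp: cell'_def)
qed (auto simp: cell'_def absval_mult)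

lemma indicator_rows_le [simp]: "indicator rows_le \<in> Sch"
proof (rule indicator_Sch[where t = 1])
  fix x y :: "'a^2^2" assume x: "x \<in> rows_le" and y: "mnorm (y - x) < 1 * mnorm x"
  define r where "r = mnorm x"
  have r: "absval (x$1$1) \<le> r" "absval (x$1$2) \<le> r" "absval (x$2$1) \<le> r" "absval (x$2$2) \<le> r"
    "absval (x$2$1) = r \<or> absval (x$2$2) = r"
    using x by (auto simp: r_def rows_le_def mnorm_def max_def split: if_splits)
  have y: "absval (y$i$j - x$i$j) < r" for i j
    using y mnorm_diff_lessD by (simp add: r_def)
  have "absval (y$1$1) \<le> r" "absval (y$1$2) \<le> r" "absval (y$2$1) = r \<or> absval (y$2$2) = r"
    using r absval_near[OF y] by auto
  moreover have "r > 0" using x by (auto simp: r_def rows_le_def)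
  ultimately show "y \<in> rows_le" by (auto simp: rows_le_def)
qed (simp_all add: rows_le_def absval_mult max_absval_mult del: max.bounded_iff)

lemma indicator_cols_less [simp]: "indicator cols_less \<in> Sch"
proof (rule indicator_Sch[where t = 1])
  fix x y :: "'a^2^2" assume x: "x \<in> cols_less" and y: "mnorm (y - x) < 1 * mnorm x"
  define r where "r = mnorm x"
  have r: "absval (x$1$1) < r" "absval (x$2$1) < r" "absval (x$1$2) = r \<or> absval (x$2$2) = r"
    using x by (auto simp: r_def cols_less_def mnorm_def max_def split: if_splits)
  have y: "absval (y$i$j - x$i$j) < r" for i j
    using y mnorm_diff_lessD by (simp add: r_def)
  have "absval (y$1$1) < r" "absval (y$2$1) < r" "absval (y$1$2) = r \<or> absval (y$2$2) = r"
    using r absval_near[OF y] by auto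
  then show "y \<in> cols_less" by (auto simp: cols_less_def)
qed (simp_all add: cols_less_def absval_mult max_absval_mult del: max_less_iff_conj)

lemma indicator_cell [simp]: "indicator (cell :: ('a::nonarch_local_field^2^2) set) \<in> Sch"
proof -
  have "indicator cell = (\<lambda>x::'a^2^2. indicator rows_le x * indicator cols_less x :: complex)"
    by (auto simp: cell_eq indicator_def fun_eq_iff)
  then show ?thesis using Sch_mult[OF indicator_rows_le indicator_cols_less] by metis
qed

lemma indicator_Sch_scale:
  "indicator A \<in> Sch \<Longrightarrow> c \<noteq> 0 \<Longrightarrow> mat c ** x \<in> A \<longleftrightarrow> x \<in> A"
  using Sch_scale[of "indicator A" c x] by (cases "x \<in> A"; cases "mat c ** x \<in> A") simp_all

lemma mat_mult_in_cell [simp]: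
  "c \<noteq> 0 \<Longrightarrow> mat c ** x \<in> cell \<longleftrightarrow> x \<in> cell" "c \<noteq> 0 \<Longrightarrow> mat c ** x \<in> cell' \<longleftrightarrow> x \<in> cell'"
  by (rule indicator_Sch_scale; simp)+

text \<open>In rank one x11 x22 = x12 x21, which forces |x11| < |x22|. So the boundary cannot tell
  \<open>cell\<close> from \<open>cell'\<close>.\<close>

lemma cell_det_0:
  assumes "det x = 0"
  shows "x \<in> cell \<longleftrightarrow> absval (x$2$1) < absval (x$2$2) \<and> absval (x$1$2) \<le> absval (x$2$2)"
proof -
  have "absval (x$1$1) < absval (x$2$2)" if "absval (x$2$1) < absval (x$2$2)" "absval (x$1$2) \<le> absval (x$2$2)"
  proof -
    have "0 < absval (x$2$2)" using that(1) absval_nonneg le_less_trans by blast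
    have "absval (x$1$1) * absval (x$2$2) = absval (x$2$1) * absval (x$1$2)"
      using assms by (simp add: det_2 mult.commute flip: absval_mult)
    also have "\<dots> \<le> absval (x$2$1) * absval (x$2$2)"
      using that by (intro mult_left_mono) simp_all
    also have "\<dots> < absval (x$2$2) * absval (x$2$2)"
      using that \<open>0 < absval (x$2$2)\<close> by (intro mult_strict_right_mono) simp_all
    finally show ?thesis using \<open>0 < absval (x$2$2)\<close> by (simp add: mult_less_cancel_right)
  qed
  then show ?thesis by (auto simp: cell_def)
qed

lemma cell'_det_0: "det x = 0 \<Longrightarrow> x \<in> cell' \<longleftrightarrow> x \<in> cell"
  using cell_det_0[of x] by (auto simp: cell_def cell'_def)

lemma rank_one:
  fixes x :: "'a::field^2^2"
  assumes "det x = 0" "x \<noteq> 0"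
  obtains u1 u2 v1 v2 where "x = mat2 (u1 * v1) (u1 * v2) (u2 * v1) (u2 * v2)"
    "u1 \<noteq> 0 \<or> u2 \<noteq> 0" "v1 \<noteq> 0 \<or> v2 \<noteq> 0"
proof -
  have d: "x$1$1 * x$2$2 = x$1$2 * x$2$1" using assms(1) by (simp add: det_2)
  show ?thesis
  proof (cases "x$2$1 = 0 \<and> x$2$2 = 0")
    case True
    then show ?thesis using assms(2)
      by (intro that[of 1 "x$1$1" "x$1$2" 0]) (auto simp: matrix_2_eq_iff)
  next
    case row2: False
    show ?thesis
    proof (cases "x$2$2 = 0")
      case True
      then show ?thesis using d row2
        by (intro that[of "x$1$1 / x$2$1" "x$2$1" "x$2$2" 1]) (auto simp: matrix_2_eq_iff)
    next
      case False
      then show ?thesis using d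
        by (intro that[of "x$1$2 / x$2$2" "x$2$1" "x$2$2" 1]) (auto simp: matrix_2_eq_iff field_simps)
    qed
  qed
qed

lemma rank_one_rows_le:
  assumes "v1 \<noteq> 0 \<or> v2 \<noteq> 0" "u1 \<noteq> 0 \<or> u2 \<noteq> 0"
  shows "mat2 (u1 * v1) (u1 * v2) (u2 * v1) (u2 * v2) \<in> rows_le \<longleftrightarrow> absval u1 \<le> absval u2"
proof -
  have "max (absval v1) (absval v2) > 0" using assms by (auto simp: less_max_iff_disj)
  moreover have "mat2 (u1 * v1) (u1 * v2) (u2 * v1) (u2 * v2) \<noteq> 0" using assms by (auto simp: matrix_2_eq_iff)
  ultimately show ?thesis
    by (auto simp: rows_le_def absval_mult max_absval_mult mult_le_cancel_right simp del: max.bounded_iff)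
qed

lemma rank_one_cols_less:
  assumes "u1 \<noteq> 0 \<or> u2 \<noteq> 0"
  shows "mat2 (u1 * v1) (u1 * v2) (u2 * v1) (u2 * v2) \<in> cols_less \<longleftrightarrow> absval v1 < absval v2"
proof -
  have "max (absval u1) (absval u2) > 0" using assms by (auto simp: less_max_iff_disj)
  then show ?thesis
    using assms by (auto simp: cols_less_def absval_mult max_absval_mult mult_less_cancel_left simp del: max_less_iff_conj)
qed

text \<open>Writing x = u v^T, right multiplication moves only v, whereas the condition concerns
  only u. Thus the second group factor fixes this indicator on the boundary.\<close>

lemma rows_le_mult_right:
  assumes "det x = 0" "invertible h"
  shows "x ** h \<in> rows_le \<longleftrightarrow> x \<in> rows_le"
proof (cases "x = 0")
  case True
  then show ?thesis using assms(2) by (simp add: rows_le_def)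
next
  case False
  then obtain u1 u2 v1 v2 where x: "x = mat2 (u1 * v1) (u1 * v2) (u2 * v1) (u2 * v2)"
    "u1 \<noteq> 0 \<or> u2 \<noteq> 0" "v1 \<noteq> 0 \<or> v2 \<noteq> 0" using rank_one[OF assms(1)] by metis
  define w1 w2 where w: "w1 = v1 * h$1$1 + v2 * h$2$1" "w2 = v1 * h$1$2 + v2 * h$2$2"
  have xh: "x ** h = mat2 (u1 * w1) (u1 * w2) (u2 * w1) (u2 * w2)"
    by (simp add: matrix_2_eq_iff matrix_2_mult_nth x(1) w algebra_simps)
  have "x ** h \<noteq> 0" using False assms(2) by simp
  then have "w1 \<noteq> 0 \<or> w2 \<noteq> 0" unfolding xh by (auto simp: matrix_2_eq_iff)
  then show ?thesis unfolding xh using x by (simp add: rank_one_rows_le)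
qed

lemma cols_less_mult_left:
  assumes "det x = 0" "invertible g"
  shows "g ** x \<in> cols_less \<longleftrightarrow> x \<in> cols_less"
proof (cases "x = 0")
  case True
  then show ?thesis using assms(2) by (simp add: cols_less_def)
next
  case False
  then obtain u1 u2 v1 v2 where x: "x = mat2 (u1 * v1) (u1 * v2) (u2 * v1) (u2 * v2)"
    "u1 \<noteq> 0 \<or> u2 \<noteq> 0" "v1 \<noteq> 0 \<or> v2 \<noteq> 0" using rank_one[OF assms(1)] by metis
  define w1 w2 where w: "w1 = g$1$1 * u1 + g$1$2 * u2" "w2 = g$2$1 * u1 + g$2$2 * u2"
  have xh: "g ** x = mat2 (w1 * v1) (w1 * v2) (w2 * v1) (w2 * v2)"
    by (simp add: matrix_2_eq_iff matrix_2_mult_nth x(1) w algebra_simps)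
  have "g ** x \<noteq> 0" using False assms(2) by simp
  then have "w1 \<noteq> 0 \<or> w2 \<noteq> 0" unfolding xh by (auto simp: matrix_2_eq_iff)
  then show ?thesis unfolding xh using x by (simp add: rank_one_cols_less)
qed

text \<open>The Atkin-Lehner element: it normalizes the Iwahori subgroup, its square is the scalar
  \<open>uniformizer\<close>, and it exchanges the chosen disc of each projective line with its
  complement.\<close>

definition flip :: "'a::nonarch_local_field^2^2" where
  "flip = mat2 0 1 uniformizer 0"

lemma invertible_flip [simp]: "invertible flip"
  by (simp add: invertible_det det_2 flip_def)

lemma matrix_inv_flip: "matrix_inv flip = mat (inverse uniformizer) ** flip"
  by (rule matrix_inv_unique) (simp add: matrix_2_eq_iff matrix_2_mult_nth flip_def)

lemma mact_flip:
  assumes "F \<in> Sch"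
  shows "mact flip h F x = F (flip ** x ** h)"
  using Sch_scale[OF assms, of "inverse uniformizer" "flip ** x ** h"]
  by (simp add: mact_apply matrix_inv_flip mat_mult_pull1)

text \<open>Flipping swaps the rows and multiplies one by the uniformizer, and
  \<open>absval_less_iff\<close> turns the resulting weak inequality into the strict negation of the
  original one.\<close>

lemma flip_rows_le:
  fixes x :: "'a::nonarch_local_field^2^2"
  assumes "x \<noteq> 0"
  shows "flip ** x \<in> rows_le \<longleftrightarrow> x \<notin> rows_le"
proof -
  let ?a = "absval (x$1$1)" and ?b = "absval (x$1$2)" and ?c = "absval (x$2$1)" and ?d = "absval (x$2$2)"
  let ?p = "absval (uniformizer::'a)"
  have "max ?c ?d \<le> ?p * max ?a ?b \<longleftrightarrow> max ?c ?d < max ?a ?b"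
  proof (cases "?a \<le> ?b")
    case True
    then show ?thesis
      using absval_less_iff[of "x$2$1" "x$1$2"] absval_less_iff[of "x$2$2" "x$1$2"]
      using assms by (cases "x$1$2 = 0") (auto simp: absval_mult max_absorb2 not_less matrix_2_eq_iff)
  next
    case False
    then have "x$1$1 \<noteq> 0" by auto
    then show ?thesis
      using absval_less_iff[of "x$2$1" "x$1$1"] absval_less_iff[of "x$2$2" "x$1$1"] False
      by (auto simp: absval_mult max_absorb1)
  qed
  moreover have "flip ** x \<noteq> 0" using assms by simp
  ultimately show ?thesis
    using assms unfolding rows_le_def mem_Collect_eq
    by (simp add: flip_def matrix_2_mult_nth absval_mult max_absval_mult not_le
        del: max.bounded_iff max_less_iff_conj)
qed

lemma flip_cols_less:
  fixes x :: "'a::nonarch_local_field^2^2"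
  assumes "x \<noteq> 0"
  shows "x ** flip \<in> cols_less \<longleftrightarrow> x \<notin> cols_less"
proof -
  let ?a = "absval (x$1$1)" and ?b = "absval (x$1$2)" and ?c = "absval (x$2$1)" and ?d = "absval (x$2$2)"
  let ?p = "absval (uniformizer::'a)"
  have "?p * max ?b ?d < max ?a ?c \<longleftrightarrow> max ?b ?d \<le> max ?a ?c" 
  proof -
    have "?p * u < v \<longleftrightarrow> u \<le> v" if "u = absval y" "v = absval z" "u \<noteq> 0 \<or> v \<noteq> 0" for u v and y z :: 'a
    proof (cases "y = 0")
      case False
      have "u \<le> v \<longleftrightarrow> \<not> absval z < absval y" using that by auto
      also have "\<dots> \<longleftrightarrow> \<not> absval z \<le> ?p * u" using absval_less_iff[of z y] False that by (simp add: absval_mult)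
      finally show ?thesis using that by auto
    qed (use that in \<open>auto simp: less_le\<close>)
    moreover have "\<exists>y. max ?b ?d = absval (y::'a)" "\<exists>y. max ?a ?c = absval (y::'a)"
      by (auto simp: max_def)
    moreover have "max ?b ?d \<noteq> 0 \<or> max ?a ?c \<noteq> 0"
      using assms by (auto simp: matrix_2_eq_iff max_def split: if_splits)
    ultimately show ?thesis by metis
  qed
  then show ?thesis
    by (simp add: cols_less_def flip_def matrix_2_mult_nth absval_mult max_absval_mult not_less
        mult.commute[of _ ?p] del: max.bounded_iff max_less_iff_conj)
qed

text \<open>The unit disc is the disjoint union of the discs of radius |d| about the residues; truth
  values are summed so that indicator identities become algebra.\<close>

lemma sum_residues:
  fixes x d :: "'a::nonarch_local_field"
  assumes "d \<noteq> 0" "absval d \<le> 1"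
  shows "(\<Sum>r\<in>residues d. of_bool (absval (x - r) \<le> absval d)) = (of_bool (absval x \<le> 1) :: complex)"
proof (cases "absval x \<le> 1")
  case True
  then obtain r where r: "r \<in> residues d" "absval (x - r) \<le> absval d"
    "\<And>r'. r' \<in> residues d \<Longrightarrow> absval (x - r') \<le> absval d \<Longrightarrow> r' = r"
    using ex1_residues[OF assms(1) True] by metis
  have "(\<Sum>r\<in>residues d. of_bool (absval (x - r) \<le> absval d)) = (\<Sum>r'\<in>residues d. if r' = r then 1 else 0 :: complex)"
  proof (rule sum.cong[OF refl])
    fix r' assume "r' \<in> residues d"
    then have "absval (x - r') \<le> absval d \<longleftrightarrow> r' = r" using r(2,3) by metis
    then show "of_bool (absval (x - r') \<le> absval d) = (if r' = r then 1 else 0 :: complex)"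
      by (simp only: of_bool_def)
  qed
  then show ?thesis using r(1) True finite_residues[OF assms(1)] by simp
next
  case False
  have "\<not> absval (x - r) \<le> absval d" if "r \<in> residues d" for r
  proof
    assume "absval (x - r) \<le> absval d"
    then have "absval ((x - r) + r) \<le> 1"
      using assms absval_residues[OF assms(1) that] by (intro absval_add_le) auto
    with False show False by simp
  qed
  then show ?thesis using False by simp
qed

text \<open>On the coordinate u1/u2 this acts as z -> d z + r and carries the unit disc to the disc
  of radius |d| about r.\<close>

definition left_shift :: "'a::nonarch_local_field \<Rightarrow> 'a \<Rightarrow> 'a^2^2" where
  "left_shift d r = mat2 d r 0 1"

text \<open>Multiplication from the right acts on v1/v2 as w -> (w - r)/d, the inverse of an affine
  contraction, as is appropriate for the argument that \<open>mact\<close> does not invert.\<close>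

definition right_shift :: "'a::nonarch_local_field \<Rightarrow> 'a \<Rightarrow> 'a^2^2" where
  "right_shift d r = mat2 1 0 (- r) d"

lemma invertible_shift [simp]:
  "d \<noteq> 0 \<Longrightarrow> invertible (left_shift d r)" "d \<noteq> 0 \<Longrightarrow> invertible (right_shift d r)"
  by (simp_all add: invertible_det det_2 left_shift_def right_shift_def)

lemma matrix_inv_left_shift:
  "d \<noteq> 0 \<Longrightarrow> matrix_inv (left_shift d r) = mat (inverse d) ** mat2 1 (- r) 0 d"
  by (rule matrix_inv_unique) (simp add: matrix_2_eq_iff matrix_2_mult_nth left_shift_def)

text \<open>The decisive point is the bound on \<open>x$1$1\<close>: the uniformizer on the diagonal
  of the shift turns the weak bound of \<open>cell'\<close> into the strict bound of
  \<open>cell\<close>. Only the last condition depends on r, so summing over r is easy.\<close>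

lemma shift_in_cell':
  fixes x :: "'a::nonarch_local_field^2^2"
  assumes "absval r \<le> 1"
  shows "matrix_inv (left_shift uniformizer r) ** x \<in> cell' \<longleftrightarrow>
    absval (x$2$1) < absval (x$2$2) \<and> absval (x$1$1) < absval (x$2$2) \<and>
    absval (x$1$2 / x$2$2 - r) \<le> absval (uniformizer::'a)"
proof (cases "x$2$2 = 0")
  case True
  then show ?thesis
    by (auto simp: matrix_inv_left_shift mat_mult_pull1 cell'_def matrix_2_mult_nth)
next
  case False
  let ?p = "uniformizer::'a"
  have 1: "absval (x$1$2 / x$2$2 - r) \<le> absval ?p \<longleftrightarrow> absval (x$1$2 - r * x$2$2) \<le> absval (?p * x$2$2)"
  proof -
    have "x$1$2 / x$2$2 - r = (x$1$2 - r * x$2$2) / x$2$2" using False by (simp add: field_simps)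
    then show ?thesis using False by (simp add: absval_divide absval_mult pos_divide_le_eq)
  qed
  \<comment> \<open>The term r x21 is smaller than x22, so subtracting it does not affect a strict
    comparison with x22.\<close>
  have 2: "absval (x$1$1 - r * x$2$1) \<le> absval (?p * x$2$2) \<longleftrightarrow> absval (x$1$1) < absval (x$2$2)"
    if "absval (x$2$1) < absval (x$2$2)"
  proof -
    have r: "absval (r * x$2$1) < absval (x$2$2)"
      using that assms mult_left_le_one_le[of "absval (x$2$1)" "absval r"] by (simp add: absval_mult)
    have "absval (x$1$1 - r * x$2$1) < absval (x$2$2) \<longleftrightarrow> absval (x$1$1) < absval (x$2$2)"
      using absval_diff_less[OF _ r, of "x$1$1"] absval_add_less[OF _ r, of "x$1$1 - r * x$2$1"] by auto
    then show ?thesis using absval_less_iff[of "x$1$1 - r * x$2$1" "x$2$2"] False by simp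
  qed
  have "matrix_inv (left_shift ?p r) ** x \<in> cell' \<longleftrightarrow> mat2 1 (- r) 0 ?p ** x \<in> cell'"
    by (simp add: matrix_inv_left_shift mat_mult_pull1)
  also have "\<dots> \<longleftrightarrow> absval (x$2$1) < absval (x$2$2) \<and> absval (x$1$2 - r * x$2$2) \<le> absval (?p * x$2$2)
     \<and> absval (x$1$1 - r * x$2$1) \<le> absval (?p * x$2$2)"
    by (simp add: cell'_def matrix_2_mult_nth absval_mult[of _ "x$2$1"] absval_mult[of _ "x$2$2"])
  finally show ?thesis using 1 2 by auto
qed

text \<open>Cutting the disc of x12/x22 into subdiscs gives \<open>cell\<close> = U
  \<open>cell'\<close>. The identity holds for every matrix, so it applies to homomorphisms that do
  not vanish on the open orbit.\<close>

lemma indicator_cell_eq_sum: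
  fixes x :: "'a::nonarch_local_field^2^2"
  shows "indicator cell x = (\<Sum>r\<in>residues (uniformizer::'a). mact (left_shift uniformizer r) (mat 1) (indicator cell') x :: complex)"
proof -
  let ?p = "uniformizer::'a"
  let ?P = "absval (x$2$1) < absval (x$2$2) \<and> absval (x$1$1) < absval (x$2$2)"
  have "(\<Sum>r\<in>residues ?p. mact (left_shift ?p r) (mat 1) (indicator cell') x :: complex) =
    (\<Sum>r\<in>residues ?p. of_bool ?P * of_bool (absval (x$1$2 / x$2$2 - r) \<le> absval ?p))"
    by (rule sum.cong)
      (simp_all add: mact_apply indicator_def shift_in_cell' absval_residues[OF uniformizer_nz] flip: of_bool_conj)
  also have "\<dots> = of_bool ?P * of_bool (absval (x$1$2 / x$2$2) \<le> 1)"
    by (simp add: sum_residues flip: sum_distrib_left)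
  also have "\<dots> = indicator cell x"
    by (cases "x$2$2 = 0") (auto simp: cell_def indicator_def absval_divide not_less)
  finally show ?thesis by simp
qed

text \<open>On the rank-one locus u1/u2 = x12/x22 and v1/v2 = x21/x22. Dividing the second
  coordinate by the uniformizer makes its strict bound weak, so that the cell is a product of two
  closed unit discs and its shifts are products of smaller ones.\<close>

lemma shift_in_cell:
  fixes x :: "'a::nonarch_local_field^2^2"
  assumes x: "det x = 0" and d: "d \<noteq> 0" "d' \<noteq> 0"
  shows "matrix_inv (left_shift d r) ** x ** right_shift d' (uniformizer * r') \<in> cell \<longleftrightarrow>
    x$2$2 \<noteq> 0 \<and> absval (x$1$2 / x$2$2 - r) \<le> absval d \<and> absval (x$2$1 / (uniformizer * x$2$2) - r') \<le> absval d'"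
proof -
  let ?p = "uniformizer::'a"
  let ?z = "mat2 1 (- r) 0 d ** x ** right_shift d' (?p * r')"
  have "matrix_inv (left_shift d r) ** x ** right_shift d' (?p * r') \<in> cell \<longleftrightarrow> ?z \<in> cell"
    using d by (simp add: matrix_inv_left_shift mat_mult_pull1)
  also have "det ?z = 0" using x by (simp add: det_mul)
  then have "?z \<in> cell \<longleftrightarrow> absval (?z$2$1) < absval (?z$2$2) \<and> absval (?z$1$2) \<le> absval (?z$2$2)"
    by (rule cell_det_0)
  also have "?z$2$1 = d * (x$2$1 - ?p * r' * x$2$2)"
    by (simp add: matrix_2_mult_nth right_shift_def algebra_simps)
  also have "?z$2$2 = d * (d' * x$2$2)"
    by (simp add: matrix_2_mult_nth right_shift_def algebra_simps)
  also have "?z$1$2 = d' * (x$1$2 - r * x$2$2)"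
    by (simp add: matrix_2_mult_nth right_shift_def algebra_simps)
  also have "absval (d * (x$2$1 - ?p * r' * x$2$2)) < absval (d * (d' * x$2$2)) \<longleftrightarrow>
      absval (x$2$1 - ?p * r' * x$2$2) < absval (d' * x$2$2)"
    using d by (simp add: absval_mult[of d])
  also have "\<dots> \<longleftrightarrow> x$2$2 \<noteq> 0 \<and> absval (x$2$1 / (?p * x$2$2) - r') \<le> absval d'"
  proof (cases "x$2$2 = 0")
    case False
    have "x$2$1 / (?p * x$2$2) - r' = (x$2$1 - ?p * r' * x$2$2) / (?p * x$2$2)"
      using False by (simp add: field_simps)
    then have "absval (x$2$1 / (?p * x$2$2) - r') \<le> absval d' \<longleftrightarrow>
        absval (x$2$1 - ?p * r' * x$2$2) \<le> absval (?p * (d' * x$2$2))"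
      using False by (simp add: absval_divide absval_mult pos_divide_le_eq ac_simps)
    then show ?thesis using absval_less_iff[of "x$2$1 - ?p * r' * x$2$2" "d' * x$2$2"] False d by simp
  qed (simp add: not_less)
  finally have 1: "matrix_inv (left_shift d r) ** x ** right_shift d' (?p * r') \<in> cell \<longleftrightarrow>
      (x$2$2 \<noteq> 0 \<and> absval (x$2$1 / (?p * x$2$2) - r') \<le> absval d') \<and>
      absval (d' * (x$1$2 - r * x$2$2)) \<le> absval (d * (d' * x$2$2))" .
  have 2: "absval (d' * (x$1$2 - r * x$2$2)) \<le> absval (d * (d' * x$2$2)) \<longleftrightarrow>
      absval (x$1$2 / x$2$2 - r) \<le> absval d" if "x$2$2 \<noteq> 0"
  proof -
    have "x$1$2 / x$2$2 - r = (x$1$2 - r * x$2$2) / x$2$2" using that by (simp add: field_simps)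
    then show ?thesis using that d by (simp add: absval_divide absval_mult pos_divide_le_eq)
  qed
  show ?thesis unfolding 1 using 2 by blast
qed

lemma cell_det_0':
  fixes x :: "'a::nonarch_local_field^2^2"
  assumes "det x = 0"
  shows "x \<in> cell \<longleftrightarrow> x$2$2 \<noteq> 0 \<and> absval (x$1$2 / x$2$2) \<le> 1 \<and> absval (x$2$1 / (uniformizer * x$2$2)) \<le> 1"
  using cell_det_0[OF assms] absval_less_iff[of "x$2$1" "x$2$2"]
  by (cases "x$2$2 = 0") (auto simp: absval_divide absval_mult pos_divide_le_eq)

section \<open>Homomorphisms supported on the rank-one locus\<close>

text \<open>Both discs are subdivided at once. Small d serves to approximate arbitrary functions on
  the cell; \<open>d = uniformizer\<close> gives a second relation for m.\<close>

lemma indicator_cell_eq_sum_shifts: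
  fixes x :: "'a::nonarch_local_field^2^2"
  assumes x: "det x = 0" and d: "d \<noteq> 0" "absval d \<le> 1"
  shows "indicator cell x = (\<Sum>(r, r')\<in>residues d \<times> residues d.
    mact (left_shift d r) (right_shift d (uniformizer * r')) (indicator cell) x :: complex)"
proof -
  let ?P = "x$2$2 \<noteq> 0"
  let ?A = "\<lambda>r. absval (x$1$2 / x$2$2 - r) \<le> absval d"
  let ?B = "\<lambda>r. absval (x$2$1 / (uniformizer * x$2$2) - r) \<le> absval d"
  have "(\<Sum>(r, r')\<in>residues d \<times> residues d.
      mact (left_shift d r) (right_shift d (uniformizer * r')) (indicator cell) x :: complex)
    = (\<Sum>(r, r')\<in>residues d \<times> residues d. of_bool ?P * (of_bool (?A r) * of_bool (?B r')))"
    by (intro sum.cong refl) (simp add: mact_apply indicator_def shift_in_cell x d split: prod.splits flip: of_bool_conj)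
  also have "\<dots> = of_bool ?P * ((\<Sum>r\<in>residues d. of_bool (?A r)) * (\<Sum>r\<in>residues d. of_bool (?B r)))"
    by (simp only: sum_product sum.cartesian_product) (simp only: sum_distrib_left case_prod_unfold)
  also have "\<dots> = indicator cell x"
    by (simp add: sum_residues d indicator_def cell_det_0'[OF x] flip: of_bool_conj)
  finally show ?thesis by simp
qed

text \<open>In rank one g moves only the first projective line and h only the second, so the
  indicator splits into a product of functions of one variable.\<close>

lemma indicator_cell_mult_det_0:
  fixes g h x :: "'a::nonarch_local_field^2^2"
  assumes "det x = 0" "invertible g" "invertible h"
  shows "indicator cell (g ** x ** h) = (indicator rows_le (g ** x) * indicator cols_less (x ** h) :: complex)"
proof -
  have "g ** x ** h \<in> rows_le \<longleftrightarrow> g ** x \<in> rows_le"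
    using assms by (intro rows_le_mult_right) (simp_all add: det_mul)
  moreover have "g ** (x ** h) \<in> cols_less \<longleftrightarrow> x ** h \<in> cols_less"
    using assms by (intro cols_less_mult_left) (simp_all add: det_mul)
  ultimately show ?thesis by (simp add: cell_eq indicator_def matrix_mul_assoc)
qed

lemma indicator_flip_rows_le:
  "x \<noteq> 0 \<Longrightarrow> indicator rows_le (flip ** x) = (1 - indicator rows_le x :: complex)"
  by (simp add: indicator_def flip_rows_le)

lemma indicator_flip_cols_less:
  "x \<noteq> 0 \<Longrightarrow> indicator cols_less (x ** flip) = (1 - indicator cols_less x :: complex)"
  by (simp add: indicator_def flip_cols_less)

lemma iwahori_cell':
  assumes k: "k \<in> iwahori" and x: "x \<in> cell'"
  shows "k ** x \<in> cell'" "x ** k \<in> cell'"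
proof -
  define r where "r = absval (x$2$2)"
  have x: "absval (x$2$2) = r" "absval (x$2$1) < r" "absval (x$1$2) \<le> r" "absval (x$1$1) \<le> r"
    using x by (auto simp: cell'_def r_def)
  have r: "0 < r" using x(2) absval_nonneg le_less_trans by blast
  have k: "absval (k$1$1) = 1" "absval (k$2$2) = 1" "absval (k$1$2) \<le> 1" "absval (k$2$1) < 1"
    using k by (auto simp: iwahori_def)
  have le: "absval (u * v) \<le> r" if "absval u \<le> 1" "absval v \<le> r" for u v :: 'a
    using mult_mono[OF that] r by (simp add: absval_mult)
  have less: "absval (u * v) < r" if "absval u < 1 \<and> absval v \<le> r \<or> absval u \<le> 1 \<and> absval v < r" for u v :: 'a
  proof (cases "u = 0 \<or> v = 0")
    case False
    then show ?thesis
      using that mult_less_le_imp_less[of "absval u" 1 "absval v" r] mult_le_less_imp_less[of "absval u" 1 "absval v" r]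
      by (auto simp: absval_mult)
  qed (use r in auto)
  have eq: "absval (u + v) = r" if "absval u = r" "absval v < r" for u v :: 'a
    using absval_eq_near[of "u + v" u] that by simp
  have "absval (k$2$2 * x$2$2 + k$2$1 * x$1$2) = r" "absval (k$2$1 * x$1$1 + k$2$2 * x$2$1) < r"
    "absval (k$1$1 * x$1$2 + k$1$2 * x$2$2) \<le> r" "absval (k$1$1 * x$1$1 + k$1$2 * x$2$1) \<le> r"
    by (intro eq absval_add_less absval_add_le le less; use x k in \<open>simp add: absval_mult\<close>)+
  then show "k ** x \<in> cell'" by (simp add: cell'_def matrix_2_mult_nth add.commute)
  have "absval (k$2$2 * x$2$2 + k$1$2 * x$2$1) = r" "absval (k$1$1 * x$2$1 + k$2$1 * x$2$2) < r"
    "absval (k$1$2 * x$1$1 + k$2$2 * x$1$2) \<le> r" "absval (k$1$1 * x$1$1 + k$2$1 * x$1$2) \<le> r"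
    by (intro eq absval_add_less absval_add_le le less; use x k in \<open>simp add: absval_mult\<close>)+
  then show "x ** k \<in> cell'" by (simp add: cell'_def matrix_2_mult_nth add.commute mult.commute)
qed

lemma mact_iwahori_cell':
  assumes g: "g \<in> iwahori" and h: "h \<in> iwahori"
  shows "mact g h (indicator cell') = indicator cell'"
proof
  fix x
  note I = matrix_groupD[OF matrix_group_iwahori]
  have "x \<in> cell'" if "matrix_inv g ** x ** h \<in> cell'"
  proof -
    have "g ** (matrix_inv g ** x ** h) ** matrix_inv h \<in> cell'"
      by (intro iwahori_cell' I g h that)
    then show ?thesis using I(2)[OF g] I(2)[OF h] by (simp add: matrix_mul_assoc)
  qed
  moreover have "matrix_inv g ** x ** h \<in> cell'" if "x \<in> cell'"
    by (intro iwahori_cell' I g h that)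
  ultimately show "mact g h (indicator cell') x = indicator cell' x"
    by (auto simp: mact_apply indicator_def)
qed

text \<open>Dividing the lower left entry by the uniformizer keeps it integral. This allows Iwahori
  factors to be moved past \<open>flip\<close> in \<open>fixed_multiple\<close>.\<close>

lemma flip_conj_iwahori:
  assumes "k \<in> iwahori"
  shows "flip ** k ** matrix_inv flip \<in> iwahori"
proof -
  have "flip ** k ** matrix_inv flip =
      mat2 (k$2$2) (k$2$1 / uniformizer) (uniformizer * k$1$2) (k$1$1)"
    unfolding matrix_inv_flip by (simp add: mat_mult_pull2 matrix_2_eq_iff matrix_2_mult_nth flip_def field_simps)
  moreover have "absval (k$2$1 / uniformizer) \<le> 1"
    using assms absval_less_1_le[of "k$2$1"] by (simp add: iwahori_def absval_divide)
  moreover have "absval (uniformizer * k$1$2) < 1"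
    using assms by (intro absval_mult_less_1) (auto simp: iwahori_def)
  ultimately show ?thesis using assms by (simp add: iwahori_def)
qed

context smooth_rep
begin

lemma invariant_fixed:
  assumes M: "matrix_group M" "\<And>g k. invertible g \<Longrightarrow> k \<in> M \<Longrightarrow> matrix_inv g ** k ** g \<in> M"
    and N: "matrix_group N" "\<And>g k. invertible g \<Longrightarrow> k \<in> N \<Longrightarrow> matrix_inv g ** k ** g \<in> N"
  shows "invariant (fixed M N)"
proof -
  have "\<rho> k l (\<rho> g h v) = \<rho> g h v"
    if gh: "invertible g" "invertible h" and v: "v \<in> fixed M N" and kl: "k \<in> M" "l \<in> N" for g h k l v
  proof -
    let ?k = "matrix_inv g ** k ** g" and ?l = "matrix_inv h ** l ** h"
    have v': "v \<in> V" and fx: "\<rho> ?k ?l v = v" using v M(2) N(2) gh kl by (auto simp: fixed_def)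
    have inv: "invertible k" "invertible l" "invertible ?k" "invertible ?l"
      using matrix_groupD(2)[OF M(1)] matrix_groupD(2)[OF N(1)] M(2) N(2) gh kl by auto
    have "\<rho> k l (\<rho> g h v) = \<rho> (g ** ?k) (h ** ?l) v"
      using act_mult[of k l g h v] inv gh v' by (simp add: matrix_mul_assoc)
    also have "\<dots> = \<rho> g h v" using act_mult[of g h ?k ?l v] inv gh v' by (simp add: fx)
    finally show ?thesis .
  qed
  then show ?thesis
    using subspace_fixed[OF M(1) N(1)] by (auto simp: invariant_def fixed_def act_closed)
qed

text \<open>Each factor is normal in the product group. So in an irreducible V a single nonzero
  vector fixed by one factor makes that factor act trivially.\<close>

lemma invariant_fixed_GL:
  shows "invariant (fixed {mat 1} {h. invertible h})" "invariant (fixed {h. invertible h} {mat 1})"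
proof -
  have GL: "matrix_group {h :: 'a^2^2. invertible h}"
    by (auto simp: matrix_group_def invertible_mult)
  show "invariant (fixed {mat 1} {h. invertible h})" "invariant (fixed {h. invertible h} {mat 1})"
    by (rule invariant_fixed; use GL matrix_group_1 in \<open>simp add: invertible_mult\<close>)+
qed

end

locale Sch_hom = intertwining fscale "Sch :: ('a::nonarch_local_field^2^2 \<Rightarrow> complex) set" mact s V \<rho> \<phi>
  for s :: "complex \<Rightarrow> 'v::ab_group_add \<Rightarrow> 'v" and V and \<rho> :: "'a::nonarch_local_field^2^2 \<Rightarrow> 'a^2^2 \<Rightarrow> 'v \<Rightarrow> 'v" and \<phi> +
  assumes irreducible: "V'.irreducible"
begin

lemma phi_cell: "\<phi> (indicator cell) =
    (\<Sum>r\<in>residues (uniformizer::'a). \<rho> (left_shift uniformizer r) (mat 1) (\<phi> (indicator cell')))"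
proof -
  have "(indicator cell :: 'a^2^2 \<Rightarrow> complex) =
      (\<Sum>r\<in>residues (uniformizer::'a). mact (left_shift uniformizer r) (mat 1) (indicator cell'))"
    by (rule ext) (simp only: indicator_cell_eq_sum sum_fun_apply)
  then show ?thesis by (simp add: sum act mact_Sch)
qed

end

locale boundary_hom = Sch_hom s V \<rho> \<phi>
  for s :: "complex \<Rightarrow> 'v::ab_group_add \<Rightarrow> 'v" and V and \<rho> :: "'a::nonarch_local_field^2^2 \<Rightarrow> 'a^2^2 \<Rightarrow> 'v \<Rightarrow> 'v" and \<phi> +
  assumes kills: "F \<in> Sch0 \<Longrightarrow> \<phi> F = 0"
begin

lemma phi_cong:
  assumes F: "F \<in> Sch" and G: "G \<in> Sch" and eq: "\<And>x. det x = 0 \<Longrightarrow> F x = G x"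
  shows "\<phi> F = \<phi> G"
proof -
  have "F - G \<in> Sch0" using V.V_diff[OF F G] eq by (simp add: Sch0_def)
  then have "\<phi> (F - G) = 0" by (rule kills)
  then show ?thesis by (simp add: diff F G)
qed

lemma phi_cell': "\<phi> (indicator cell') = \<phi> (indicator cell)"
  by (rule phi_cong) (simp_all add: indicator_def cell'_det_0)

text \<open>Subdivide the cell into pieces so small that F is constant on each; on the boundary F
  times the cell is then a combination of translates of the cell, all of which are killed.\<close>

lemma phi_restrict_cell:
  assumes zero: "\<phi> (indicator cell) = 0" and F: "F \<in> Sch"
  shows "\<phi> (\<lambda>x. F x * indicator cell x) = 0"
proof -
  obtain \<delta> where \<delta>: "\<delta> > 0" "\<And>x y. mnorm (y - x) \<le> \<delta> * mnorm x \<Longrightarrow> F y = F x"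
    using Sch_uniform[OF F] by metis
  obtain d :: 'a where d: "d \<noteq> 0" "absval d \<le> \<delta>" "absval d < 1" using ex_small[OF \<delta>(1)] by metis
  let ?p = "uniformizer :: 'a"
  \<comment> \<open>The sample point of the piece (r, r'): the rank-one matrix with x22 = 1 and
    affine coordinates r and r'.\<close>
  define m where "m = (\<lambda>(r, r'). mat2 (r * (?p * r')) r (?p * r') 1)"
  define t :: "'a \<times> 'a \<Rightarrow> 'a^2^2 \<Rightarrow> complex" where
    "t = (\<lambda>(r, r'). mact (left_shift d r) (right_shift d (?p * r')) (indicator cell))"
  let ?R = "residues d \<times> residues d"
  have t: "t q \<in> Sch" for q
    using d by (auto simp: t_def mact_Sch split: prod.splits)
  have "\<phi> (t q) = 0" for q
    using d by (auto simp: t_def act zero split: prod.splits)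
  then have "\<phi> (\<Sum>q\<in>?R. fscale (F (m q)) (t q)) = 0"
    by (simp add: sum scale t V.V_scale)
  moreover have "F x * indicator cell x = (\<Sum>q\<in>?R. fscale (F (m q)) (t q)) x" if x: "det x = 0" for x
  proof -
    have "F x * t q x = F (m q) * t q x" if q: "q \<in> ?R" for q
    proof (cases "t q x = 0")
      case False
      obtain r r' where q': "q = (r, r')" by (cases q)
      define b c where bc: "b = x$1$2 / x$2$2" "c = x$2$1 / (?p * x$2$2)"
      have x22: "x$2$2 \<noteq> 0" and b': "absval (b - r) \<le> absval d" and c': "absval (c - r') \<le> absval d"
        using False shift_in_cell[OF x d(1) d(1), of r r']
        by (auto simp: t_def q' mact_apply indicator_def bc)
      have r: "absval r \<le> 1" "absval r' \<le> 1" using absval_residues[OF d(1)] q q' by auto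
      have "absval (c - r' + r') \<le> 1" by (rule absval_add_le) (use c' r d in auto)
      then have c1: "absval c \<le> 1" by simp
      have c2: "absval (?p * c - ?p * r') \<le> absval d"
        using c' mult_mono[of "absval ?p" 1 "absval (c - r')" "absval d"]
        by (simp add: absval_mult flip: right_diff_distrib)
      have a: "absval (b * (?p * c) - r * (?p * r')) \<le> absval d"
      proof -
        have "b * (?p * c) - r * (?p * r') = (b - r) * (?p * c) + r * (?p * c - ?p * r')"
          by (simp add: algebra_simps)
        also have "absval \<dots> \<le> absval d"
        proof (rule absval_add_le)
          have "absval (b - r) * absval (?p * c) \<le> absval d * 1"
            using b' c1 by (intro mult_mono absval_mult_le_1) simp_all
          then show "absval ((b - r) * (?p * c)) \<le> absval d" by (simp add: absval_mult)
          have "absval r * absval (?p * c - ?p * r') \<le> 1 * absval d"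
            using r c2 by (intro mult_mono) simp_all
          then show "absval (r * (?p * c - ?p * r')) \<le> absval d" by (simp add: absval_mult)
        qed
        finally show ?thesis .
      qed
      \<comment> \<open>The multiple of x with lower right entry 1, in the affine coordinates b and
        c; it is within |d| of the sample point.\<close>
      define y where "y = mat2 (b * (?p * c)) b (?p * c) 1"
      have "x = mat (x$2$2) ** y"
        using x x22 by (simp add: matrix_2_eq_iff y_def det_2 bc field_simps)
      then have "F x = F y" using Sch_scale[OF F x22, of y] by simp
      also have "F y = F (m q)"
      proof (rule \<delta>(2))
        have "absval (?p * r') \<le> 1" "absval (r * (?p * r')) \<le> 1"
          using r by (auto intro!: absval_mult_le_1)
        then have "mnorm (m q) = 1"
          using r by (auto simp: m_def q' mnorm_def)
        moreover have "mnorm (y - m q) \<le> absval d"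
          using a b' c2 by (simp add: mnorm_le_iff y_def m_def q')
        ultimately show "mnorm (y - m q) \<le> \<delta> * mnorm (m q)" using d by simp
      qed
      finally show ?thesis by simp
    qed simp
    then have "(\<Sum>q\<in>?R. fscale (F (m q)) (t q)) x = F x * (\<Sum>q\<in>?R. t q x)"
      unfolding sum_fun_apply sum_distrib_left fscale_apply by (intro sum.cong refl) metis
    also have "(\<Sum>q\<in>?R. t q x) = indicator cell x"
      using indicator_cell_eq_sum_shifts[OF x d(1)] d(3) by (simp add: t_def case_prod_unfold)
    finally show ?thesis by (rule sym)
  qed
  ultimately show ?thesis
    using phi_cong[OF Sch_mult[OF F indicator_cell], of "\<Sum>q\<in>?R. fscale (F (m q)) (t q)"]
    by (simp add: V.V_sum V.V_scale t)
qed

text \<open>The four translates of the cell by 1 or \<open>flip\<close> on either side tile the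
  product of projective lines, and each piece of F can be moved back to the cell itself.\<close>

lemma phi_zero:
  assumes zero: "\<phi> (indicator cell) = 0" and F: "F \<in> Sch"
  shows "\<phi> F = 0"
proof -
  define t where "t g h = (\<lambda>x. F x * mact g h (indicator cell) x)" for g h :: "'a^2^2"
  have t: "t g h \<in> Sch \<and> \<phi> (t g h) = 0" if gh: "invertible g" "invertible h" for g h
  proof -
    let ?F = "mact (matrix_inv g) (matrix_inv h) F"
    let ?G = "\<lambda>x. ?F x * indicator cell x"
    have F': "?F \<in> Sch" using gh F by (simp add: mact_Sch)
    have G: "?G \<in> Sch" using Sch_mult[OF F' indicator_cell] .
    have "t g h = mact g h ?G"
      unfolding t_def mact_apply using gh by (simp add: matrix_mul_assoc)
    then show ?thesis
      using gh G phi_restrict_cell[OF zero F'] by (simp add: mact_Sch act)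
  qed
  let ?S = "t (mat 1) (mat 1) + t flip (mat 1) + t (mat 1) flip + t flip flip"
  have S: "?S \<in> Sch" "\<phi> ?S = 0" using t by (simp_all add: V.V_add add)
  have "\<phi> F = \<phi> ?S"
  proof (rule phi_cong[OF F S(1)])
    fix x :: "'a^2^2" assume x: "det x = 0"
    show "F x = ?S x"
    proof (cases "x = 0")
      case False
      have *: "mact flip h (indicator cell) x = indicator cell (flip ** x ** h)"
         "mact (mat 1) h (indicator cell) x = indicator cell (mat 1 ** x ** h)" for h
        by (simp_all add: mact_flip) (simp add: mact_apply)
      note c = indicator_cell_mult_det_0[OF x]
      have "indicator cell x = (indicator rows_le x * indicator cols_less x :: complex)"
        "indicator cell (flip ** x) = ((1 - indicator rows_le x) * indicator cols_less x :: complex)"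
        "indicator cell (x ** flip) = (indicator rows_le x * (1 - indicator cols_less x) :: complex)"
        "indicator cell (flip ** x ** flip) = ((1 - indicator rows_le x) * (1 - indicator cols_less x) :: complex)"
        using c[of "mat 1" "mat 1"] c[of flip "mat 1"] c[of "mat 1" flip] c[of flip flip] False
        by (simp_all add: indicator_flip_rows_le indicator_flip_cols_less)
      then show ?thesis
        unfolding plus_fun_apply t_def * by (simp only: matrix_mul_lid matrix_mul_rid) (simp add: algebra_simps)
    qed (use F in \<open>simp add: t_def\<close>)
  qed
  then show ?thesis using S by simp
qed

end

locale nonzero_boundary_hom = boundary_hom s V \<rho> \<phi>
  for s :: "complex \<Rightarrow> 'v::ab_group_add \<Rightarrow> 'v" and V and \<rho> :: "'a::nonarch_local_field^2^2 \<Rightarrow> 'a^2^2 \<Rightarrow> 'v \<Rightarrow> 'v" and \<phi> +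
  assumes nonzero: "\<exists>F\<in>Sch. \<phi> F \<noteq> 0"
begin

definition m where "m = \<phi> (indicator cell)"

lemma m_nonzero: "m \<noteq> 0"
  using phi_zero nonzero by (auto simp: m_def)

lemma m_closed [simp]: "m \<in> V"
  by (simp add: m_def closed)

lemma m_fixed: "m \<in> V'.fixed iwahori iwahori"
proof -
  have "\<rho> g h m = m" if "g \<in> iwahori" "h \<in> iwahori" for g h
  proof -
    have "\<rho> g h (\<phi> (indicator cell')) = \<phi> (mact g h (indicator cell'))"
      using that matrix_groupD(2)[OF matrix_group_iwahori] by (intro act[symmetric]) simp_all
    then show ?thesis by (simp add: m_def phi_cell' mact_iwahori_cell'[OF that])
  qed
  then show ?thesis by (simp add: V'.fixed_def)
qed

text \<open>U m = m: both cells have the same image under \<phi>, and U takes one to the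
  other.\<close>

lemma m_eq: "m = (\<Sum>r\<in>residues (uniformizer::'a). \<rho> (left_shift uniformizer r) (mat 1) m)"
  using phi_cell by (simp add: m_def phi_cell')

lemma m_eq2: "m = (\<Sum>(r, r')\<in>residues (uniformizer::'a) \<times> residues uniformizer.
    \<rho> (left_shift uniformizer r) (right_shift uniformizer (uniformizer * r')) m)"
proof -
  let ?R = "residues (uniformizer::'a) \<times> residues uniformizer"
  let ?t = "\<lambda>q. mact (left_shift uniformizer (fst q)) (right_shift uniformizer (uniformizer * snd q)) (indicator cell :: 'a^2^2 \<Rightarrow> complex)"
  have t: "?t q \<in> Sch" for q by (simp add: mact_Sch)
  have "m = \<phi> (\<Sum>q\<in>?R. ?t q)"
    unfolding m_def
    by (rule phi_cong)
      (simp_all add: V.V_sum t indicator_cell_eq_sum_shifts[OF _ uniformizer_nz] sum_fun_apply case_prod_unfold)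
  then show ?thesis by (simp add: sum t act case_prod_unfold flip: m_def)
qed


lemma m_not_multiple: "m \<noteq> s (of_nat (card (residues (uniformizer::'a)))) m"
proof
  let ?q = "card (residues (uniformizer::'a))"
  assume "m = s (of_nat ?q) m"
  then have "s (of_nat ?q - 1) m = 0"
    by (simp add: V'.scale_left_diff_distrib)
  then have "of_nat ?q = (1::complex)" using m_nonzero by simp
  then show False
    using card_residues_uniformizer[where 'a = 'a] by simp
qed

text \<open>On the boundary this indicator is invariant under the second factor. If its image were
  nonzero, that factor would act trivially on V; then \<open>m_eq2\<close> repeats every term of
  \<open>m_eq\<close> q times and gives m = q m.\<close>

lemma phi_rows_le: "\<phi> (indicator rows_le) = 0"
proof (rule ccontr)
  let ?e = "\<phi> (indicator rows_le)" and ?p = "uniformizer :: 'a"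
  assume nz: "?e \<noteq> 0"
  have "\<rho> (mat 1) h ?e = ?e" if "invertible h" for h
  proof -
    have "\<rho> (mat 1) h ?e = \<phi> (mact (mat 1) h (indicator rows_le))"
      using that by (simp add: act)
    also have "\<dots> = ?e"
      using that by (intro phi_cong) (simp_all add: mact_Sch mact_apply indicator_def rows_le_mult_right)
    finally show ?thesis .
  qed
  then have "?e \<in> V'.fixed {mat 1} {h. invertible h}"
    by (simp add: V'.fixed_def closed)
  then have "V'.fixed {mat 1} {h. invertible h} = V"
    using V'.irreducibleD[OF irreducible V'.invariant_fixed_GL(1)] nz by metis
  then have triv: "\<rho> (mat 1) h m = m" if "invertible h" for h
    using m_closed that unfolding V'.fixed_def by blast
  have "\<rho> g h m = \<rho> g (mat 1) m" if "invertible g" "invertible h" for g h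
    using V'.act_split(1)[OF that m_closed] triv[OF that(2)] by simp
  then have *: "\<rho> (left_shift ?p r) (right_shift ?p (?p * r')) m = \<rho> (left_shift ?p r) (mat 1) m" for r r'
    by (metis invertible_shift uniformizer_nz)
  have "m = (\<Sum>(r, r')\<in>residues ?p \<times> residues ?p. \<rho> (left_shift ?p r) (mat 1) m)"
    by (rule trans[OF m_eq2]) (simp only: *)
  also have "\<dots> = (\<Sum>r\<in>residues ?p. \<Sum>r'\<in>residues ?p. \<rho> (left_shift ?p r) (mat 1) m)"
    by (simp add: sum.cartesian_product)
  also have "\<dots> = (\<Sum>r\<in>residues ?p. s (of_nat (card (residues ?p))) (\<rho> (left_shift ?p r) (mat 1) m))"
    by (simp add: V'.sum_constant_scale)
  also have "\<dots> = s (of_nat (card (residues ?p))) m"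
    using m_eq by (simp flip: V'.scale_sum_right)
  finally show False using m_not_multiple by simp
qed

text \<open>As for rows, but now the first factor would act trivially, and already
  \<open>m_eq\<close> becomes m = q m.\<close>

lemma phi_cols_less: "\<phi> (indicator cols_less) = 0"
proof (rule ccontr)
  let ?e = "\<phi> (indicator cols_less)" and ?p = "uniformizer :: 'a"
  assume nz: "?e \<noteq> 0"
  have "\<rho> g (mat 1) ?e = ?e" if "invertible g" for g
  proof -
    have "\<rho> g (mat 1) ?e = \<phi> (mact g (mat 1) (indicator cols_less))"
      using that by (simp add: act)
    also have "\<dots> = ?e"
      using that by (intro phi_cong) (simp_all add: mact_Sch mact_apply indicator_def cols_less_mult_left)
    finally show ?thesis .
  qed
  then have "?e \<in> V'.fixed {h. invertible h} {mat 1}"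
    by (simp add: V'.fixed_def closed)
  then have "V'.fixed {h. invertible h} {mat 1} = V"
    using V'.irreducibleD[OF irreducible V'.invariant_fixed_GL(2)] nz by metis
  then have "\<rho> g (mat 1) m = m" if "invertible g" for g
    using m_closed that unfolding V'.fixed_def by blast
  then have "m = s (of_nat (card (residues ?p))) m"
    using m_eq by (simp add: V'.sum_constant_scale)
  then show False using m_not_multiple by simp
qed

text \<open>In the flipped variable the cell and its translate fill a whole projective line; the sum
  depends on the other variable only and is killed. This is the Atkin-Lehner sign of the Steinberg
  representation.\<close>

lemma flip_m:
  shows "\<rho> flip (mat 1) m = - m" "\<rho> (mat 1) flip m = - m" "\<rho> flip flip m = m"
proof -
  let ?c = "indicator cell :: 'a^2^2 \<Rightarrow> complex"
  have sum0: "m + \<rho> g h m = 0"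
    if gh: "invertible g" "invertible h" and F: "F \<in> Sch" "\<phi> F = 0"
      and eq: "\<And>x. det x = 0 \<Longrightarrow> x \<noteq> 0 \<Longrightarrow> indicator cell x + mact g h (indicator cell) x = F x" for g h F
  proof -
    have S: "mact g h ?c \<in> Sch" using gh by (simp add: mact_Sch)
    have "m + \<rho> g h m = \<phi> (?c + mact g h ?c)"
      using gh S by (simp add: add act m_def)
    also have "\<dots> = \<phi> F"
    proof (rule phi_cong)
      fix x :: "'a^2^2" assume "det x = 0"
      then show "(?c + mact g h ?c) x = F x"
        using eq[of x] S F by (cases "x = 0") simp_all
    qed (use S F in \<open>simp_all add: V.V_add\<close>)
    finally show ?thesis using F by simp
  qed
  have "m + \<rho> flip (mat 1) m = 0"
  proof (rule sum0[OF _ _ indicator_cols_less phi_cols_less])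
    fix x :: "'a^2^2" assume x: "det x = 0" "x \<noteq> 0"
    note c = indicator_cell_mult_det_0[OF x(1)]
    show "?c x + mact flip (mat 1) ?c x = indicator cols_less x"
      using c[of "mat 1" "mat 1"] c[of flip "mat 1"] x by (simp add: mact_flip indicator_flip_rows_le algebra_simps)
  qed simp_all
  then show 1: "\<rho> flip (mat 1) m = - m" by (simp add: eq_neg_iff_add_eq_0 add.commute)
  have "m + \<rho> (mat 1) flip m = 0"
  proof (rule sum0[OF _ _ indicator_rows_le phi_rows_le])
    fix x :: "'a^2^2" assume x: "det x = 0" "x \<noteq> 0"
    note c = indicator_cell_mult_det_0[OF x(1)]
    show "?c x + mact (mat 1) flip ?c x = indicator rows_le x"
      using c[of "mat 1" "mat 1"] c[of "mat 1" flip] x by (simp add: mact_apply indicator_flip_cols_less algebra_simps)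
  qed simp_all
  then show 2: "\<rho> (mat 1) flip m = - m" by (simp add: eq_neg_iff_add_eq_0 add.commute)
  have "\<rho> flip flip m = \<rho> flip (mat 1) (s (- 1) m)"
    using V'.act_split(1)[of flip flip m] by (simp add: 2)
  also have "\<dots> = m" using V'.act_scale[of flip "mat 1" m "- 1"] by (simp add: 1)
  finally show "\<rho> flip flip m = m" .
qed

text \<open>Lift v to a function F invariant under the Iwahori subgroup on both sides. On the
  boundary the four tiles are single orbits, so F is constant on each, and by \<open>flip_m\<close>
  every tile has image m or -m.\<close>

lemma fixed_multiple:
  assumes "v \<in> V'.fixed iwahori iwahori"
  shows "\<exists>c. v = s c m"
proof -
  note I = matrix_groupD[OF matrix_group_iwahori]
  obtain F0 where "F0 \<in> Sch" "\<phi> F0 \<noteq> 0" using nonzero by blast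
  then obtain F where F: "F \<in> V.fixed iwahori iwahori" "F \<in> Sch" "\<phi> F = v"
    using lift_fixed[OF irreducible V.invariant_V _ _ matrix_group_iwahori compact_iwahori
        matrix_group_iwahori compact_iwahori assms] by metis
  have FI: "F (k ** x ** l) = F x" if "k \<in> iwahori" "l \<in> iwahori" for k l x
  proof -
    have "mact (matrix_inv k) l F = F" using F(1) I(3)[OF that(1)] that(2) by (simp add: V.fixed_def)
    then have "mact (matrix_inv k) l F x = F x" by simp
    then show ?thesis using I(2)[OF that(1)] by (simp add: mact_apply)
  qed
  \<comment> \<open>The base point of the cell; its translates by 1 and \<open>flip\<close> are base
    points of the four tiles.\<close>
  let ?e = "mat2 0 0 0 1 :: 'a^2^2"
  let ?k = "\<lambda>g h. F (g ** ?e ** matrix_inv h)"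
  let ?t = "\<lambda>g h. mact g h (indicator cell :: 'a^2^2 \<Rightarrow> complex)"
  have const: "F x = ?k g h"
    if x: "det x = 0" and c: "matrix_inv g ** x ** h \<in> cell"
      and g: "g = mat 1 \<or> g = flip" and h: "h = mat 1 \<or> h = flip" for x g h
  proof -
    have inv: "invertible g" "invertible h" using g h by auto
    define z where "z = matrix_inv g ** x ** h"
    have z: "det z = 0" using x by (simp add: z_def det_mul)
    have z22: "z$2$2 \<noteq> 0" and "absval (z$1$2 / z$2$2) \<le> 1" and "absval (z$2$1 / (uniformizer * z$2$2)) \<le> 1"
      using c cell_det_0'[OF z] by (simp_all flip: z_def)
    moreover have "absval (z$2$1) < absval (z$2$2)" using c by (simp add: cell_def flip: z_def)
    ultimately have k: "mat2 1 (z$1$2 / z$2$2) 0 1 \<in> iwahori" "mat2 1 0 (z$2$1 / z$2$2) 1 \<in> iwahori"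
      by (simp_all add: iwahori_def absval_divide)
    \<comment> \<open>Unipotent Iwahori elements that carry the base point to z, up to the scalar
      z22.\<close>
    define k1 k2 where k12: "k1 = mat2 1 (z$1$2 / z$2$2) 0 1" "k2 = mat2 1 0 (z$2$1 / z$2$2) 1"
    have conj: "g ** k ** matrix_inv g \<in> iwahori" if "g = mat 1 \<or> g = flip" "k \<in> iwahori" for g k :: "'a^2^2"
      using that flip_conj_iwahori by auto
    have zk: "z = mat (z$2$2) ** (k1 ** ?e ** k2)"
      using z z22 by (simp add: matrix_2_eq_iff matrix_2_mult_nth k12 det_2 field_simps)
    have "x = g ** z ** matrix_inv h"
      using inv by (simp add: z_def matrix_mul_assoc)
    also have "\<dots> = mat (z$2$2) ** (g ** (k1 ** ?e ** k2) ** matrix_inv h)"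
      by (subst zk) (simp only: mat_mult_pull1 mat_mult_pull2[of g])
    finally have "F x = F (mat (z$2$2) ** (g ** (k1 ** ?e ** k2) ** matrix_inv h))"
      by (rule arg_cong)
    also have "\<dots> = F (g ** (k1 ** ?e ** k2) ** matrix_inv h)"
      by (rule Sch_scale[OF F(2) z22])
    \<comment> \<open>Conjugation by g and h, each 1 or \<open>flip\<close>, keeps k1 and k2 in the
      Iwahori subgroup, so the invariance of F absorbs them.\<close>
    also have "g ** (k1 ** ?e ** k2) ** matrix_inv h =
        (g ** k1 ** matrix_inv g) ** (g ** ?e ** matrix_inv h) ** (h ** k2 ** matrix_inv h)"
      using inv by (simp add: matrix_mul_assoc)
    also have "F \<dots> = ?k g h"
      using k by (intro FI conj g h) (simp_all add: k12)
    finally show ?thesis .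
  qed
  let ?G = "fscale (?k (mat 1) (mat 1)) (?t (mat 1) (mat 1)) + fscale (?k flip (mat 1)) (?t flip (mat 1)) +
    fscale (?k (mat 1) flip) (?t (mat 1) flip) + fscale (?k flip flip) (?t flip flip)"
  have S: "?t g h \<in> Sch" if "invertible g" "invertible h" for g h using that by (simp add: mact_Sch)
  have "\<phi> F = \<phi> ?G"
  proof (rule phi_cong)
    show "?G \<in> Sch" using S by (simp add: V.V_add V.V_scale)
    fix x :: "'a^2^2" assume x: "det x = 0"
    show "F x = ?G x"
    proof (cases "x = 0")
      case True
      have "?t g h 0 = 0" if "invertible g" "invertible h" for g h
        using Sch_0[OF S[OF that]] .
      then show ?thesis using True F(2) by simp
    next
      case False
      have t: "F x * ?t g h x = ?k g h * ?t g h x" if "g = mat 1 \<or> g = flip" "h = mat 1 \<or> h = flip" for g h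
      proof (cases "matrix_inv g ** x ** h \<in> cell")
        case True
        show ?thesis by (simp only: const[OF x True that])
      qed (simp add: mact_apply)
      have *: "?t flip h x = indicator cell (flip ** x ** h)"
         "?t (mat 1) h x = indicator cell (mat 1 ** x ** h)" for h
        by (simp_all add: mact_flip) (simp add: mact_apply)
      note c = indicator_cell_mult_det_0[OF x]
      have "?t (mat 1) (mat 1) x + ?t flip (mat 1) x + ?t (mat 1) flip x + ?t flip flip x = 1"
        unfolding *
        using c[of "mat 1" "mat 1"] c[of flip "mat 1"] c[of "mat 1" flip] c[of flip flip] False
        by (simp add: indicator_flip_rows_le indicator_flip_cols_less) (simp add: algebra_simps)
      then have "F x = F x * (?t (mat 1) (mat 1) x + ?t flip (mat 1) x + ?t (mat 1) flip x + ?t flip flip x)"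
        by simp
      also have "\<dots> = ?G x" by (simp add: distrib_left t)
      finally show ?thesis .
    qed
  qed (rule F)
  also have "\<dots> = s (?k (mat 1) (mat 1)) m + s (?k flip (mat 1)) (- m) + s (?k (mat 1) flip) (- m) + s (?k flip flip) m"
    using S by (simp add: add scale V.V_add V.V_scale act flip_m V'.act_1 flip: m_def)
  also have "\<dots> = s (?k (mat 1) (mat 1) - ?k flip (mat 1) - ?k (mat 1) flip + ?k flip flip) m"
    by (simp add: V'.scale_left_distrib V'.scale_left_diff_distrib)
  finally show ?thesis using F(3) by blast
qed

end

section \<open>Homomorphisms that do not vanish on the open orbit\<close>

text \<open>Here \<open>Sch0_partition_induct\<close> is applied to the cosets x G and G x. In the
  left version the translating element is the inverse of x, which is harmless because the step is
  assumed for every invertible matrix.\<close>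

lemma
  fixes f :: "'a::nonarch_local_field^2^2 \<Rightarrow> complex"
  assumes G: "matrix_group G" "open G" and scal: "\<And>c x. c \<noteq> 0 \<Longrightarrow> x \<in> G \<Longrightarrow> mat c ** x \<in> G"
    and f: "f \<in> Sch0" and zero: "Q 0"
  shows coset_induct_right: "\<lbrakk>\<And>x k. k \<in> G \<Longrightarrow> f (x ** k) = f x;
      \<And>F c x. Q F \<Longrightarrow> invertible x \<Longrightarrow> Q (F + fscale c (mact x (mat 1) (indicator G)))\<rbrakk> \<Longrightarrow> Q f"
    and coset_induct_left: "\<lbrakk>\<And>x k. k \<in> G \<Longrightarrow> f (k ** x) = f x;
      \<And>F c x. Q F \<Longrightarrow> invertible x \<Longrightarrow> Q (F + fscale c (mact (mat 1) x (indicator G)))\<rbrakk> \<Longrightarrow> Q f"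
proof -
  note g = matrix_groupD[OF G(1)]
  have zero': "Q (\<lambda>x. 0)" using zero by (simp add: zero_fun_def)
  {
    assume inv: "\<And>x k. k \<in> G \<Longrightarrow> f (x ** k) = f x"
      and step: "\<And>F c x. Q F \<Longrightarrow> invertible x \<Longrightarrow> Q (F + fscale c (mact x (mat 1) (indicator G)))"
    let ?B = "\<lambda>x :: 'a^2^2. {y. matrix_inv x ** y \<in> G}"
    show "Q f"
    proof (rule Sch0_partition_induct[OF f, of ?B Q])
      show "open (?B x)" if "invertible x" for x using that G(2) by (intro open_coset) simp_all
      show "x \<in> ?B x" if "invertible x" for x using that g(1) by simp
      show "invertible y \<and> ?B y = ?B x" if x: "invertible x" and y: "y \<in> ?B x" for x y
      proof -
        define k where "k = matrix_inv x ** y"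
        have k: "k \<in> G" "y = x ** k" using x y by (simp_all add: k_def)
        have "matrix_inv y ** z \<in> G \<longleftrightarrow> matrix_inv x ** z \<in> G" for z
        proof -
          have 1: "matrix_inv y ** z = matrix_inv k ** (matrix_inv x ** z)"
            using k x g(2)[OF k(1)] by (simp add: matrix_inv_mult matrix_mul_assoc)
          have 2: "matrix_inv x ** z = k ** (matrix_inv y ** z)"
            unfolding 1 using g(2)[OF k(1)] by simp
          show ?thesis using 1 2 g(3)[OF k(1)] g(4) k(1) by metis
        qed
        then show ?thesis using k x g(2)[OF k(1)] by (simp add: invertible_mult)
      qed
      show "mat c ** y \<in> ?B x" if "c \<noteq> 0" "invertible x" "y \<in> ?B x" for c x y
        using that scal[of c "matrix_inv x ** y"] by (simp add: mat_mult_pull2)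
      show "f y = f x" if "invertible x" "y \<in> ?B x" for x y
        using inv[of "matrix_inv x ** y" x] that by simp
      show "Q (\<lambda>x. 0)" by (rule zero')
      fix F c and x :: "'a^2^2" assume "Q F" and x: "invertible x"
      have "(\<lambda>y. F y + c * indicator (?B x) y) = F + fscale c (mact x (mat 1) (indicator G))"
        by (auto simp: fun_eq_iff mact_apply indicator_def)
      then show "Q (\<lambda>y. F y + c * indicator (?B x) y)" using step[OF \<open>Q F\<close> x] by simp
    qed
  next
    assume inv: "\<And>x k. k \<in> G \<Longrightarrow> f (k ** x) = f x"
      and step: "\<And>F c x. Q F \<Longrightarrow> invertible x \<Longrightarrow> Q (F + fscale c (mact (mat 1) x (indicator G)))"
    let ?B = "\<lambda>x :: 'a^2^2. {y :: 'a^2^2. y ** matrix_inv x \<in> G}"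
    show "Q f"
    proof (rule Sch0_partition_induct[OF f, of ?B Q])
      show "open (?B x)" if "invertible x" for x using that G(2) by (intro open_coset) simp_all
      show "x \<in> ?B x" if "invertible x" for x using that g(1) by simp
      show "invertible y \<and> ?B y = ?B x" if x: "invertible x" and y: "y \<in> ?B x" for x y
      proof -
        define k where "k = y ** matrix_inv x"
        have k: "k \<in> G" "y = k ** x" using x y by (simp_all add: k_def)
        have "z ** matrix_inv y \<in> G \<longleftrightarrow> z ** matrix_inv x \<in> G" for z
        proof -
          have 1: "z ** matrix_inv y = (z ** matrix_inv x) ** matrix_inv k"
            using k x g(2)[OF k(1)] by (simp add: matrix_inv_mult matrix_mul_assoc)
          have 2: "z ** matrix_inv x = (z ** matrix_inv y) ** k"
            unfolding 1 using g(2)[OF k(1)] by simp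
          show ?thesis using 1 2 g(3)[OF k(1)] g(4) k(1) by metis
        qed
        then show ?thesis using k x g(2)[OF k(1)] by (simp add: invertible_mult)
      qed
      show "mat c ** y \<in> ?B x" if "c \<noteq> 0" "invertible x" "y \<in> ?B x" for c x y
        using that scal[of c "y ** matrix_inv x"] by (simp add: mat_mult_pull1)
      show "f y = f x" if "invertible x" "y \<in> ?B x" for x y
        using inv[of "y ** matrix_inv x" x] that by simp
      show "Q (\<lambda>x. 0)" by (rule zero')
      fix F c and x :: "'a^2^2" assume "Q F" and x: "invertible x"
      have "(\<lambda>y. F y + c * indicator (?B x) y) = F + fscale c (mact (mat 1) (matrix_inv x) (indicator G))"
        by (auto simp: fun_eq_iff mact_apply indicator_def)
      then show "Q (\<lambda>y. F y + c * indicator (?B x) y)" using step[OF \<open>Q F\<close> invertible_inv[OF x]] by simp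
    qed
  }
qed

text \<open>The preimage in the invertible matrices of the image of M in the projective group, when
  M is a matrix group; unlike M itself it is stable under scalars.\<close>

definition scalar_mults :: "('a::nonarch_local_field^2^2) set \<Rightarrow> ('a^2^2) set" where
  "scalar_mults M = {mat c ** x | c x. c \<noteq> 0 \<and> x \<in> M}"

lemma scalar_mults_scale:
  assumes "c \<noteq> 0" "x \<in> scalar_mults M"
  shows "mat c ** x \<in> scalar_mults M"
proof -
  obtain d y where "d \<noteq> 0" "y \<in> M" "x = mat d ** y" using assms(2) by (auto simp: scalar_mults_def)
  then have "mat c ** x = mat (c * d) ** y" "c * d \<noteq> 0" using assms(1) by (simp_all add: mat_mult_assoc)
  then show ?thesis using \<open>y \<in> M\<close> unfolding scalar_mults_def by blast
qed

lemma scalar_mults_iff: "x \<in> scalar_mults M \<longleftrightarrow> (\<exists>c. c \<noteq> 0 \<and> mat c ** x \<in> M)"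
proof
  assume "x \<in> scalar_mults M"
  then obtain d y where d: "d \<noteq> 0" "y \<in> M" "x = mat d ** y" by (auto simp: scalar_mults_def)
  then have "mat (inverse d) ** x = y" by (simp add: mat_mult_assoc)
  then show "\<exists>c. c \<noteq> 0 \<and> mat c ** x \<in> M" using d by (intro exI[of _ "inverse d"]) simp
next
  assume "\<exists>c. c \<noteq> 0 \<and> mat c ** x \<in> M"
  then obtain c where c: "c \<noteq> 0" "mat c ** x \<in> M" by blast
  then have "x = mat (inverse c) ** (mat c ** x)" by (simp add: mat_mult_assoc)
  then show "x \<in> scalar_mults M" using c unfolding scalar_mults_def
    by (metis (mono_tags, lifting) inverse_nonzero_iff_nonzero mem_Collect_eq)
qed

lemma subset_scalar_mults: "M \<subseteq> scalar_mults M"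
proof
  fix x assume "x \<in> M"
  then show "x \<in> scalar_mults M"
    unfolding scalar_mults_iff by (intro exI[of _ 1]) simp
qed

lemma open_scalar_mults:
  assumes "open M"
  shows "open (scalar_mults M)"
proof -
  have "scalar_mults M = (\<Union>c\<in>-{0}. {x. mat c ** x \<in> M})"
    by (auto simp: scalar_mults_iff)
  moreover have "open {x. mat c ** x \<in> M}" if "c \<noteq> 0" for c
    by (rule open_coset(1)[OF invertible_mat[OF that] assms])
  ultimately show ?thesis by auto
qed

lemma matrix_group_scalar_mults:
  assumes "matrix_group M"
  shows "matrix_group (scalar_mults M)"
  unfolding matrix_group_def
proof (intro conjI ballI)
  note g = matrix_groupD[OF assms]
  show "mat 1 \<in> scalar_mults M" using g(1) subset_scalar_mults by blast
  fix x assume "x \<in> scalar_mults M"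
  then obtain c u where x: "c \<noteq> 0" "u \<in> M" "x = mat c ** u" by (auto simp: scalar_mults_def)
  show "invertible x" using x g(2) by (simp add: invertible_mult invertible_mat)
  have "matrix_inv x = mat (inverse c) ** matrix_inv u"
    using x g(2)[OF x(2)] by (intro matrix_inv_unique) (simp add: mat_mult_pull1 mat_mult_pull2 mat_mult_mat)
  then show "matrix_inv x \<in> scalar_mults M" using x g(3)[OF x(2)] unfolding scalar_mults_def by force
  fix y assume "y \<in> scalar_mults M"
  then obtain d v where y: "d \<noteq> 0" "v \<in> M" "y = mat d ** v" by (auto simp: scalar_mults_def)
  have "x ** y = mat (c * d) ** (u ** v)"
    unfolding x y by (simp add: mat_mult_pull1 mat_mult_pull2[of u] mat_mult_assoc)
  then show "x ** y \<in> scalar_mults M"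
    using x y g(4)[OF x(2) y(2)] unfolding scalar_mults_def by force
qed

lemma scalar_mults_iwahori_iff:
  "x \<in> scalar_mults iwahori \<longleftrightarrow> x \<in> cell' \<and> x \<notin> cell" for x :: "'a::nonarch_local_field^2^2"
proof
  assume "x \<in> scalar_mults iwahori"
  then obtain c k where x: "c \<noteq> 0" "k \<in> iwahori" "x = mat c ** k" by (auto simp: scalar_mults_def)
  then show "x \<in> cell' \<and> x \<notin> cell" by (auto simp: iwahori_def cell_def cell'_def absval_mult)
next
  assume x: "x \<in> cell' \<and> x \<notin> cell"
  then have "x$2$2 \<noteq> 0" by (auto simp: cell'_def)
  then show "x \<in> scalar_mults iwahori"
    unfolding scalar_mults_iff using x
    by (intro exI[of _ "inverse (x$2$2)"])
      (auto simp: iwahori_def cell_def cell'_def absval_mult absval_inverse field_simps absval_divide)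
qed

lemma indicator_scalar_mults_iwahori:
  "indicator (scalar_mults iwahori) = (indicator cell' - indicator cell :: 'a::nonarch_local_field^2^2 \<Rightarrow> complex)"
  by (auto simp: fun_eq_iff indicator_def scalar_mults_iwahori_iff) (auto simp: cell_def cell'_def)

lemma indicator_scalar_mults_congr:
  assumes \<delta>: "0 < \<delta>" "\<delta> < 1"
  shows "indicator (scalar_mults (congr \<delta>)) \<in> Sch0"
proof -
  have G: "matrix_group (scalar_mults (congr \<delta> :: ('a^2^2) set))"
    using \<delta> by (intro matrix_group_scalar_mults matrix_group_congr) simp_all
  have "indicator (scalar_mults (congr \<delta> :: ('a^2^2) set)) \<in> Sch"
  proof (rule indicator_Sch[OF _ scalar_mults_scale \<delta>(1)])
    show "0 \<notin> scalar_mults (congr \<delta> :: ('a^2^2) set)"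
      using matrix_groupD(2)[OF G, of 0] by (auto simp: invertible_det det_2)
    fix x y :: "'a^2^2" assume "x \<in> scalar_mults (congr \<delta>)" and y: "mnorm (y - x) < \<delta> * mnorm x"
    then obtain c where c: "c \<noteq> 0" "mat c ** x \<in> congr \<delta>" by (auto simp: scalar_mults_iff)
    have "mnorm (mat c ** y - mat c ** x) = absval c * mnorm (y - x)"
      using mnorm_scale[of c "y - x"] by (simp add: matrix_mult_distribs)
    also have "\<dots> < absval c * (\<delta> * mnorm x)" using y c by (intro mult_strict_left_mono) simp_all
    also have "\<dots> = \<delta>" using congr_mnorm[OF \<delta>(2) c(2)] by simp
    finally have "mat c ** y \<in> congr \<delta>" by (rule congr_near) (rule c(2))
    then show "y \<in> scalar_mults (congr \<delta>)" using c(1) by (auto simp: scalar_mults_iff)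
  qed (use \<delta> in simp_all)
  moreover have "x \<notin> scalar_mults (congr \<delta>)" if "det x = 0" for x :: "'a^2^2"
    using matrix_groupD(2)[OF G, of x] that by (auto simp: invertible_det)
  ultimately show ?thesis by (simp add: Sch0_def)
qed

lemma (in intertwining) hom_diff:
  assumes \<psi>: "rep_hom s V \<rho> s' V' \<rho>' \<psi>"
  shows "rep_hom s V \<rho> s' V' \<rho>' (\<lambda>v. \<psi> v - s' c (\<phi> v))"
proof -
  interpret \<psi>: intertwining s V \<rho> s' V' \<rho>' \<psi> by unfold_locales (rule \<psi>)
  have "\<psi> (\<rho> g h v) - s' c (\<phi> (\<rho> g h v)) = \<rho>' g h (\<psi> v - s' c (\<phi> v))"
    if gh: "invertible g" "invertible h" and v: "v \<in> V" for g h v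
  proof -
    have "\<psi> v - s' c (\<phi> v) = \<psi> v + s' (- c) (\<phi> v)" by simp
    then have "\<rho>' g h (\<psi> v - s' c (\<phi> v)) = \<rho>' g h (\<psi> v) + s' (- c) (\<rho>' g h (\<phi> v))"
      using gh v V'.act_add[OF gh, of "\<psi> v" "s' (- c) (\<phi> v)"] V'.act_scale[OF gh, of "\<phi> v" "- c"]
        closed[OF v] \<psi>.closed[OF v] V'.V_scale[of "\<phi> v" "- c"] by simp
    then show ?thesis using gh v by (simp add: act \<psi>.act)
  qed
  then show ?thesis
    unfolding rep_hom_def
    by (simp add: closed add scale \<psi>.closed \<psi>.add \<psi>.scale V'.V_diff V'.V_scale
        V'.scale_right_distrib V'.scale_right_diff_distrib V'.scale_left_commute)
qed

context nonzero_boundary_hom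
begin

text \<open>Were \<psi> nonzero on \<open>Sch0\<close>, the Iwahori-fixed vector m would lift to an
  Iwahori-invariant f in \<open>Sch0\<close>. Such an f is a combination of left translates of the
  Iwahori indicator, whose image under \<psi> is shown to be 0, so m = 0.\<close>

lemma kills_Sch0:
  assumes \<psi>: "rep_hom fscale Sch mact s V \<rho> \<psi>" and f0: "f0 \<in> Sch0"
  shows "\<psi> f0 = 0"
proof (rule ccontr)
  assume nz: "\<psi> f0 \<noteq> 0"
  interpret \<psi>: Sch_hom s V \<rho> \<psi> by unfold_locales (rule \<psi>, rule irreducible)
  have "\<psi> (indicator cell') \<in> V'.fixed iwahori iwahori"
  proof -
    have "\<rho> g h (\<psi> (indicator cell')) = \<psi> (indicator cell')" if "g \<in> iwahori" "h \<in> iwahori" for g h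
      using \<psi>.act[of g h "indicator cell'"] matrix_groupD(2)[OF matrix_group_iwahori] that
      by (metis indicator_cell' mact_iwahori_cell')
    then show ?thesis by (simp add: V'.fixed_def \<psi>.closed)
  qed
  then obtain c where c: "\<psi> (indicator cell') = s c m" using fixed_multiple by blast
  \<comment> \<open>The right-hand side is U applied to c m. Although m arises from \<phi>, its
    relation U m = m is a fact about V and thus applies to \<psi>.\<close>
  have "\<psi> (indicator cell) = (\<Sum>r\<in>residues (uniformizer::'a). s c (\<rho> (left_shift uniformizer r) (mat 1) m))"
    unfolding \<psi>.phi_cell by (simp add: c V'.act_scale)
  also have "\<dots> = s c m" using m_eq by (simp flip: V'.scale_sum_right)
  finally have zero: "\<psi> (indicator (scalar_mults iwahori)) = 0"
    unfolding indicator_scalar_mults_iwahori by (simp add: \<psi>.diff c)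
  obtain f where f: "f \<in> Sch0" "f \<in> V.fixed iwahori iwahori" "\<psi> f = m"
    using \<psi>.lift_fixed[OF irreducible invariant_Sch0 f0 nz matrix_group_iwahori compact_iwahori
        matrix_group_iwahori compact_iwahori m_fixed] by blast
  let ?G = "scalar_mults iwahori :: ('a^2^2) set"
  have "indicator ?G \<in> Sch"
    unfolding indicator_scalar_mults_iwahori by (intro V.V_diff) simp_all
  have "f \<in> Sch \<and> \<psi> f = 0"
  proof (rule coset_induct_right[of ?G f "\<lambda>F. F \<in> Sch \<and> \<psi> F = 0"])
    show "matrix_group ?G" by (intro matrix_group_scalar_mults matrix_group_iwahori)
    show "open ?G" by (intro open_scalar_mults open_iwahori)
    show "f (x ** k) = f x" if k: "k \<in> ?G" for x k
    proof -
      obtain c l where l: "c \<noteq> 0" "l \<in> iwahori" "k = mat c ** l" using k by (auto simp: scalar_mults_def)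
      have "mact (mat 1) l f = f"
        using f(2) l(2) matrix_groupD(1)[OF matrix_group_iwahori[where 'a = 'a]] by (simp add: V.fixed_def)
      then have "mact (mat 1) l f x = f x" by simp
      moreover have "f (mat c ** (x ** l)) = f (x ** l)"
        using f(1) l(1) by (intro Sch_scale) (simp_all add: Sch0_def)
      ultimately show ?thesis by (simp add: mact_apply l(3) mat_mult_pull2)
    qed
    show "F + fscale c (mact x (mat 1) (indicator ?G)) \<in> Sch \<and> \<psi> (F + fscale c (mact x (mat 1) (indicator ?G))) = 0"
      if "F \<in> Sch \<and> \<psi> F = 0" "invertible x" for F c x
      using that \<open>indicator ?G \<in> Sch\<close>
      by (simp add: V.V_add V.V_scale mact_Sch \<psi>.add \<psi>.scale \<psi>.act zero)
  qed (use f(1) in \<open>simp_all add: scalar_mults_scale\<close>)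
  then show False using f(3) m_nonzero by simp
qed

text \<open>Both maps send the cell into the line of m; subtracting the right multiple of \<phi>
  gives a boundary homomorphism that kills the cell, hence everything.\<close>

lemma boundary_hom_unique:
  assumes \<psi>: "boundary_hom s V \<rho> \<psi>"
  shows "\<exists>c. \<forall>F\<in>Sch. \<psi> F = s c (\<phi> F)"
proof -
  interpret \<psi>: boundary_hom s V \<rho> \<psi> by (rule \<psi>)
  have "\<rho> g h (\<psi> (indicator cell')) = \<psi> (indicator cell')" if "g \<in> iwahori" "h \<in> iwahori" for g h
    using \<psi>.act[of g h "indicator cell'"] matrix_groupD(2)[OF matrix_group_iwahori] that
    by (metis indicator_cell' mact_iwahori_cell')
  then have "\<psi> (indicator cell') \<in> V'.fixed iwahori iwahori" by (simp add: V'.fixed_def \<psi>.closed)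
  then obtain c where c: "\<psi> (indicator cell) = s c m" using fixed_multiple \<psi>.phi_cell' by metis
  interpret \<theta>: boundary_hom s V \<rho> "\<lambda>F. \<psi> F - s c (\<phi> F)"
  proof unfold_locales
    show "rep_hom fscale Sch mact s V \<rho> (\<lambda>F. \<psi> F - s c (\<phi> F))"
      by (rule hom_diff[OF \<psi>.hom])
  qed (use irreducible kills \<psi>.kills in simp_all)
  have "\<psi> F - s c (\<phi> F) = 0" if "F \<in> Sch" for F
    by (rule \<theta>.phi_zero[OF _ that]) (simp add: c m_def)
  then show ?thesis by (intro exI[of _ c]) simp
qed

end

context Sch_hom
begin

text \<open>Compatibility is required with the first factor only: T will be a combination of right
  translations, which need not commute with one another.\<close>

definition left_commuting :: "('v \<Rightarrow> 'v) \<Rightarrow> bool" where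
  "left_commuting T \<longleftrightarrow> (\<forall>v\<in>V. T v \<in> V) \<and> (\<forall>v\<in>V. \<forall>w\<in>V. T (v + w) = T v + T w) \<and>
     (\<forall>c. \<forall>v\<in>V. T (s c v) = s c (T v)) \<and> (\<forall>g. invertible g \<longrightarrow> (\<forall>v\<in>V. T (\<rho> g (mat 1) v) = \<rho> g (mat 1) (T v)))"

text \<open>With \<open>e\<close> the indicator of a small subgroup, \<open>\<psi> e = T (\<phi> e)\<close> for a combination \<open>T\<close> of right translations;
  as \<open>T\<close> commutes with left translations, \<open>\<psi> = T \<circ> \<phi>\<close> on the left translates of \<open>e\<close>, which span.\<close>

lemma kernel_Sch0:
  assumes f0: "f0 \<in> Sch0" "\<phi> f0 \<noteq> 0"
    and \<psi>: "rep_hom fscale Sch mact s V \<rho> \<psi>"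
    and h: "h \<in> Sch0" "\<phi> h = 0"
  shows "\<psi> h = 0"
proof -
  interpret \<psi>: Sch_hom s V \<rho> \<psi> by unfold_locales (rule \<psi>, rule irreducible)
  have hS: "h \<in> Sch" using h by (simp add: Sch0_def)
  \<comment> \<open>The level is taken from h, so that h is a combination of left translates of the
    indicator \<open>?e\<close> of this level.\<close>
  obtain \<delta> where \<delta>: "0 < \<delta>" "\<delta> < 1" "\<And>g k. g \<in> congr \<delta> \<Longrightarrow> k \<in> congr \<delta> \<Longrightarrow> mact g k h = h"
    using V.smooth[OF hS] by blast
  let ?K = "congr \<delta> :: ('a^2^2) set" and ?G = "scalar_mults (congr \<delta>) :: ('a^2^2) set"
  let ?e = "indicator ?G :: 'a^2^2 \<Rightarrow> complex"
  have K: "matrix_group ?K" using \<delta> by (intro matrix_group_congr) simp_all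
  then have G: "matrix_group ?G" by (rule matrix_group_scalar_mults)
  have oG: "open ?G" by (intro open_scalar_mults open_congr \<delta>)
  have e: "?e \<in> Sch0" "?e \<in> Sch"
    using indicator_scalar_mults_congr[OF \<delta>(1,2), where 'a = 'a] by (simp_all add: Sch0_def)
  note k = matrix_groupD[OF K]
  have "mact g (mat 1) ?e = ?e" if g: "g \<in> ?K" for g
  proof
    fix x :: "'a^2^2"
    have G': "g \<in> ?G" using g subset_scalar_mults by blast
    have "x = g ** (matrix_inv g ** x)" using k(2)[OF g] by simp
    then have "matrix_inv g ** x \<in> ?G \<longleftrightarrow> x \<in> ?G"
      using matrix_groupD(3,4)[OF G] G' by metis
    then show "mact g (mat 1) ?e x = ?e x" by (simp add: mact_apply indicator_def)
  qed
  \<comment> \<open>Invariance is used on the left only: the lift f is then left invariant, hence a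
    combination of right translates of \<open>?e\<close>, which is what T encodes.\<close>
  then have "\<psi> ?e \<in> V'.fixed ?K {mat 1}"
    using e(2) \<psi>.act[of _ "mat 1" ?e] k(2) by (auto simp: V'.fixed_def \<psi>.closed) metis
  then obtain f where f: "f \<in> Sch0" "f \<in> V.fixed ?K {mat 1}" "\<phi> f = \<psi> ?e"
    using lift_fixed[OF irreducible invariant_Sch0 f0 K compact_congr[OF \<delta>(1,2)] matrix_group_1 compact_sing]
    by blast
  have "\<exists>T. left_commuting T \<and> f \<in> Sch \<and> \<phi> f = T (\<phi> ?e)"
  proof (rule coset_induct_left[of ?G f "\<lambda>f. \<exists>T. left_commuting T \<and> f \<in> Sch \<and> \<phi> f = T (\<phi> ?e)", OF G oG _ f(1)])
    show "\<exists>T. left_commuting T \<and> 0 \<in> Sch \<and> \<phi> 0 = T (\<phi> ?e)"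
      by (intro exI[of _ "\<lambda>_. 0"]) (simp add: left_commuting_def)
    show "f (l ** x) = f x" if l: "l \<in> ?G" for x l
    proof -
      obtain c j where j: "c \<noteq> 0" "j \<in> ?K" "l = mat c ** j" using l by (auto simp: scalar_mults_def)
      have "mact (matrix_inv j) (mat 1) f = f" using f(2) k(3)[OF j(2)] by (simp add: V.fixed_def)
      then have "mact (matrix_inv j) (mat 1) f x = f x" by simp
      moreover have "f (mat c ** (j ** x)) = f (j ** x)"
        using f(1) j(1) by (intro Sch_scale) (simp_all add: Sch0_def)
      ultimately show ?thesis using k(2)[OF j(2)] by (simp add: mact_apply j(3) mat_mult_pull1)
    qed
    fix F c and x :: "'a^2^2"
    assume "\<exists>T. left_commuting T \<and> F \<in> Sch \<and> \<phi> F = T (\<phi> ?e)" and x: "invertible x"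
    then obtain T where T: "left_commuting T" "F \<in> Sch" "\<phi> F = T (\<phi> ?e)" by blast
    let ?T = "\<lambda>v. T v + s c (\<rho> (mat 1) x v)"
    have "left_commuting ?T"
      unfolding left_commuting_def
    proof (intro conjI ballI allI impI)
      fix g :: "'a^2^2" and v assume g: "invertible g" and v: "v \<in> V"
      have "\<rho> (mat 1) x (\<rho> g (mat 1) v) = \<rho> g (mat 1) (\<rho> (mat 1) x v)"
        using V'.act_commute[OF g x v] by simp
      moreover have "T v \<in> V" "\<rho> (mat 1) x v \<in> V" "T (\<rho> g (mat 1) v) = \<rho> g (mat 1) (T v)"
        using T(1) v x g by (auto simp: left_commuting_def V'.act_closed)
      ultimately show "T (\<rho> g (mat 1) v) + s c (\<rho> (mat 1) x (\<rho> g (mat 1) v))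
          = \<rho> g (mat 1) (T v + s c (\<rho> (mat 1) x v))"
        using g by (simp add: V'.act_add V'.act_scale V'.V_scale)
    qed (use T(1) x in \<open>simp_all add: left_commuting_def V'.V_add V'.V_scale V'.act_closed V'.act_add V'.act_scale
          V'.scale_right_distrib V'.scale_left_commute\<close>)
    moreover have "F + fscale c (mact (mat 1) x ?e) \<in> Sch" "\<phi> (F + fscale c (mact (mat 1) x ?e)) = ?T (\<phi> ?e)"
      using T x e by (simp_all add: V.V_add V.V_scale mact_Sch add scale act)
    ultimately show "\<exists>T. left_commuting T \<and> F + fscale c (mact (mat 1) x ?e) \<in> Sch \<and>
        \<phi> (F + fscale c (mact (mat 1) x ?e)) = T (\<phi> ?e)" by blast
  qed (rule scalar_mults_scale)
  then obtain T where T: "left_commuting T" and eT: "\<psi> ?e = T (\<phi> ?e)" using f(3) by auto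
  have "h \<in> Sch \<and> \<psi> h = T (\<phi> h)"
  proof (rule coset_induct_right[of ?G h "\<lambda>h. h \<in> Sch \<and> \<psi> h = T (\<phi> h)", OF G oG _ h(1)])
    have "T (s 0 0) = s 0 (T 0)" using T V'.V_0 unfolding left_commuting_def by blast
    then show "0 \<in> Sch \<and> \<psi> 0 = T (\<phi> 0)" by simp
    show "h (x ** l) = h x" if l: "l \<in> ?G" for x l
    proof -
      obtain c j where j: "c \<noteq> 0" "j \<in> ?K" "l = mat c ** j" using l by (auto simp: scalar_mults_def)
      have "mact (mat 1) j h x = h x" by (simp only: \<delta>(3)[OF k(1) j(2)])
      moreover have "h (mat c ** (x ** j)) = h (x ** j)"
        by (rule Sch_scale[OF hS j(1)])
      ultimately show ?thesis by (simp add: mact_apply j(3) mat_mult_pull2)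
    qed
    fix F c and x :: "'a^2^2" assume F: "F \<in> Sch \<and> \<psi> F = T (\<phi> F)" and x: "invertible x"
    have "T (\<phi> F + s c (\<rho> x (mat 1) (\<phi> ?e))) = T (\<phi> F) + s c (\<rho> x (mat 1) (T (\<phi> ?e)))"
    proof -
      have "\<phi> F \<in> V" "\<phi> ?e \<in> V" "\<rho> x (mat 1) (\<phi> ?e) \<in> V" "s c (\<rho> x (mat 1) (\<phi> ?e)) \<in> V"
        using F e x by (simp_all add: closed V'.act_closed V'.V_scale)
      then show ?thesis using T x unfolding left_commuting_def by metis
    qed
    then show "F + fscale c (mact x (mat 1) ?e) \<in> Sch \<and>
        \<psi> (F + fscale c (mact x (mat 1) ?e)) = T (\<phi> (F + fscale c (mact x (mat 1) ?e)))"
      using F e x by (simp add: V.V_add V.V_scale mact_Sch add scale act \<psi>.add \<psi>.scale \<psi>.act eT)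
  qed (rule scalar_mults_scale)
  moreover have "T 0 = 0" 
  proof -
    have "T (s 0 0) = s 0 (T 0)" using T V'.V_0 unfolding left_commuting_def by blast
    then show ?thesis by simp
  qed
  ultimately show ?thesis using h(2) by simp
qed

end

section \<open>Schur's lemma and multiplicity one\<close>

context vector_space
begin

text \<open>There is one vector more than B has elements. Repetitions are treated separately because
  \<open>dependent\<close> speaks of sets, not of families.\<close>

lemma linear_dependence_relation:
  assumes "finite B" and f: "\<And>i. i \<le> card B \<Longrightarrow> f i \<in> span B"
  shows "\<exists>c. (\<exists>i\<le>card B. c i \<noteq> 0) \<and> (\<Sum>i\<le>card B. scale (c i) (f i)) = 0"
proof (cases "inj_on f {..card B}")
  case False
  then obtain i j where ij: "i \<le> card B" "j \<le> card B" "i \<noteq> j" "f i = f j"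
    by (auto simp: inj_on_def)
  let ?c = "\<lambda>k. if k = i then 1 else if k = j then - 1 else 0"
  have "(\<Sum>k\<le>card B. scale (?c k) (f k)) = (\<Sum>k\<in>{i, j}. scale (?c k) (f k))"
    using ij by (intro sum.mono_neutral_right) auto
  also have "\<dots> = 0" using ij by simp
  finally show ?thesis using ij by (intro exI[of _ ?c]) auto
next
  case True
  have "dependent (f ` {..card B})"
  proof (rule ccontr)
    assume "independent (f ` {..card B})"
    moreover have "f ` {..card B} \<subseteq> span B" using f by auto
    ultimately have "card (f ` {..card B}) \<le> card B"
      using independent_span_bound[OF assms(1)] by blast
    then show False by (simp add: card_image[OF True])
  qed
  then obtain u v where u: "v \<in> f ` {..card B}" "u v \<noteq> 0" "(\<Sum>v\<in>f ` {..card B}. scale (u v) v) = 0"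
    using dependent_finite[of "f ` {..card B}"] by auto
  then have "(\<Sum>i\<le>card B. scale (u (f i)) (f i)) = 0" by (simp add: sum.reindex[OF True])
  then show ?thesis using u by (intro exI[of _ "u \<circ> f"]) auto
qed

text \<open>Horner's rule: (a + X p) evaluated at T is a + T p(T). Linearity of T is available on U
  only, so the powers must be seen to stay in U.\<close>

lemma poly_apply_pCons:
  assumes U: "subspace U" and TU: "\<And>u. u \<in> U \<Longrightarrow> T u \<in> U"
    and add: "\<And>u v. u \<in> U \<Longrightarrow> v \<in> U \<Longrightarrow> T (u + v) = T u + T v"
    and sc: "\<And>c u. u \<in> U \<Longrightarrow> T (scale c u) = scale c (T u)" and v: "v \<in> U"
  shows "(\<Sum>i\<le>Suc n. scale (coeff (pCons a p) i) ((T ^^ i) v)) =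
    scale a v + T (\<Sum>i\<le>n. scale (coeff p i) ((T ^^ i) v))"
proof -
  have pow: "(T ^^ i) v \<in> U" for i by (induction i) (simp_all add: v TU)
  have "T (\<Sum>i\<in>I. scale (coeff p i) ((T ^^ i) v)) = (\<Sum>i\<in>I. T (scale (coeff p i) ((T ^^ i) v)))"
    if "finite I" for I
    using that
  proof (induction I rule: finite_induct)
    case empty
    show ?case using sc[OF subspace_0[OF U], of 0] by simp
  qed (simp add: add pow subspace_scale[OF U] subspace_sum[OF U])
  then have "T (\<Sum>i\<le>n. scale (coeff p i) ((T ^^ i) v)) = (\<Sum>i\<le>n. scale (coeff p i) ((T ^^ Suc i) v))"
    by (simp add: sc pow)
  then show ?thesis by (subst sum.atMost_Suc_shift) simp
qed

end

text \<open>Take p of least degree annihilating v. It has a root z, and the cofactor q of X - z does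
  not annihilate v by minimality, so q(T) v is an eigenvector.\<close>

lemma ex_eigenvector:
  fixes s :: "complex \<Rightarrow> 'v::ab_group_add \<Rightarrow> 'v"
  assumes "vector_space s" and fin: "finite_dimensional s U" and U: "module.subspace s U"
    and TU: "\<And>u. u \<in> U \<Longrightarrow> T u \<in> U"
    and add: "\<And>u v. u \<in> U \<Longrightarrow> v \<in> U \<Longrightarrow> T (u + v) = T u + T v"
    and sc: "\<And>c u. u \<in> U \<Longrightarrow> T (s c u) = s c (T u)"
    and v: "v \<in> U" "v \<noteq> 0"
  shows "\<exists>w\<in>U. \<exists>c. w \<noteq> 0 \<and> T w = s c w"
proof -
  interpret vector_space s by fact
  obtain B where B: "finite B" "U \<subseteq> span B" using fin by (auto simp: finite_dimensional_def)
  have pow: "(T ^^ i) v \<in> U" for i by (induction i) (simp_all add: v TU)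
  define ev where "ev p = (\<Sum>i\<le>degree p. s (coeff p i) ((T ^^ i) v))" for p
  have ev: "ev p = (\<Sum>i\<le>n. s (coeff p i) ((T ^^ i) v))" if "degree p \<le> n" for p n
    unfolding ev_def using that by (intro sum.mono_neutral_left) (auto simp: coeff_eq_0)
  have evU: "ev p \<in> U" for p
    unfolding ev_def by (intro subspace_sum[OF U] subspace_scale[OF U] pow)
  have "\<exists>p. p \<noteq> 0 \<and> ev p = 0"
  proof -
    obtain c i where c: "i \<le> card B" "c i \<noteq> 0" "(\<Sum>i\<le>card B. s (c i) ((T ^^ i) v)) = 0"
      using linear_dependence_relation[OF B(1), of "\<lambda>i. (T ^^ i) v"] pow B(2) by blast
    define p where "p = (\<Sum>i\<le>card B. monom (c i) i)"
    have co: "coeff p i = (if i \<le> card B then c i else 0)" for i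
      by (simp add: p_def coeff_sum)
    then have "degree p \<le> card B" by (intro degree_le) auto
    then have "ev p = 0" using c(3) by (simp add: ev co)
    moreover have "p \<noteq> 0" using co[of i] c by auto
    ultimately show ?thesis by blast
  qed
  then obtain p where p: "p \<noteq> 0" "ev p = 0" and min: "\<And>q. q \<noteq> 0 \<Longrightarrow> ev q = 0 \<Longrightarrow> degree p \<le> degree q"
    using arg_min_nat_lemma[of "\<lambda>p. p \<noteq> 0 \<and> ev p = 0" _ degree] by (metis (no_types, lifting))
  have "degree p \<noteq> 0"
  proof
    assume "degree p = 0"
    then obtain a where "p = [:a:]" "a \<noteq> 0" using p(1) by (metis degree_eq_zeroE pCons_0_0)
    then show False using p(2) v by (simp add: ev_def)
  qed
  then have "\<not> constant (poly p)" by (simp add: constant_degree)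
  then obtain z where "poly p z = 0" using fundamental_theorem_of_algebra by blast
  then obtain q where q: "p = [:- z, 1:] * q" by (auto simp: poly_eq_0_iff_dvd)
  have q0: "q \<noteq> 0" using p(1) q by auto
  then have deg: "degree p = Suc (degree q)" unfolding q by (subst degree_mult_eq) auto
  then have w: "ev q \<noteq> 0" using min[OF q0] by auto
  have "coeff p i = coeff (pCons 0 q) i - z * coeff q i" for i
    by (simp add: q algebra_simps)
  \<comment> \<open>This is p = X q - z q, coefficient by coefficient. Both sums run one index
    beyond the degree of q, where the coefficient of q is 0.\<close>
  then have "ev p = (\<Sum>i\<le>Suc (degree q). s (coeff (pCons 0 q) i) ((T ^^ i) v)) - s z (\<Sum>i\<le>Suc (degree q). s (coeff q i) ((T ^^ i) v))"
    unfolding ev_def deg by (simp only: scale_left_diff_distrib sum_subtractf scale_sum_right scale_scale)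
  also have "(\<Sum>i\<le>Suc (degree q). s (coeff (pCons 0 q) i) ((T ^^ i) v)) = T (ev q)"
    using poly_apply_pCons[OF U TU add sc v(1), where n = "degree q" and a = 0 and p = q] by (simp only: ev_def scale_zero_left add_0)
  also have "(\<Sum>i\<le>Suc (degree q). s (coeff q i) ((T ^^ i) v)) = ev q"
    by (rule ev[symmetric]) simp
  finally have "T (ev q) = s z (ev q)" using p(2) by simp
  then show ?thesis using evU w by blast
qed

locale irreducible_admissible = smooth_rep s V \<rho>
  for s :: "complex \<Rightarrow> 'v::ab_group_add \<Rightarrow> 'v" and V and \<rho> :: "'a::nonarch_local_field^2^2 \<Rightarrow> 'a^2^2 \<Rightarrow> 'v \<Rightarrow> 'v" +
  assumes irreducible: irreducible
    and fin: "0 < \<delta> \<Longrightarrow> \<delta> < 1 \<Longrightarrow> finite_dimensional s (fixed (congr \<delta>) (congr \<delta>))"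
begin

text \<open>T preserves a nonzero space of vectors fixed by a congruence subgroup. Admissibility
  makes it finite-dimensional, so T has an eigenvector; its eigenspace is invariant, hence all of
  V.\<close>

lemma schur:
  assumes T: "rep_hom s V \<rho> s V \<rho> T"
  shows "\<exists>c. \<forall>v\<in>V. T v = s c v"
proof -
  interpret T: intertwining s V \<rho> s V \<rho> T by unfold_locales (rule T)
  obtain v where v: "v \<in> V" "v \<noteq> 0" using irreducible V_0 unfolding irreducible_def by blast
  obtain \<delta> where \<delta>: "0 < \<delta>" "\<delta> < 1" "\<forall>g\<in>congr \<delta>. \<forall>h\<in>congr \<delta>. \<rho> g h v = v"
    using smooth[OF v(1)] by blast
  have K: "matrix_group (congr \<delta> :: ('a^2^2) set)" using \<delta> by (intro matrix_group_congr) simp_all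
  let ?U = "fixed (congr \<delta>) (congr \<delta>)"
  have "\<exists>w\<in>?U. \<exists>c. w \<noteq> 0 \<and> T w = s c w"
  proof (rule ex_eigenvector[OF vector_space fin[OF \<delta>(1,2)] subspace_fixed[OF K K], of T v])
    fix u assume u: "u \<in> ?U"
    then show "T u \<in> ?U"
      using T.act[of _ _ u] matrix_groupD(2)[OF K] by (auto simp: fixed_def T.closed) metis
    show "T (s c u) = s c (T u)" for c using u by (simp add: fixed_def T.scale)
    fix w assume "w \<in> ?U"
    then show "T (u + w) = T u + T w" using u by (simp add: fixed_def T.add)
  qed (use v \<delta> in \<open>simp_all add: fixed_def\<close>)
  then obtain w c where w: "w \<in> V" "w \<noteq> 0" "T w = s c w" by (auto simp: fixed_def)
  let ?W = "{u \<in> V. T u = s c u}"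
  have "invariant ?W"
    unfolding invariant_def
  proof (intro conjI allI impI ballI subspaceI)
    show "\<rho> g h u \<in> ?W" if "invertible g" "invertible h" "u \<in> ?W" for g h u
      using that by (simp add: T.act act_closed act_scale)
  qed (auto simp: T.add T.scale V_add V_scale scale_right_distrib scale_left_commute)
  then have "?W = V" using irreducibleD[OF irreducible, of ?W w] w by blast
  then show ?thesis by blast
qed

text \<open>If a nonzero boundary homomorphism exists, then every homomorphism is a boundary one and
  a multiple of it. Otherwise a homomorphism is determined by its restriction to
  \<open>Sch0\<close>, where Schur's lemma applies.\<close>

lemma Sch_hom_unique:
  "\<exists>\<phi>0. \<forall>\<phi>. rep_hom fscale Sch mact s V \<rho> \<phi> \<longrightarrow> (\<exists>c. \<forall>F\<in>Sch. \<phi> F = s c (\<phi>0 F))"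
proof (cases "\<exists>\<phi>. nonzero_boundary_hom s V \<rho> \<phi>")
  case True
  then obtain \<phi>0 where "nonzero_boundary_hom s V \<rho> \<phi>0" by blast
  then interpret \<phi>0: nonzero_boundary_hom s V \<rho> \<phi>0 .
  have "\<exists>c. \<forall>F\<in>Sch. \<phi> F = s c (\<phi>0 F)" if \<phi>: "rep_hom fscale Sch mact s V \<rho> \<phi>" for \<phi>
  proof (rule \<phi>0.boundary_hom_unique)
    show "boundary_hom s V \<rho> \<phi>"
      by unfold_locales (use \<phi> irreducible \<phi>0.kills_Sch0[OF \<phi>] in simp_all)
  qed
  then show ?thesis by blast
next
  case no_boundary: False
  have zero: "\<phi> F = 0" if \<phi>: "rep_hom fscale Sch mact s V \<rho> \<phi>" and "\<forall>F\<in>Sch0. \<phi> F = 0" and F: "F \<in> Sch" for \<phi> F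
  proof (rule ccontr)
    assume "\<phi> F \<noteq> 0"
    then have "nonzero_boundary_hom s V \<rho> \<phi>"
      by unfold_locales (use that irreducible in auto)
    then show False using no_boundary by blast
  qed
  show ?thesis
  proof (cases "\<exists>\<phi>. rep_hom fscale Sch mact s V \<rho> \<phi> \<and> (\<exists>F\<in>Sch0. \<phi> F \<noteq> 0)")
    case False
    then have "\<phi> F = s 0 0" if "rep_hom fscale Sch mact s V \<rho> \<phi>" "F \<in> Sch" for \<phi> F
      using zero[OF that(1) _ that(2)] that(1) by auto
    then show ?thesis by (intro exI[of _ "\<lambda>_. 0"]) blast
  next
    case True
    then obtain \<phi> f0 where \<phi>: "rep_hom fscale Sch mact s V \<rho> \<phi>" and f0: "f0 \<in> Sch0" "\<phi> f0 \<noteq> 0" by blast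
    interpret \<phi>: Sch_hom s V \<rho> \<phi> by unfold_locales (rule \<phi>, rule irreducible)
    have onto: "\<phi> ` Sch0 = V" by (rule \<phi>.irreducible_image[OF irreducible invariant_Sch0 f0])
    \<comment> \<open>A mere choice of preimages, not linear; its composite with \<psi> is linear
      because the kernel of \<phi> on \<open>Sch0\<close> lies in that of \<psi>.\<close>
    define \<sigma> where "\<sigma> v = (SOME f. f \<in> Sch0 \<and> \<phi> f = v)" for v
    have \<sigma>: "\<sigma> v \<in> Sch0 \<and> \<phi> (\<sigma> v) = v" if "v \<in> V" for v
    proof -
      have "\<exists>f. f \<in> Sch0 \<and> \<phi> f = v" using onto that by blast
      then show ?thesis unfolding \<sigma>_def by (rule someI_ex)
    qed
    have S: "f \<in> Sch" if "f \<in> Sch0" for f using that by (simp add: Sch0_def)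
    have sub: "Sch.subspace Sch0" and inv: "\<And>g h f. invertible g \<Longrightarrow> invertible h \<Longrightarrow> f \<in> Sch0 \<Longrightarrow> mact g h f \<in> Sch0"
      using invariant_Sch0 by (auto simp: Sch.invariant_def)
    have "\<exists>c. \<forall>F\<in>Sch. \<psi> F = s c (\<phi> F)" if \<psi>: "rep_hom fscale Sch mact s V \<rho> \<psi>" for \<psi>
    proof -
      interpret \<psi>: Sch_hom s V \<rho> \<psi> by unfold_locales (rule \<psi>, rule irreducible)
      have eq: "\<psi> f = \<psi> g" if "f \<in> Sch0" "g \<in> Sch0" "\<phi> f = \<phi> g" for f g
      proof -
        have "\<psi> (f - g) = 0"
          using that by (intro \<phi>.kernel_Sch0[OF f0 \<psi>] Sch.subspace_diff[OF sub]) (simp_all add: \<phi>.diff S)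
        then show ?thesis using that by (simp add: \<psi>.diff S)
      qed
      have T: "\<psi> (\<sigma> (\<phi> f)) = \<psi> f" if "f \<in> Sch0" for f
        using that \<sigma>[of "\<phi> f"] by (intro eq) (simp_all add: \<phi>.closed S)
      have "rep_hom s V \<rho> s V \<rho> (\<lambda>v. \<psi> (\<sigma> v))"
        unfolding rep_hom_def
      proof (intro conjI ballI allI impI)
        fix v assume v: "v \<in> V"
        note f = \<sigma>[OF v]
        show "\<psi> (\<sigma> v) \<in> V" using f by (simp add: \<psi>.closed S)
        show "\<psi> (\<sigma> (s c v)) = s c (\<psi> (\<sigma> v))" for c
          using T[of "fscale c (\<sigma> v)"] f Sch.subspace_scale[OF sub, of "\<sigma> v" c]
          by (simp add: \<phi>.scale \<psi>.scale S)
        show "\<psi> (\<sigma> (\<rho> g h v)) = \<rho> g h (\<psi> (\<sigma> v))" if "invertible g" "invertible h" for g h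
          using T[of "mact g h (\<sigma> v)"] f inv[OF that, of "\<sigma> v"] that by (simp add: \<phi>.act \<psi>.act S)
        fix w assume w: "w \<in> V"
        note f' = \<sigma>[OF w]
        show "\<psi> (\<sigma> (v + w)) = \<psi> (\<sigma> v) + \<psi> (\<sigma> w)"
          using T[of "\<sigma> v + \<sigma> w"] f f' Sch.subspace_add[OF sub, of "\<sigma> v" "\<sigma> w"]
          by (simp add: \<phi>.add \<psi>.add S)
      qed
      then obtain c where c: "\<And>v. v \<in> V \<Longrightarrow> \<psi> (\<sigma> v) = s c v" using schur by blast
      have c': "\<psi> f = s c (\<phi> f)" if "f \<in> Sch0" for f
        using T[OF that] c[of "\<phi> f"] that by (simp add: \<phi>.closed S)
      \<comment> \<open>The difference kills \<open>Sch0\<close>, and in this case nonzero boundary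
        homomorphisms do not exist.\<close>
      have "\<psi> F - s c (\<phi> F) = 0" if "F \<in> Sch" for F
        by (rule zero[OF \<phi>.hom_diff[OF \<psi>] _ that]) (simp add: c')
      then show ?thesis by (intro exI[of _ c]) simp
    qed
    then show ?thesis by blast
  qed
qed

end

section \<open>The contragredient\<close>

text \<open>The functions in W are determined by their values on C, and imposing a zero at one more
  point lowers the dimension by at most one.\<close>

lemma finite_dimensional_functions:
  fixes W :: "('x \<Rightarrow> complex) set"
  assumes "finite C" "module.subspace fscale W" "\<And>w. w \<in> W \<Longrightarrow> (\<And>x. x \<in> C \<Longrightarrow> w x = 0) \<Longrightarrow> w = 0"
  shows "finite_dimensional fscale W"
  using assms
proof (induction C arbitrary: W rule: finite_induct)
  interpret vector_space fscale by (rule vector_space_fscale)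
  case empty
  then have "W \<subseteq> {0}" by blast
  then have "W \<subseteq> span {}" by simp
  then show ?case unfolding finite_dimensional_def by blast
next
  interpret vector_space fscale by (rule vector_space_fscale)
  case (insert b C)
  let ?W = "{w \<in> W. w b = 0}"
  have "subspace ?W"
    by (rule subspaceI) (simp_all add: subspace_0[OF insert.prems(1)] subspace_add[OF insert.prems(1)]
      subspace_scale[OF insert.prems(1)])
  then have "finite_dimensional fscale ?W"
  proof (rule insert.IH)
    show "w = 0" if "w \<in> ?W" "\<And>x. x \<in> C \<Longrightarrow> w x = 0" for w
      by (rule insert.prems(2)) (use that in auto)
  qed
  then obtain B where B: "finite B" "?W \<subseteq> span B" by (auto simp: finite_dimensional_def)
  show ?case
  proof (cases "\<exists>w1\<in>W. w1 b \<noteq> 0")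
    case True
    then obtain w1 where w1: "w1 \<in> W" "w1 b \<noteq> 0" by blast
    have "W \<subseteq> span (insert w1 B)"
    proof
      fix w assume w: "w \<in> W"
      let ?c = "w b / w1 b"
      have "w - fscale ?c w1 \<in> ?W"
        using w w1 by (simp add: subspace_diff[OF insert.prems(1)] subspace_scale[OF insert.prems(1)])
      then have "w - fscale ?c w1 \<in> span (insert w1 B)"
        using B(2) span_mono[of B "insert w1 B"] by blast
      moreover have "fscale ?c w1 \<in> span (insert w1 B)" by (simp add: span_scale span_base)
      ultimately have "(w - fscale ?c w1) + fscale ?c w1 \<in> span (insert w1 B)" by (rule span_add)
      then show "w \<in> span (insert w1 B)" by simp
    qed
    then show ?thesis using B(1) unfolding finite_dimensional_def by blast
  next
    case False
    then have "?W = W" by auto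
    then show ?thesis using B unfolding finite_dimensional_def by auto
  qed
qed

text \<open>Finite-dimensional duality: functionals that separate the points of U restrict onto the
  whole dual of U once U is finite-dimensional. It is applied to the K-fixed vectors of V and the
  K-fixed part of a subrepresentation of the dual.\<close>

locale separating_functionals = vector_space s
  for s :: "complex \<Rightarrow> 'v::ab_group_add \<Rightarrow> 'v" +
  fixes U :: "'v set" and W :: "('v \<Rightarrow> complex) set"
  assumes U: "subspace U" and W: "module.subspace fscale W"
    and W_add: "w \<in> W \<Longrightarrow> u \<in> U \<Longrightarrow> v \<in> U \<Longrightarrow> w (u + v) = w u + w v"
    and W_scale: "w \<in> W \<Longrightarrow> u \<in> U \<Longrightarrow> w (s c u) = c * w u"
    and separating: "u \<in> U \<Longrightarrow> u \<noteq> 0 \<Longrightarrow> \<exists>w\<in>W. w u \<noteq> 0"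
begin

interpretation F: vector_space fscale by (rule vector_space_fscale)

lemma ex_functional_vanishing:
  assumes "finite C" "independent C" "C \<subseteq> U" "c \<in> U" "c \<notin> span C"
  shows "\<exists>w\<in>W. (\<forall>b\<in>C. w b = 0) \<and> w c \<noteq> 0"
  using assms
proof (induction C arbitrary: c rule: finite_induct)
  case empty
  then show ?case using separating[of c] by auto
next
  case (insert b C)
  have C: "independent C" "C \<subseteq> U" and b: "b \<in> U" "b \<notin> span C"
    using insert.prems insert.hyps by (auto simp: independent_insert)
  obtain w0 where w0: "w0 \<in> W" "\<forall>a\<in>C. w0 a = 0" "w0 b \<noteq> 0"
    using insert.IH[OF C b] by blast
  define wb where "wb = fscale (1 / w0 b) w0"
  have wb: "wb \<in> W" "\<forall>a\<in>C. wb a = 0" "wb b = 1"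
    using w0 F.subspace_scale[OF W w0(1)] by (auto simp: wb_def)
  \<comment> \<open>The functional \<open>wb\<close> is 1 at b and 0 on C. Removing the b-component
    of c allows the induction hypothesis, and the resulting w is corrected by a multiple of
    \<open>wb\<close> to vanish at b.\<close>
  let ?c = "c - s (wb c) b"
  have c: "?c \<in> U" using insert.prems b U by (simp add: subspace_diff subspace_scale)
  have "?c \<notin> span C"
  proof
    assume "?c \<in> span C"
    then have "?c \<in> span (insert b C)" using span_mono[of C "insert b C"] by blast
    moreover have "s (wb c) b \<in> span (insert b C)" by (simp add: span_scale span_base)
    ultimately have "?c + s (wb c) b \<in> span (insert b C)" by (rule span_add)
    then show False using insert.prems by simp
  qed
  then obtain w where w: "w \<in> W" "\<forall>a\<in>C. w a = 0" "w ?c \<noteq> 0"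
    using insert.IH[OF C c] by blast
  have "w c = w ?c + wb c * w b"
    using W_add[OF w(1) c, of "s (wb c) b"] W_scale[OF w(1) b(1)] subspace_scale[OF U b(1)] by simp
  then have "(w - fscale (w b) wb) c \<noteq> 0" using w(3) by (simp add: mult.commute)
  moreover have "w - fscale (w b) wb \<in> W"
    using w wb by (intro F.subspace_diff[OF W] F.subspace_scale[OF W])
  ultimately show ?case using w wb by (intro bexI[of _ "w - fscale (w b) wb"]) auto
qed

lemma ex_functional_agreeing:
  assumes "finite C" "independent C" "C \<subseteq> U"
  shows "\<exists>w\<in>W. \<forall>b\<in>C. w b = l b"
  using assms
proof (induction C rule: finite_induct)
  case empty
  then show ?case using F.subspace_0[OF W] by blast
next
  case (insert b C)
  have C: "independent C" "C \<subseteq> U" and b: "b \<in> U" "b \<notin> span C"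
    using insert.prems insert.hyps by (auto simp: independent_insert)
  obtain w0 where w0: "w0 \<in> W" "\<forall>a\<in>C. w0 a = l a" using insert.IH[OF C] by blast
  obtain w1 where w1: "w1 \<in> W" "\<forall>a\<in>C. w1 a = 0" "w1 b \<noteq> 0"
    using ex_functional_vanishing[OF insert.hyps(1) C b] by blast
  let ?w = "w0 + fscale ((l b - w0 b) / w1 b) w1"
  have "?w \<in> W" using w0 w1 by (intro F.subspace_add[OF W] F.subspace_scale[OF W])
  then show ?case using w0 w1 by (intro bexI[of _ ?w]) auto
qed

lemma ex_functional_eq:
  assumes fin: "finite_dimensional s U"
    and l: "\<And>u v. u \<in> U \<Longrightarrow> v \<in> U \<Longrightarrow> l (u + v) = l u + l v" "\<And>c u. u \<in> U \<Longrightarrow> l (s c u) = c * l u"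
  shows "\<exists>w\<in>W. \<forall>u\<in>U. w u = l u"
proof -
  obtain C where C: "C \<subseteq> U" "independent C" "U \<subseteq> span C"
    by (rule basis_exists[of U]) (rule that; assumption)
  obtain B where "finite B" "U \<subseteq> span B" using fin by (auto simp: finite_dimensional_def)
  then have "finite C" using C independent_span_bound[of B C] by auto
  then obtain w where w: "w \<in> W" "\<forall>b\<in>C. w b = l b" using ex_functional_agreeing[of C l] C by blast
  have "l 0 = 0" "w 0 = 0"
    using l(2)[OF subspace_0[OF U], of 0] W_scale[OF w(1) subspace_0[OF U], of 0] by simp_all
  then have "subspace {u \<in> U. w u = l u}"
    using U w(1) by (auto intro!: subspaceI simp: subspace_0 subspace_add subspace_scale l W_add W_scale)
  then have "span C \<subseteq> {u \<in> U. w u = l u}" using C w by (intro span_minimal) auto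
  then show ?thesis using C w by (intro bexI[of _ w]) auto
qed

end

lemma congr_min_iff: "x \<in> congr (min \<delta> \<epsilon>) \<longleftrightarrow> x \<in> congr \<delta> \<and> x \<in> congr \<epsilon>"
  by (simp add: congr_def)

lemma congr_invertible: "0 < \<delta> \<Longrightarrow> \<delta> < 1 \<Longrightarrow> x \<in> congr \<delta> \<Longrightarrow> invertible x"
  by (rule matrix_groupD(2)[OF matrix_group_congr]) simp_all

text \<open>Conjugation distorts the norm by a bounded factor only. Hence translates of a smooth
  functional are smooth.\<close>

lemma ex_conj_congr:
  fixes g :: "'a::nonarch_local_field^2^2"
  assumes g: "invertible g" and "0 < \<delta>"
  shows "\<exists>\<epsilon>>0. \<epsilon> < 1 \<and> (\<forall>k\<in>congr \<epsilon>. matrix_inv g ** k ** g \<in> congr \<delta>)"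
proof -
  define K where "K = mnorm (matrix_inv g) * mnorm g"
  have K: "0 \<le> K" by (simp add: K_def)
  \<comment> \<open>The summand 1 makes the denominator visibly positive when only K \<ge> 0 is
    known.\<close>
  define \<epsilon> where "\<epsilon> = min (1/2) (\<delta> / (K + 1))"
  have "matrix_inv g ** k ** g \<in> congr \<delta>" if k: "k \<in> congr \<epsilon>" for k
  proof -
    have "matrix_inv g ** k ** g - mat 1 = matrix_inv g ** (k - mat 1) ** g"
      using g by (simp add: matrix_mult_distribs)
    also have "mnorm \<dots> \<le> mnorm (matrix_inv g) * \<epsilon> * mnorm g"
      using k by (intro mnorm_mult_mono) (simp_all add: congr_def)
    also have "\<dots> = K * \<epsilon>" by (simp add: K_def)
    also have "\<dots> \<le> K * (\<delta> / (K + 1))" using K by (intro mult_left_mono) (simp_all add: \<epsilon>_def)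
    also have "\<dots> \<le> \<delta>" using K \<open>0 < \<delta>\<close> by (simp add: field_simps)
    finally show ?thesis by (simp add: congr_def)
  qed
  moreover have "0 < \<epsilon>" "\<epsilon> < 1" using K \<open>0 < \<delta>\<close> by (auto simp: \<epsilon>_def)
  ultimately show ?thesis by blast
qed

context smooth_rep
begin

definition dact :: "'a^2^2 \<Rightarrow> 'a^2^2 \<Rightarrow> ('v \<Rightarrow> complex) \<Rightarrow> 'v \<Rightarrow> complex" where
  "dact g h l = (\<lambda>v. if v \<in> V then l (\<rho> (matrix_inv g) (matrix_inv h) v) else 0)"

definition dual :: "('v \<Rightarrow> complex) set" where
  "dual = {l. (\<forall>v. v \<notin> V \<longrightarrow> l v = 0) \<and> (\<forall>v\<in>V. \<forall>w\<in>V. l (v + w) = l v + l w) \<and> (\<forall>c. \<forall>v\<in>V. l (s c v) = c * l v)}"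

definition smooth_dual :: "('v \<Rightarrow> complex) set" where
  "smooth_dual = {l \<in> dual. \<exists>\<delta>>0. \<delta> < 1 \<and> (\<forall>g\<in>congr \<delta>. \<forall>h\<in>congr \<delta>. dact g h l = l)}"

lemma dualD:
  assumes "l \<in> dual"
  shows "v \<notin> V \<Longrightarrow> l v = 0" "v \<in> V \<Longrightarrow> w \<in> V \<Longrightarrow> l (v + w) = l v + l w" "v \<in> V \<Longrightarrow> l (s c v) = c * l v"
  using assms by (simp_all add: dual_def)

lemma smooth_dual_dual: "l \<in> smooth_dual \<Longrightarrow> l \<in> dual"
  by (simp add: smooth_dual_def)

lemma dact_dual:
  assumes "invertible g" "invertible h" "l \<in> dual"
  shows "dact g h l \<in> dual"
  using dualD[OF assms(3)] assms(1,2)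
  by (auto simp: dual_def dact_def V_add V_scale act_add act_scale act_closed)

lemma dact_mult:
  assumes "invertible g" "invertible h" "invertible g'" "invertible h'"
  shows "dact (g ** g') (h ** h') l = dact g h (dact g' h' l)"
  using assms by (auto simp: fun_eq_iff dact_def matrix_inv_mult act_mult act_closed)

lemma smooth_dual_add:
  assumes "l \<in> smooth_dual" "l' \<in> smooth_dual"
  shows "l + l' \<in> smooth_dual"
proof -
  obtain \<delta> \<delta>' where d: "0 < \<delta>" "\<delta> < 1" "\<forall>g\<in>congr \<delta>. \<forall>h\<in>congr \<delta>. dact g h l = l"
    "0 < \<delta>'" "\<delta>' < 1" "\<forall>g\<in>congr \<delta>'. \<forall>h\<in>congr \<delta>'. dact g h l' = l'"
    using assms unfolding smooth_dual_def by blast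
  have "dact g h (l + l') = l + l'" if "g \<in> congr (min \<delta> \<delta>')" "h \<in> congr (min \<delta> \<delta>')" for g h
  proof -
    have "dact g h l = l" "dact g h l' = l'"
      using that d(3,6) by (simp_all add: congr_min_iff)
    moreover have "dact g h (l + l') = dact g h l + dact g h l'" by (auto simp: dact_def fun_eq_iff)
    ultimately show ?thesis by simp
  qed
  moreover have "l + l' \<in> dual"
    using assms by (auto simp: dual_def smooth_dual_def algebra_simps)
  ultimately show ?thesis
    unfolding smooth_dual_def using d by (intro CollectI conjI exI[of _ "min \<delta> \<delta>'"]) auto
qed

lemma smooth_dual_scale:
  assumes "l \<in> smooth_dual"
  shows "fscale c l \<in> smooth_dual"
proof -
  have "dact g h (fscale c l) = fscale c (dact g h l)" for g h by (auto simp: dact_def fun_eq_iff)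
  moreover have "fscale c l \<in> dual"
    using assms by (auto simp: dual_def smooth_dual_def algebra_simps)
  ultimately show ?thesis
    using assms unfolding smooth_dual_def mem_Collect_eq by metis
qed

lemma dact_smooth_dual:
  assumes g: "invertible g" and h: "invertible h" and l: "l \<in> smooth_dual"
  shows "dact g h l \<in> smooth_dual"
proof -
  obtain \<delta> where d: "0 < \<delta>" "\<delta> < 1" "\<And>g h. g \<in> congr \<delta> \<Longrightarrow> h \<in> congr \<delta> \<Longrightarrow> dact g h l = l"
    using l unfolding smooth_dual_def by blast
  obtain \<epsilon> \<epsilon>' where e: "0 < \<epsilon>" "\<epsilon> < 1" "\<And>k. k \<in> congr \<epsilon> \<Longrightarrow> matrix_inv g ** k ** g \<in> congr \<delta>"
    "0 < \<epsilon>'" "\<epsilon>' < 1" "\<And>k. k \<in> congr \<epsilon>' \<Longrightarrow> matrix_inv h ** k ** h \<in> congr \<delta>"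
    using ex_conj_congr[OF g d(1)] ex_conj_congr[OF h d(1)] by blast
  let ?e = "min \<epsilon> \<epsilon>'"
  have "dact k k' (dact g h l) = dact g h l" if k: "k \<in> congr ?e" "k' \<in> congr ?e" for k k'
  proof -
    have inv: "invertible k" "invertible k'"
      using k e by (auto simp: congr_min_iff intro: congr_invertible)
    let ?k = "matrix_inv g ** k ** g" and ?k' = "matrix_inv h ** k' ** h"
    have inv': "invertible ?k" "invertible ?k'" using inv g h by (simp_all add: invertible_mult)
    have "dact k k' (dact g h l) = dact (k ** g) (k' ** h) l" using inv g h by (simp add: dact_mult)
    also have "\<dots> = dact (g ** ?k) (h ** ?k') l" using g h by (simp add: matrix_mul_assoc)
    also have "\<dots> = dact g h (dact ?k ?k' l)" using inv' g h by (simp add: dact_mult)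
    also have "dact ?k ?k' l = l"
      using k by (intro d e) (simp_all add: congr_min_iff)
    finally show ?thesis .
  qed
  then show ?thesis
    unfolding smooth_dual_def using dact_dual[OF g h smooth_dual_dual[OF l]] e
    by (intro CollectI conjI exI[of _ ?e]) auto
qed

lemma smooth_rep_dual: "smooth_rep fscale smooth_dual dact"
proof (rule smooth_rep.intro)
  interpret F: vector_space fscale by (rule vector_space_fscale)
  have "0 \<in> smooth_dual"
    unfolding smooth_dual_def by (intro CollectI conjI exI[of _ "1/2"]) (auto simp: dual_def dact_def fun_eq_iff)
  then show "F.subspace smooth_dual"
    by (intro F.subspaceI smooth_dual_add smooth_dual_scale)
  show "dact (mat 1) (mat 1) l = l" if "l \<in> smooth_dual" for l
    using that dualD(1)[OF smooth_dual_dual[OF that]] by (auto simp: dact_def fun_eq_iff act_1)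
  show "\<exists>\<delta>>0. \<delta> < 1 \<and> (\<forall>g\<in>congr \<delta>. \<forall>h\<in>congr \<delta>. dact g h l = l)" if "l \<in> smooth_dual" for l
    using that by (simp add: smooth_dual_def)
qed (simp_all add: vector_space_fscale dact_smooth_dual dact_mult, simp_all add: dact_def fun_eq_iff)

text \<open>A K-fixed functional takes one value on each orbit. It is therefore determined by its
  restriction to the K-fixed vectors.\<close>

lemma dual_avg:
  assumes K: "matrix_group K" "compact K" and l: "l \<in> dual" and fx: "\<And>g h. g \<in> K \<Longrightarrow> h \<in> K \<Longrightarrow> dact g h l = l"
    and v: "v \<in> V"
  shows "l (avg K K v) = l v"
proof -
  interpret averaging s V \<rho> K K by unfold_locales (rule K)+
  note k = matrix_groupD[OF K(1)]
  show ?thesis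
  proof (rule avg_hom[where t = "(*)"])
    show "vector_space ((*) :: complex \<Rightarrow> complex \<Rightarrow> complex)" by unfold_locales (simp_all add: algebra_simps)
    show "l (\<rho> g h v) = l v" if g: "g \<in> K" and h: "h \<in> K" for g h
    proof -
      have "dact (matrix_inv g) (matrix_inv h) l v = l v" using fx k(3) g h by simp
      then show ?thesis using k(2) g h v by (simp add: dact_def)
    qed
  qed (use v dualD[OF l] in simp_all)
qed

end

text \<open>The common kernel of a nonzero invariant W is a proper invariant subspace of V, hence 0.
  So the K-fixed part of W separates the K-fixed vectors and represents every functional on them; by
  \<open>dual_avg\<close> a K-fixed l then equals an element of W.\<close>

lemma (in irreducible_admissible) irreducible_admissible_dual:
  assumes nz: "smooth_dual \<noteq> {0}"
  shows "irreducible_admissible fscale smooth_dual dact"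
proof -
  interpret D: smooth_rep fscale smooth_dual dact by (rule smooth_rep_dual)
  have "D.irreducible"
    unfolding D.irreducible_def
  proof (intro conjI allI impI nz)
    fix W assume W: "D.invariant W"
    have Wsub: "D.subspace W" "W \<subseteq> smooth_dual"
      and Wact: "\<And>g h w. invertible g \<Longrightarrow> invertible h \<Longrightarrow> w \<in> W \<Longrightarrow> dact g h w \<in> W"
      using W by (auto simp: D.invariant_def)
    have Wdual: "w \<in> dual" if "w \<in> W" for w using that Wsub smooth_dual_dual by blast
    show "W = {0} \<or> W = smooth_dual"
    proof (cases "W = {0}")
      case False
      then obtain l0 where l0: "l0 \<in> W" "l0 \<noteq> 0" using D.subspace_0[OF Wsub(1)] by blast
      let ?N = "{v \<in> V. \<forall>w\<in>W. w v = 0}"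
      have "invariant ?N"
        unfolding invariant_def
      proof (intro conjI allI impI ballI subspaceI)
        show "0 \<in> ?N" using dualD(3)[OF Wdual, of _ 0 0] by auto
        show "\<rho> g h v \<in> ?N" if gh: "invertible g" "invertible h" and v: "v \<in> ?N" for g h v
        proof -
          have "w (\<rho> g h v) = 0" if "w \<in> W" for w
          proof -
            have "dact (matrix_inv g) (matrix_inv h) w v = 0" using Wact[of "matrix_inv g" "matrix_inv h" w] gh that v by auto
            then show ?thesis using gh v by (simp add: dact_def)
          qed
          then show ?thesis using gh v by (simp add: act_closed)
        qed
      qed (auto simp: V_add V_scale dualD(2,3)[OF Wdual])
      moreover have "?N \<noteq> V"
      proof
        assume "?N = V"
        then have "l0 v = 0" for v using l0(1) dualD(1)[OF Wdual[OF l0(1)], of v] by blast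
        then show False using l0(2) by auto
      qed
      ultimately have N: "?N = {0}" using irreducible unfolding irreducible_def by blast
      have "l \<in> W" if l: "l \<in> smooth_dual" for l
      proof -
        obtain \<delta> where d: "0 < \<delta>" "\<delta> < 1" "\<And>g h. g \<in> congr \<delta> \<Longrightarrow> h \<in> congr \<delta> \<Longrightarrow> dact g h l = l"
          using l unfolding smooth_dual_def by blast
        let ?K = "congr \<delta> :: ('a^2^2) set"
        have K: "matrix_group ?K" "compact ?K" using d by (auto intro: matrix_group_congr compact_congr)
        note k = matrix_groupD[OF K(1)]
        let ?U = "fixed ?K ?K"
        interpret W: smooth_rep fscale W dact by (rule D.smooth_rep_invariant[OF W])
        interpret W: averaging fscale W dact ?K ?K by unfold_locales (rule K)+
        interpret S: separating_functionals s ?U "W.fixed ?K ?K"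
        proof unfold_locales
          show "subspace ?U" by (rule subspace_fixed[OF K(1) K(1)])
          show "module.subspace fscale (W.fixed ?K ?K)" by (rule W.subspace_fixed[OF K(1) K(1)])
          show "w (u + v) = w u + w v" if "w \<in> W.fixed ?K ?K" "u \<in> ?U" "v \<in> ?U" for w u v
            using that dualD(2)[OF Wdual, of w u v] by (simp add: W.fixed_def fixed_def)
          show "w (s c u) = c * w u" if "w \<in> W.fixed ?K ?K" "u \<in> ?U" for w u c
            using that dualD(3)[OF Wdual, of w u c] by (simp add: W.fixed_def fixed_def)
          fix u assume u: "u \<in> ?U" "u \<noteq> 0"
          then have "u \<notin> ?N" "u \<in> V" using N by (auto simp: fixed_def)
          then obtain w where w: "w \<in> W" "w u \<noteq> 0" by blast
          \<comment> \<open>Averaging w makes it K-fixed without changing its value at u, because u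
            is K-fixed.\<close>
          have "(W.avg ?K ?K w) u = w u"
          proof (rule W.avg_hom[where t = "(*)" and L = "\<lambda>w. w u"])
            show "vector_space ((*) :: complex \<Rightarrow> complex \<Rightarrow> complex)" by unfold_locales (simp_all add: algebra_simps)
            show "dact g h w u = w u" if "g \<in> ?K" "h \<in> ?K" for g h
              using u that k(3) by (simp add: dact_def fixed_def)
          qed (use w in simp_all)
          then show "\<exists>w\<in>W.fixed ?K ?K. w u \<noteq> 0" using W.avg_fixed[OF w(1)] w(2) by metis
        qed
        have "\<exists>w\<in>W.fixed ?K ?K. \<forall>u\<in>?U. w u = l u"
          by (rule S.ex_functional_eq[OF fin[OF d(1,2)]])
            (use dualD(2,3)[OF smooth_dual_dual[OF l]] in \<open>auto simp: fixed_def\<close>)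
        then obtain w where w: "w \<in> W.fixed ?K ?K" "\<forall>u\<in>?U. w u = l u" by blast
        then have wW: "w \<in> W" "\<And>g h. g \<in> ?K \<Longrightarrow> h \<in> ?K \<Longrightarrow> dact g h w = w" by (auto simp: W.fixed_def)
        interpret A: averaging s V \<rho> ?K ?K by unfold_locales (rule K)+
        have "w v = l v" for v
        proof (cases "v \<in> V")
          case True
          have "w v = w (avg ?K ?K v)" by (rule dual_avg[OF K Wdual[OF wW(1)] wW(2) True, symmetric])
          also have "\<dots> = l (avg ?K ?K v)" using w(2) A.avg_fixed[OF True] by blast
          also have "\<dots> = l v" by (rule dual_avg[OF K smooth_dual_dual[OF l] d(3) True])
          finally show ?thesis .
        next
          case False
          then show ?thesis using dualD(1)[OF Wdual[OF wW(1)]] dualD(1)[OF smooth_dual_dual[OF l]] by simp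
        qed
        then have "w = l" by auto
        then show ?thesis using wW(1) by simp
      qed
      then show ?thesis using Wsub(2) by blast
    qed simp
  qed
  moreover have "finite_dimensional fscale (D.fixed (congr \<delta>) (congr \<delta>))" if d: "0 < \<delta>" "\<delta> < 1" for \<delta>
  proof -
    let ?K = "congr \<delta> :: ('a^2^2) set"
    have K: "matrix_group ?K" "compact ?K" using d by (auto intro: matrix_group_congr compact_congr)
    let ?U = "fixed ?K ?K"
    obtain C where C: "C \<subseteq> ?U" "independent C" "?U \<subseteq> span C"
      by (rule basis_exists[of ?U]) (rule that; assumption)
    obtain B where "finite B" "?U \<subseteq> span B" using fin[OF d] by (auto simp: finite_dimensional_def)
    then have "finite C" using C independent_span_bound[of B C] by auto
    then show ?thesis
    proof (rule finite_dimensional_functions)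
      show "D.subspace (D.fixed ?K ?K)" by (rule D.subspace_fixed[OF K(1) K(1)])
      fix l assume l: "l \<in> D.fixed ?K ?K" and C0: "\<And>x. x \<in> C \<Longrightarrow> l x = 0"
      then have ld: "l \<in> dual" "\<And>g h. g \<in> ?K \<Longrightarrow> h \<in> ?K \<Longrightarrow> dact g h l = l"
        by (auto simp: D.fixed_def smooth_dual_dual)
      have "subspace {u \<in> V. l u = 0}"
        using dualD(2,3)[OF ld(1)] dualD(3)[OF ld(1), of 0 0] by (auto intro!: subspaceI simp: V_add V_scale)
      then have "span C \<subseteq> {u \<in> V. l u = 0}"
        using C(1) C0 by (intro span_minimal) (auto simp: fixed_def)
      then have U0: "l u = 0" if "u \<in> ?U" for u using that C(3) by blast
      interpret A: averaging s V \<rho> ?K ?K by unfold_locales (rule K)+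
      have "l v = 0" for v
      proof (cases "v \<in> V")
        case True
        then show ?thesis using dual_avg[OF K ld True] U0[OF A.avg_fixed[OF True]] by simp
      qed (rule dualD(1)[OF ld(1)])
      then show "l = 0" by auto
    qed
  qed
  ultimately show ?thesis by unfold_locales
qed

section \<open>From matrices to the projective groups\<close>

lemma proj_class_iff: "y \<in> proj_class x \<longleftrightarrow> (\<exists>c. c \<noteq> 0 \<and> y = mat c ** x)"
  by (auto simp: proj_class_def)

lemma proj_class_self [simp]: "x \<in> proj_class x"
  unfolding proj_class_iff by (rule exI[of _ 1]) simp

lemma proj_class_scale [simp]:
  assumes "c \<noteq> 0"
  shows "proj_class (mat c ** x) = proj_class x"
proof -
  have "mat d ** (mat c ** x) \<in> proj_class x" if "d \<noteq> 0" for d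
    unfolding proj_class_iff using that assms by (intro exI[of _ "d * c"]) (simp add: mat_mult_assoc)
  moreover have "mat d ** x \<in> proj_class (mat c ** x)" if "d \<noteq> 0" for d
    unfolding proj_class_iff using that assms by (intro exI[of _ "d / c"]) (simp add: mat_mult_assoc)
  ultimately show ?thesis by (auto simp: proj_class_def[of x] proj_class_def[of "mat c ** x"])
qed

lemma proj_class_eq_iff: "proj_class x = proj_class y \<longleftrightarrow> (\<exists>c. c \<noteq> 0 \<and> x = mat c ** y)"
  using proj_class_self[of x] by (auto simp: proj_class_iff)

lemma carrier_GL2: "carrier GL2 = {g. invertible g}"
  by (simp add: GL2_def)

lemma mult_GL2: "g \<otimes>\<^bsub>GL2\<^esub> h = g ** h"
  by (simp add: GL2_def)

lemma carrier_PGL2: "carrier PGL2 = proj_class ` {g. invertible g}"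
  by (simp add: PGL2_def carrier_FactGroup r_coset_scalars carrier_GL2)

lemma mult_PGL2:
  assumes "invertible g" "invertible h"
  shows "proj_class g \<otimes>\<^bsub>PGL2\<^esub> proj_class h = proj_class (g ** h)"
  using normal.rcos_sum[OF normal_scalars, of g h] assms
  by (simp add: PGL2_def FactGroup_def r_coset_scalars carrier_GL2 mult_GL2)

lemma one_PGL2: "\<one>\<^bsub>PGL2\<^esub> = proj_class (mat 1)"
  by (auto simp: PGL2_def FactGroup_def scalars_def proj_class_def)

lemma carrier_H: "carrier H_group = {(proj_class g, proj_class h) | g h. invertible g \<and> invertible h}"
  by (auto simp: H_group_def DirProd_def carrier_PGL2)

lemma proj_class_in_H [simp]: "invertible g \<Longrightarrow> invertible h \<Longrightarrow> (proj_class g, proj_class h) \<in> carrier H_group"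
  by (auto simp: carrier_H)

lemma mult_H:
  "invertible g \<Longrightarrow> invertible h \<Longrightarrow> invertible g' \<Longrightarrow> invertible h' \<Longrightarrow>
   (proj_class g, proj_class h) \<otimes>\<^bsub>H_group\<^esub> (proj_class g', proj_class h') = (proj_class (g ** g'), proj_class (h ** h'))"
  by (simp add: H_group_def DirProd_def mult_PGL2)

lemma one_H: "\<one>\<^bsub>H_group\<^esub> = (proj_class (mat 1), proj_class (mat 1))"
  by (simp add: H_group_def DirProd_def one_PGL2)

lemma inv_H:
  assumes "invertible g" "invertible h"
  shows "inv\<^bsub>H_group\<^esub> (proj_class g, proj_class h) = (proj_class (matrix_inv g), proj_class (matrix_inv h))"
  using assms by (intro group.inv_equality[OF group_H]) (simp_all add: mult_H one_H)

lemma openin_PGL2_top: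
  "openin PGL2_top U \<longleftrightarrow> U \<subseteq> proj_class ` {g. invertible g} \<and>
     openin (top_of_set {g. invertible g}) {g. invertible g \<and> proj_class g \<in> U}"
  by (simp add: PGL2_top_def openin_quotient_topology r_coset_scalars carrier_GL2)

lemma PGL2_open_near_1:
  assumes "openin PGL2_top U" "proj_class (mat 1) \<in> U"
  shows "\<exists>\<delta>>0. \<delta> < 1 \<and> (\<forall>g\<in>congr \<delta>. proj_class g \<in> U)"
proof -
  have "openin (top_of_set {g. invertible g}) {g. invertible g \<and> proj_class g \<in> U}"
    using assms(1) by (simp add: openin_PGL2_top)
  then obtain T where T: "open T" "{g. invertible g \<and> proj_class g \<in> U} = {g. invertible g} \<inter> T"
    unfolding openin_open by (elim exE conjE) (rule that)
  have "mat 1 \<in> {g. invertible g \<and> proj_class g \<in> U}" using assms(2) by simp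
  then have "mat 1 \<in> T" unfolding T(2) by simp
  then obtain e where e: "e > 0" "\<And>y. mnorm (y - mat 1) < e \<Longrightarrow> y \<in> T"
    using T(1) unfolding open_mnorm by metis
  define \<delta> where "\<delta> = min (1/2) (e/2)"
  have \<delta>: "0 < \<delta>" "\<delta> < 1" "\<delta> < e" using e(1) by (auto simp: \<delta>_def min_def)
  have "proj_class g \<in> U" if g: "g \<in> congr \<delta>" for g
  proof -
    have "invertible g" using matrix_groupD(2)[OF matrix_group_congr g] \<delta> by simp
    moreover have "g \<in> T" using g \<delta>(3) by (intro e(2)) (simp add: congr_def)
    ultimately have "g \<in> {g. invertible g} \<inter> T" by simp
    then show ?thesis unfolding T(2)[symmetric] by simp
  qed
  then show ?thesis using \<delta> by blast
qed

text \<open>The preimage of the coset under the class map is g times \<open>scalar_mults M\<close>,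
  which is open.\<close>

lemma openin_PGL2_coset:
  fixes M :: "('a::nonarch_local_field^2^2) set"
  assumes g: "invertible g" and M: "matrix_group M" "open M"
  shows "openin PGL2_top ((\<lambda>k. proj_class (g ** k)) ` M)"
  unfolding openin_PGL2_top
proof
  show "(\<lambda>k. proj_class (g ** k)) ` M \<subseteq> proj_class ` {g. invertible g}"
    using g matrix_groupD(2)[OF M(1)] by (auto intro!: imageI invertible_mult)
  have "proj_class x \<in> (\<lambda>k. proj_class (g ** k)) ` M \<longleftrightarrow> matrix_inv g ** x \<in> scalar_mults M" for x
  proof
    assume "proj_class x \<in> (\<lambda>k. proj_class (g ** k)) ` M"
    then obtain k c where k: "k \<in> M" "c \<noteq> 0" "x = mat c ** (g ** k)" by (auto simp: proj_class_eq_iff)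
    then have "matrix_inv g ** x = mat c ** k" using g by (simp add: mat_mult_pull2)
    then show "matrix_inv g ** x \<in> scalar_mults M" using k by (auto simp: scalar_mults_def)
  next
    assume "matrix_inv g ** x \<in> scalar_mults M"
    then obtain k c where k: "k \<in> M" "c \<noteq> 0" "matrix_inv g ** x = mat c ** k" by (auto simp: scalar_mults_def)
    have "x = g ** (matrix_inv g ** x)" using g by simp
    also have "\<dots> = mat c ** (g ** k)" unfolding k(3) by (simp add: mat_mult_pull2)
    finally have "proj_class x = proj_class (g ** k)" using k(2) by simp
    then show "proj_class x \<in> (\<lambda>k. proj_class (g ** k)) ` M" using k(1) by blast
  qed
  then have "{x. invertible x \<and> proj_class x \<in> (\<lambda>k. proj_class (g ** k)) ` M} =
      {x. invertible x} \<inter> {x. matrix_inv g ** x \<in> scalar_mults M}" by auto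
  moreover have "open {x. matrix_inv g ** x \<in> scalar_mults M}"
    using g M by (intro open_coset open_scalar_mults) simp_all
  ultimately show "openin (top_of_set {g. invertible g}) {x. invertible x \<and> proj_class x \<in> (\<lambda>k. proj_class (g ** k)) ` M}"
    by (simp add: openin_open_Int)
qed

lemma H_open_near_1:
  assumes "openin H_top S" "(proj_class (mat 1), proj_class (mat 1)) \<in> S"
  shows "\<exists>\<delta>>0. \<delta> < 1 \<and> (\<forall>g\<in>congr \<delta>. \<forall>h\<in>congr \<delta>. (proj_class g, proj_class h) \<in> S)"
proof -
  obtain U U' where U: "openin PGL2_top U" "openin PGL2_top U'"
    "proj_class (mat 1) \<in> U" "proj_class (mat 1) \<in> U'" "U \<times> U' \<subseteq> S"
    using assms(1)[unfolded H_top_def openin_prod_topology_alt, rule_format, OF assms(2)]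
    by (elim exE conjE) (rule that)
  obtain \<delta> \<delta>' where d: "0 < \<delta>" "\<delta> < 1" "\<forall>g\<in>congr \<delta>. proj_class g \<in> U"
    "0 < \<delta>'" "\<delta>' < 1" "\<forall>g\<in>congr \<delta>'. proj_class g \<in> U'"
    using PGL2_open_near_1[OF U(1,3)] PGL2_open_near_1[OF U(2,4)] by blast
  have "(proj_class g, proj_class h) \<in> S" if "g \<in> congr (min \<delta> \<delta>')" "h \<in> congr (min \<delta> \<delta>')" for g h
    using that U(5) d(3,6) by (auto simp: congr_min_iff)
  then show ?thesis using d by (intro exI[of _ "min \<delta> \<delta>'"]) auto
qed

text \<open>A set closed under products that contains a neighbourhood of the identity contains a
  translate of it around each of its points. This serves both for stabilizers and for the compact
  subgroups K \<times> K.\<close>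

lemma openin_H_top_if:
  fixes S :: "(('a::nonarch_local_field^2^2) set \<times> ('a^2^2) set) set"
  assumes S: "S \<subseteq> carrier H_group" and mult: "\<And>x y. x \<in> S \<Longrightarrow> y \<in> S \<Longrightarrow> x \<otimes>\<^bsub>H_group\<^esub> y \<in> S"
    and \<delta>: "0 < \<delta>" "\<delta> < 1" and near: "\<And>g h. g \<in> congr \<delta> \<Longrightarrow> h \<in> congr \<delta> \<Longrightarrow> (proj_class g, proj_class h) \<in> S"
  shows "openin H_top S"
  unfolding H_top_def openin_prod_topology_alt
proof (intro allI impI)
  fix a b :: "('a^2^2) set" assume ab: "(a, b) \<in> S"
  then obtain g h where gh: "invertible g" "invertible h" "a = proj_class g" "b = proj_class h"
    using S by (auto simp: carrier_H)
  let ?M = "congr \<delta> :: ('a^2^2) set"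
  have M: "matrix_group ?M" "open ?M" using \<delta> by (auto intro: matrix_group_congr open_congr)
  let ?U = "\<lambda>g. (\<lambda>k. proj_class (g ** k)) ` ?M"
  have mem: "proj_class x \<in> ?U x" for x :: "'a^2^2"
    by (rule image_eqI[of _ _ "mat 1"]) (simp_all add: matrix_groupD(1)[OF M(1)])
  have "?U g \<times> ?U h \<subseteq> S"
  proof
    fix z assume "z \<in> ?U g \<times> ?U h"
    then obtain k l where z: "k \<in> ?M" "l \<in> ?M" "z = (proj_class (g ** k), proj_class (h ** l))" by auto
    have "(proj_class g, proj_class h) \<otimes>\<^bsub>H_group\<^esub> (proj_class k, proj_class l) \<in> S"
      using ab gh z near by (intro mult) auto
    then show "z \<in> S" using z gh matrix_groupD(2)[OF M(1)] by (simp add: mult_H)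
  qed
  then show "\<exists>U U'. openin PGL2_top U \<and> openin PGL2_top U' \<and> a \<in> U \<and> b \<in> U' \<and> U \<times> U' \<subseteq> S"
    using openin_PGL2_coset[OF gh(1) M] openin_PGL2_coset[OF gh(2) M] mem gh(3,4)
    by (intro exI[of _ "?U g"] exI[of _ "?U h"] conjI) simp_all
qed

lemma congr_subgroup_H:
  assumes \<delta>: "0 < \<delta>" "\<delta> < 1"
  defines "K \<equiv> proj_class ` (congr \<delta> :: ('a::nonarch_local_field^2^2) set)"
  shows "subgroup (K \<times> K) H_group" "openin H_top (K \<times> K)" "compactin H_top (K \<times> K)"
proof -
  let ?M = "congr \<delta> :: ('a^2^2) set"
  have M: "matrix_group ?M" "compact ?M" using \<delta> by (auto intro: matrix_group_congr compact_congr)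
  note m = matrix_groupD[OF M(1)]
  have sub: "K \<times> K \<subseteq> carrier H_group" using m(2) by (auto simp: K_def carrier_H)
  have mult: "x \<otimes>\<^bsub>H_group\<^esub> y \<in> K \<times> K" if "x \<in> K \<times> K" "y \<in> K \<times> K" for x y
    using that m(2,4) by (auto simp: K_def mult_H)
  show "subgroup (K \<times> K) H_group"
  proof (rule group.subgroupI[OF group_H sub])
    show "K \<times> K \<noteq> {}" using m(1) by (auto simp: K_def)
    show "inv\<^bsub>H_group\<^esub> x \<in> K \<times> K" if "x \<in> K \<times> K" for x
      using that m(2,3) by (auto simp: K_def inv_H)
  qed (rule mult)
  show "openin H_top (K \<times> K)"
    by (rule openin_H_top_if[OF sub mult \<delta>]) (auto simp: K_def)
  have "compactin (top_of_set {g :: 'a^2^2. invertible g}) ?M"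
    using M(2) m(2) by (auto simp: compactin_subtopology)
  moreover have "continuous_map (top_of_set {g :: 'a^2^2. invertible g}) PGL2_top proj_class"
    using quotient_imp_continuous_map[OF quotient_map_quotient_topology[of "top_of_set (carrier GL2)" "\<lambda>g :: 'a^2^2. scalars #>\<^bsub>GL2\<^esub> g"]]
    by (simp add: PGL2_top_def r_coset_scalars carrier_GL2)
  ultimately have "compactin PGL2_top K"
    unfolding K_def by (rule image_compactin)
  then show "compactin H_top (K \<times> K)"
    unfolding H_top_def by (simp add: compactin_Times)
qed

section \<open>Schwartz functions on the projective space of matrices\<close>

lemma topspace_Pgl2: "topspace Pgl2 = proj_class ` (- {0})"
  by (simp add: Pgl2_def topspace_quotient_topology)

lemma openin_Pgl2:
  "openin Pgl2 U \<longleftrightarrow> U \<subseteq> proj_class ` (- {0}) \<and> open {x. x \<noteq> 0 \<and> proj_class x \<in> U}"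
proof -
  have "{x \<in> - {0}. proj_class x \<in> U} = {x. x \<noteq> 0 \<and> proj_class x \<in> U}" by auto
  moreover have "openin (top_of_set (- {0})) V \<longleftrightarrow> open V \<and> V \<subseteq> - {0}" for V :: "('a^2^2) set"
    by (rule openin_open_eq) auto
  ultimately show ?thesis by (auto simp: Pgl2_def openin_quotient_topology)
qed

lemma compact_space_Pgl2: "compact_space (Pgl2 :: ('a::nonarch_local_field^2^2) set topology)"
proof -
  have "compactin (top_of_set (- {0})) {x :: 'a^2^2. mnorm x = 1}"
    using compact_sphere by (auto simp: compactin_subtopology mnorm_zero)
  moreover have "continuous_map (top_of_set (- {0})) Pgl2 (proj_class :: 'a^2^2 \<Rightarrow> _)"
    unfolding Pgl2_def by (rule quotient_imp_continuous_map[OF quotient_map_quotient_topology])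
  ultimately have "compactin Pgl2 (proj_class ` {x :: 'a^2^2. mnorm x = 1})"
    by (rule image_compactin)
  moreover have "proj_class ` {x :: 'a^2^2. mnorm x = 1} = topspace Pgl2"
  proof -
    have "proj_class x \<in> proj_class ` {x :: 'a^2^2. mnorm x = 1}" if "x \<noteq> 0" for x :: "'a^2^2"
    proof -
      obtain c where "c \<noteq> 0" "mnorm (mat c ** x) = 1" using ex_normalized[OF \<open>x \<noteq> 0\<close>] by blast
      then show ?thesis by (intro image_eqI[of _ _ "mat c ** x"]) simp_all
    qed
    then show ?thesis by (auto simp: topspace_Pgl2 mnorm_zero)
  qed
  ultimately show ?thesis by (simp add: compact_space_def)
qed

text \<open>The inverse of composition with \<open>proj_class\<close>. For F in \<open>Sch\<close>
  homogeneity makes the choice of representative immaterial.\<close>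

definition lift_fun :: "('a::nonarch_local_field^2^2 \<Rightarrow> complex) \<Rightarrow> ('a^2^2) set \<Rightarrow> complex" where
  "lift_fun F y = (if y \<in> topspace Pgl2 then F (SOME x. x \<noteq> 0 \<and> y = proj_class x) else 0)"

lemma lift_fun_class:
  assumes F: "F \<in> Sch" and x: "x \<noteq> 0"
  shows "lift_fun F (proj_class x) = F x"
proof -
  define z where "z = (SOME z. z \<noteq> 0 \<and> proj_class x = proj_class z)"
  have "z \<noteq> 0 \<and> proj_class x = proj_class z"
    unfolding z_def by (rule someI[of _ x]) (simp add: x)
  then obtain c where "c \<noteq> 0" "x = mat c ** z" by (auto simp: proj_class_eq_iff)
  then have "F x = F z" using Sch_scale[OF F] by simp
  then show ?thesis using x by (simp add: lift_fun_def topspace_Pgl2 z_def)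
qed

lemma proj_class_in_Pgl2 [simp]: "proj_class x \<in> topspace Pgl2 \<longleftrightarrow> x \<noteq> 0"
  by (auto simp: topspace_Pgl2 proj_class_eq_iff)

lemma lift_fun_schwartz:
  assumes F: "F \<in> Sch"
  shows "lift_fun F \<in> schwartz Pgl2"
  unfolding schwartz_def mem_Collect_eq
proof (intro conjI allI impI ballI)
  show "lift_fun F y = 0" if "y \<notin> topspace Pgl2" for y using that by (simp add: lift_fun_def)
  show "compactin Pgl2 (Pgl2 closure_of {y \<in> topspace Pgl2. lift_fun F y \<noteq> 0})"
    by (rule closedin_compact_space[OF compact_space_Pgl2 closedin_closure_of])
  fix y assume "y \<in> topspace (Pgl2 :: ('a^2^2) set topology)"
  then obtain x where x: "x \<noteq> 0" "y = proj_class x" by (auto simp: topspace_Pgl2)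
  let ?S = "{z. z \<noteq> 0 \<and> F z = F x}"
  have "open ?S"
    unfolding open_mnorm
  proof
    fix z assume z: "z \<in> ?S"
    then obtain e where e: "e > 0" "\<forall>y. mnorm (y - z) < e \<longrightarrow> F y = F z" using Sch_near[OF F] by blast
    \<comment> \<open>Closer to z than its norm, the norm stays constant; this keeps w away from the
      zero matrix.\<close>
    have "w \<in> ?S" if "mnorm (w - z) < min e (mnorm z)" for w
    proof -
      have "mnorm w = mnorm z" using that by (intro mnorm_eq_near) simp
      then have "w \<noteq> 0" using z mnorm_zero mnorm_eq_0 by (metis (mono_tags, lifting) mem_Collect_eq)
      moreover have "F w = F z" using e(2) that by (metis min_less_iff_conj)
      ultimately show ?thesis using z by simp
    qed
    then show "\<exists>e>0. \<forall>w. mnorm (w - z) < e \<longrightarrow> w \<in> ?S"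
      using e(1) z by (intro exI[of _ "min e (mnorm z)"]) simp
  qed
  moreover have "{z. z \<noteq> 0 \<and> proj_class z \<in> proj_class ` ?S} = ?S"
  proof (intro equalityI subsetI)
    fix z assume "z \<in> {z. z \<noteq> 0 \<and> proj_class z \<in> proj_class ` ?S}"
    then obtain w where "z \<noteq> 0" "F w = F x" "proj_class z = proj_class w" by auto
    then show "z \<in> ?S" using Sch_scale[OF F] by (auto simp: proj_class_eq_iff)
  qed auto
  ultimately have "openin Pgl2 (proj_class ` ?S)" by (auto simp: openin_Pgl2)
  moreover have "lift_fun F z = lift_fun F y" if "z \<in> proj_class ` ?S" for z
    using that x by (auto simp: lift_fun_class[OF F])
  moreover have "y \<in> proj_class ` ?S" using x by auto
  ultimately show "\<exists>U. openin Pgl2 U \<and> y \<in> U \<and> (\<forall>z\<in>U. lift_fun F z = lift_fun F y)" by blast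
qed

lemma schwartz_comp_proj_class:
  assumes f: "f \<in> schwartz Pgl2"
  shows "f \<circ> proj_class \<in> Sch"
  unfolding Sch_def mem_Collect_eq
proof (intro conjI allI impI)
  have out: "f y = 0" if "y \<notin> topspace Pgl2" for y using f that by (simp add: schwartz_def)
  show "(f \<circ> proj_class) 0 = 0" by (simp add: out)
  show "(f \<circ> proj_class) (mat c ** x) = (f \<circ> proj_class) x" if "c \<noteq> 0" for c x using that by simp
  fix x :: "'a^2^2" assume "x \<noteq> 0"
  have "\<forall>y\<in>topspace Pgl2. \<exists>U. openin Pgl2 U \<and> y \<in> U \<and> (\<forall>z\<in>U. f z = f y)"
    using f by (simp add: schwartz_def)
  from bspec[OF this, of "proj_class x"] \<open>x \<noteq> 0\<close>
  obtain U where U: "openin Pgl2 U" "proj_class x \<in> U" "\<forall>z\<in>U. f z = f (proj_class x)"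
    by auto
  have "open {z. z \<noteq> 0 \<and> proj_class z \<in> U}" "x \<in> {z. z \<noteq> 0 \<and> proj_class z \<in> U}"
    using U \<open>x \<noteq> 0\<close> by (auto simp: openin_Pgl2)
  then obtain e where "e > 0" "\<And>y. mnorm (y - x) < e \<Longrightarrow> y \<in> {z. z \<noteq> 0 \<and> proj_class z \<in> U}"
    unfolding open_mnorm by blast
  then show "\<exists>e>0. \<forall>y. mnorm (y - x) < e \<longrightarrow> (f \<circ> proj_class) y = (f \<circ> proj_class) x"
    using U(3) by (intro exI[of _ e]) auto
qed

lemma lift_fun_comp_proj_class:
  assumes f: "f \<in> schwartz Pgl2"
  shows "lift_fun (f \<circ> proj_class) = f"
proof
  fix y
  show "lift_fun (f \<circ> proj_class) y = f y"
  proof (cases "y \<in> topspace Pgl2")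
    case True
    then obtain x where "x \<noteq> 0" "y = proj_class x" by (auto simp: topspace_Pgl2)
    then show ?thesis using lift_fun_class[OF schwartz_comp_proj_class[OF f]] by simp
  next
    case False
    then show ?thesis using f by (simp add: lift_fun_def schwartz_def)
  qed
qed

lemma lift_fun_act:
  assumes gh: "invertible g" "invertible h" and F: "F \<in> Sch"
  shows "ract (schwartz_rep H_group H_act Pgl2) (proj_class g, proj_class h) (lift_fun F) = lift_fun (mact g h F)"
proof
  fix y
  show "ract (schwartz_rep H_group H_act Pgl2) (proj_class g, proj_class h) (lift_fun F) y = lift_fun (mact g h F) y"
  proof (cases "y \<in> topspace Pgl2")
    case True
    then obtain x where x: "x \<noteq> 0" "y = proj_class x" by (auto simp: topspace_Pgl2)
    have "H_act (inv\<^bsub>H_group\<^esub> (proj_class g, proj_class h)) y = proj_class (matrix_inv g ** x ** h)"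
      using gh by (simp add: inv_H x H_act_proj_class)
    then show ?thesis
      using True x gh by (simp add: schwartz_rep_def lift_fun_class F mact_Sch mact_apply)
  qed (simp add: schwartz_rep_def lift_fun_def)
qed

lemma vector_space_pointwise:
  assumes "vector_space s"
  shows "vector_space (\<lambda>c (f :: 'x \<Rightarrow> 'v::ab_group_add) v. s c (f v))"
proof -
  interpret vector_space s by (rule assms)
  show ?thesis
    by unfold_locales (simp_all add: fun_eq_iff scale_right_distrib scale_left_distrib)
qed

lemma edim_le_1:
  assumes "vector_space s" and sub: "\<And>x. x \<in> S \<Longrightarrow> \<exists>c. x = s c x0"
  shows "edim s S \<le> 1"
proof -
  interpret vector_space s by (rule assms)
  have "S \<subseteq> span {x0}"
  proof
    fix x assume "x \<in> S"
    then obtain c where "x = s c x0" using sub by blast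
    then show "x \<in> span {x0}" by (simp add: span_scale span_base)
  qed
  then have "finite_dimensional s S" "dim S \<le> card {x0}"
    using dim_le_card[of S "{x0}"] unfolding finite_dimensional_def by auto
  then show ?thesis by (simp add: edim_def one_enat_def)
qed

lemma dim_Hom_le_1:
  fixes \<sigma> :: "(('a::nonarch_local_field^2^2) set \<times> ('a^2^2) set, 'v::ab_group_add) crep"
  assumes V: "irreducible_admissible (rscale \<sigma>) (rspace \<sigma>) \<rho>"
    and act: "\<And>g h v. invertible g \<Longrightarrow> invertible h \<Longrightarrow> v \<in> rspace \<sigma> \<Longrightarrow> ract \<sigma> (proj_class g, proj_class h) v = \<rho> g h v"
  shows "dim_Hom H_group (schwartz_rep H_group H_act Pgl2) \<sigma> \<le> 1"
proof -
  interpret irreducible_admissible "rscale \<sigma>" "rspace \<sigma>" \<rho> by (rule V)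
  let ?X = "schwartz_rep H_group H_act (Pgl2 :: ('a^2^2) set topology)"
  let ?H = "Hom_rep H_group ?X \<sigma>" and ?s = "\<lambda>c f v. rscale \<sigma> c (f v)"
  have X: "rspace ?X = schwartz Pgl2" "rscale ?X = fscale"
    by (simp_all add: schwartz_rep_def fscale_def fun_eq_iff)
  obtain \<phi>0 where \<phi>0: "\<And>\<phi>. rep_hom fscale Sch mact (rscale \<sigma>) (rspace \<sigma>) \<rho> \<phi> \<Longrightarrow>
      \<exists>c. \<forall>F\<in>Sch. \<phi> F = rscale \<sigma> c (\<phi>0 F)"
    using Sch_hom_unique by blast
  \<comment> \<open>Elements of \<open>Hom_rep\<close> vanish off the Schwartz space, so the
    spanning vector is cut off there as well.\<close>
  define f0 where "f0 f = (if f \<in> schwartz Pgl2 then \<phi>0 (f \<circ> proj_class) else 0)" for f :: "('a^2^2) set \<Rightarrow> complex"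
  show ?thesis
    unfolding dim_Hom_def
  proof (rule edim_le_1[OF vector_space_pointwise[OF vector_space]])
    fix f assume f: "f \<in> ?H"
    have lift_add: "lift_fun (F + G) = lift_fun F + lift_fun G"
      and lift_scale: "lift_fun (fscale c F) = fscale c (lift_fun F)" for F G :: "'a^2^2 \<Rightarrow> complex" and c
      by (simp_all add: fun_eq_iff lift_fun_def)
    have "rep_hom fscale Sch mact (rscale \<sigma>) (rspace \<sigma>) \<rho> (\<lambda>F. f (lift_fun F))"
      unfolding rep_hom_def
    proof (intro conjI ballI allI impI)
      fix F :: "'a^2^2 \<Rightarrow> complex" assume F: "F \<in> Sch"
      note lF = lift_fun_schwartz[OF F]
      show in_V: "f (lift_fun F) \<in> rspace \<sigma>" using f lF by (simp add: Hom_rep_def X)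
      show "f (lift_fun (fscale c F)) = rscale \<sigma> c (f (lift_fun F))" for c
        using f lF by (simp add: Hom_rep_def X lift_scale)
      show "f (lift_fun (F + G)) = f (lift_fun F) + f (lift_fun G)" if "G \<in> Sch" for G
        using f lF lift_fun_schwartz[OF that] by (simp add: Hom_rep_def X lift_add)
      show "f (lift_fun (mact g h F)) = \<rho> g h (f (lift_fun F))" if gh: "invertible g" "invertible h" for g h
      proof -
        have "f (ract ?X (proj_class g, proj_class h) (lift_fun F)) = ract \<sigma> (proj_class g, proj_class h) (f (lift_fun F))"
          using f lF proj_class_in_H[OF gh] unfolding Hom_rep_def X by blast
        then show ?thesis using act[OF gh in_V] by (simp add: lift_fun_act[OF gh F])
      qed
    qed
    then obtain c where c: "\<And>F. F \<in> Sch \<Longrightarrow> f (lift_fun F) = rscale \<sigma> c (\<phi>0 F)" using \<phi>0 by blast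
    have "f = ?s c f0"
    proof
      fix v
      show "f v = rscale \<sigma> c (f0 v)"
      proof (cases "v \<in> schwartz Pgl2")
        case True
        then show ?thesis
          using c[OF schwartz_comp_proj_class[OF True]] by (simp add: lift_fun_comp_proj_class f0_def)
      next
        case False
        then show ?thesis using f by (simp add: Hom_rep_def X f0_def)
      qed
    qed
    then show "\<exists>c. f = (\<lambda>v. rscale \<sigma> c (f0 v))" by blast
  qed
qed

lemma irreducible_admissible_rep:
  fixes \<pi> :: "(('a::nonarch_local_field^2^2) set \<times> ('a^2^2) set, 'v::ab_group_add) crep"
  assumes rep: "representation H_group \<pi>" and irr: "irreducible_rep H_group \<pi>" and adm: "admissible_rep H_group H_top \<pi>"
  defines "\<rho> \<equiv> \<lambda>g h. ract \<pi> (proj_class g, proj_class h)"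
  shows "irreducible_admissible (rscale \<pi>) (rspace \<pi>) \<rho>"
proof -
  have r: "\<And>x v. x \<in> carrier H_group \<Longrightarrow> v \<in> rspace \<pi> \<Longrightarrow> ract \<pi> x v \<in> rspace \<pi>"
    "\<And>x v w. x \<in> carrier H_group \<Longrightarrow> v \<in> rspace \<pi> \<Longrightarrow> w \<in> rspace \<pi> \<Longrightarrow> ract \<pi> x (v + w) = ract \<pi> x v + ract \<pi> x w"
    "\<And>x c v. x \<in> carrier H_group \<Longrightarrow> v \<in> rspace \<pi> \<Longrightarrow> ract \<pi> x (rscale \<pi> c v) = rscale \<pi> c (ract \<pi> x v)"
    "\<And>v. v \<in> rspace \<pi> \<Longrightarrow> ract \<pi> \<one>\<^bsub>H_group\<^esub> v = v"
    "\<And>x y v. x \<in> carrier H_group \<Longrightarrow> y \<in> carrier H_group \<Longrightarrow> v \<in> rspace \<pi> \<Longrightarrow> ract \<pi> (x \<otimes>\<^bsub>H_group\<^esub> y) v = ract \<pi> x (ract \<pi> y v)"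
    using rep unfolding representation_def by blast+
  have \<rho>: "ract \<pi> (proj_class g, proj_class h) = \<rho> g h" for g h by (simp add: \<rho>_def)
  interpret smooth_rep "rscale \<pi>" "rspace \<pi>" \<rho>
  proof (rule smooth_rep.intro)
    show "vector_space (rscale \<pi>)" "module.subspace (rscale \<pi>) (rspace \<pi>)"
      using rep by (auto simp: representation_def)
    fix v assume v: "v \<in> rspace \<pi>"
    show "\<rho> (mat 1) (mat 1) v = v" using r(4)[OF v] by (simp add: \<rho>_def one_H)
    have "openin H_top (stabilizer_in H_group \<pi> v)"
      using adm v by (auto simp: admissible_rep_def smooth_vectors_def)
    moreover have "(proj_class (mat 1), proj_class (mat 1)) \<in> stabilizer_in H_group \<pi> v"
      using r(4)[OF v] by (simp add: stabilizer_in_def one_H)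
    ultimately have "\<exists>\<delta>>0. \<delta> < 1 \<and> (\<forall>g\<in>congr \<delta>. \<forall>h\<in>congr \<delta>. (proj_class g, proj_class h) \<in> stabilizer_in H_group \<pi> v)"
      by (rule H_open_near_1)
    then show "\<exists>\<delta>>0. \<delta> < 1 \<and> (\<forall>g\<in>congr \<delta>. \<forall>h\<in>congr \<delta>. \<rho> g h v = v)"
      by (auto simp: stabilizer_in_def \<rho>_def)
  next
    show "\<rho> (g ** g') (h ** h') v = \<rho> g h (\<rho> g' h' v)"
      if "invertible g" "invertible h" "invertible g'" "invertible h'" "v \<in> rspace \<pi>" for g h g' h' v
      using r(5)[OF proj_class_in_H[OF that(1,2)] proj_class_in_H[OF that(3,4)] that(5)] that
      by (simp add: \<rho>_def mult_H)
  qed (simp_all add: \<rho>_def r)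
  show ?thesis
  proof unfold_locales
    show irreducible
      unfolding irreducible_def
    proof (intro conjI allI impI)
      show "rspace \<pi> \<noteq> {0}" using irr by (simp add: irreducible_rep_def)
      fix W assume "invariant W"
      then have "subspace W" "W \<subseteq> rspace \<pi>" "\<forall>x\<in>carrier H_group. \<forall>w\<in>W. ract \<pi> x w \<in> W"
        by (auto simp: invariant_def carrier_H \<rho>)
      then show "W = {0} \<or> W = rspace \<pi>" using irr unfolding irreducible_rep_def by blast
    qed
    fix \<delta> :: real assume d: "0 < \<delta>" "\<delta> < 1"
    let ?K = "proj_class ` (congr \<delta> :: ('a^2^2) set)"
    have "finite_dimensional (rscale \<pi>) (invariants \<pi> (?K \<times> ?K))"
      using adm congr_subgroup_H[OF d, where 'a = 'a] by (simp add: admissible_rep_def)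
    moreover have "invariants \<pi> (?K \<times> ?K) = fixed (congr \<delta>) (congr \<delta>)"
      by (auto simp: invariants_def fixed_def \<rho>)
    ultimately show "finite_dimensional (rscale \<pi>) (fixed (congr \<delta>) (congr \<delta>))" by simp
  qed
qed

text \<open>A stabilizer in the dual is closed under products, so it is open as soon as it contains
  the classes of a congruence neighbourhood. Thus the contragredient is \<open>smooth_dual\<close>,
  and the general bound applies.\<close>

lemma dim_Hom_contragredient_le_1:
  fixes \<pi> :: "(('a::nonarch_local_field^2^2) set \<times> ('a^2^2) set, 'v::ab_group_add) crep"
  assumes "representation H_group \<pi>" "irreducible_rep H_group \<pi>" "admissible_rep H_group H_top \<pi>"
  shows "dim_Hom H_group (schwartz_rep H_group H_act Pgl2) (contragredient H_group H_top \<pi>) \<le> 1"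
proof -
  define \<rho> where "\<rho> = (\<lambda>g h. ract \<pi> (proj_class (g :: 'a^2^2), proj_class h))"
  interpret irreducible_admissible "rscale \<pi>" "rspace \<pi>" \<rho>
    unfolding \<rho>_def by (rule irreducible_admissible_rep[OF assms])
  let ?D = "dual_rep H_group \<pi>" and ?C = "contragredient H_group H_top \<pi>"
  have \<rho>: "ract \<pi> (proj_class g, proj_class h) = \<rho> g h" for g h by (simp add: \<rho>_def)
  have D: "ract ?D (proj_class g, proj_class h) l = dact g h l" if "invertible g" "invertible h" for g h l
    using that by (auto simp: dual_rep_def dact_def \<rho> inv_H fun_eq_iff)
  have rD: "rspace ?D = dual" by (simp add: dual_rep_def dual_def)
  have "l \<in> smooth_vectors H_group H_top ?D \<longleftrightarrow> l \<in> smooth_dual" for l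
  proof
    assume l: "l \<in> smooth_vectors H_group H_top ?D"
    then have ld: "l \<in> dual" and o: "openin H_top (stabilizer_in H_group ?D l)"
      by (simp_all add: smooth_vectors_def rD)
    have "(proj_class (mat 1), proj_class (mat 1)) \<in> stabilizer_in H_group ?D l"
      using dualD(1)[OF ld] by (auto simp: stabilizer_in_def D dact_def act_1 fun_eq_iff)
    then obtain \<delta> where d: "0 < \<delta>" "\<delta> < 1"
      "\<And>g h. g \<in> congr \<delta> \<Longrightarrow> h \<in> congr \<delta> \<Longrightarrow> (proj_class g, proj_class h) \<in> stabilizer_in H_group ?D l"
      using H_open_near_1[OF o] by blast
    have "dact g h l = l" if "g \<in> congr \<delta>" "h \<in> congr \<delta>" for g h
      using d(3)[OF that] D[OF congr_invertible[OF d(1,2) that(1)] congr_invertible[OF d(1,2) that(2)]]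
      by (simp add: stabilizer_in_def)
    then show "l \<in> smooth_dual" using ld d unfolding smooth_dual_def by blast
  next
    assume l: "l \<in> smooth_dual"
    then obtain \<delta> where d: "0 < \<delta>" "\<delta> < 1" "\<And>g h. g \<in> congr \<delta> \<Longrightarrow> h \<in> congr \<delta> \<Longrightarrow> dact g h l = l"
      unfolding smooth_dual_def by blast
    have "openin H_top (stabilizer_in H_group ?D l)"
    proof (rule openin_H_top_if[OF _ _ d(1,2)])
      show "stabilizer_in H_group ?D l \<subseteq> carrier H_group" by (auto simp: stabilizer_in_def)
      show "x \<otimes>\<^bsub>H_group\<^esub> y \<in> stabilizer_in H_group ?D l"
        if "x \<in> stabilizer_in H_group ?D l" "y \<in> stabilizer_in H_group ?D l" for x y
      proof -
        obtain g h g' h' where gh: "invertible g" "invertible h" "x = (proj_class g, proj_class h)"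
          "invertible g'" "invertible h'" "y = (proj_class g', proj_class h')"
          using \<open>x \<in> _\<close> \<open>y \<in> _\<close> by (auto simp: stabilizer_in_def carrier_H)
        then have "dact g h l = l" "dact g' h' l = l"
          using \<open>x \<in> _\<close> \<open>y \<in> _\<close> by (simp_all add: stabilizer_in_def D)
        then show ?thesis using gh by (simp add: stabilizer_in_def mult_H D invertible_mult dact_mult)
      qed
      show "(proj_class g, proj_class h) \<in> stabilizer_in H_group ?D l" if "g \<in> congr \<delta>" "h \<in> congr \<delta>" for g h
        using that d(3) by (simp add: stabilizer_in_def D congr_invertible[OF d(1,2)])
    qed
    then show "l \<in> smooth_vectors H_group H_top ?D"
      using smooth_dual_dual[OF l] by (simp add: smooth_vectors_def rD)
  qed
  then have C: "rspace ?C = smooth_dual" "rscale ?C = fscale" "ract ?C = ract ?D"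
    by (auto simp: contragredient_def dual_rep_def fscale_def fun_eq_iff)
  show ?thesis
  proof (cases "smooth_dual = {0}")
    case False
    show ?thesis
      using irreducible_admissible_dual[OF False] by (intro dim_Hom_le_1[where \<rho> = dact]) (simp_all add: C D)
  next
    \<comment> \<open>Irreducibility includes being nonzero, so a vanishing contragredient is
      treated apart: every homomorphism into it is 0.\<close>
    case True
    have "f = 0" if "f \<in> Hom_rep H_group (schwartz_rep H_group H_act Pgl2) ?C" for f
    proof
      fix v
      show "f v = 0 v"
        using that by (cases "v \<in> rspace (schwartz_rep H_group H_act Pgl2)") (auto simp: Hom_rep_def C True)
    qed
    then show ?thesis
      unfolding dim_Hom_def C
      by (intro edim_le_1[OF vector_space_pointwise[OF vector_space_fscale], of _ 0]) (auto simp: fun_eq_iff C)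
  qed
qed

theorem theoremB:
  fixes \<pi> :: "(('a::nonarch_local_field^2^2) set \<times> ('a^2^2) set, 'v::ab_group_add) crep"
  assumes "representation H_group \<pi>"
    and "irreducible_rep H_group \<pi>"
    and "admissible_rep H_group H_top \<pi>"
  shows "dim_Hom H_group (schwartz_rep H_group H_act Pgl2) \<pi> *
         dim_Hom H_group (schwartz_rep H_group H_act Pgl2) (contragredient H_group H_top \<pi>) \<le> 1"
proof -
  have "dim_Hom H_group (schwartz_rep H_group H_act Pgl2) \<pi> \<le> 1"
    by (rule dim_Hom_le_1[OF irreducible_admissible_rep[OF assms]]) simp
  with dim_Hom_contragredient_le_1[OF assms] show ?thesis
    using mult_mono[of _ "1 :: enat" _ 1] by simp
qed

end
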